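(* Let $\Bbbk$ be an algebraically closed field of characteristic zero, and let $A=A_0\oplus A_1\oplus\dots\oplus A_s$ be a positively graded finite dimensional $\Bbbk$-algebra such that $A_0$ is isomorphic as a $\Bbbk$-algebra to a product $\Bbbk\times\dots\times\Bbbk$ of copies of $\Bbbk$. Then $\operatorname{HHdim} T(A)=\infty$.
   Context: $T(A)=A\ltimes DA$ is the trivial extension: the vector space $A\oplus DA$, where $DA=\operatorname{Hom}_\Bbbk(A,\Bbbk)$ with its natural bimodule structure, with multiplication $(a,f)(b,g)=(ab,ag+fb)$. For a finite dimensional algebra $B$, $\operatorname{HH}_n(B)=\operatorname{Tor}^{B\otimes_\Bbbk B^{\mathrm{op}}}_n(B,B)$ is the $n$-th Hochschild homology group, and $\operatorname{HHdim}B=\sup\{n\mid \operatorname{HH}_n(B)\neq 0\}$. *)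

theory Defs
  imports "HOL-Computational_Algebra.Polynomial" "HOL-Library.Extended_Nat"
begin

text \<open>A finite dimensional algebra of dimension d over a field is presented by
structure constants with respect to a basis e_0, ..., e_(d-1):
c i j l is the coefficient of e_l in the product e_i e_j.
Vectors are functions nat => 'k, of which only the coordinates < d matter.\<close>

type_synonym 'k sc = "nat \<Rightarrow> nat \<Rightarrow> nat \<Rightarrow> 'k"

definition amult :: "'k::field sc \<Rightarrow> nat \<Rightarrow> (nat \<Rightarrow> 'k) \<Rightarrow> (nat \<Rightarrow> 'k) \<Rightarrow> (nat \<Rightarrow> 'k)" where
  "amult c d x y = (\<lambda>l. \<Sum>i<d. \<Sum>j<d. x i * y j * c i j l)"

definition fd_algebra :: "'k::field sc \<Rightarrow> nat \<Rightarrow> bool" where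
  "fd_algebra c d \<longleftrightarrow>
     (\<forall>x y z. \<forall>l<d. amult c d (amult c d x y) z l = amult c d x (amult c d y z) l) \<and>
     (\<exists>u. \<forall>x. \<forall>l<d. amult c d u x l = x l \<and> amult c d x u l = x l)"

text \<open>Positive grading A = A_0 + A_1 + ... + A_s, presented by a homogeneous basis:
deg i is the degree of e_i and A_p A_q is contained in A_(p+q).\<close>

definition graded_by :: "'k::field sc \<Rightarrow> nat \<Rightarrow> (nat \<Rightarrow> nat) \<Rightarrow> bool" where
  "graded_by c d deg \<longleftrightarrow> (\<forall>i<d. \<forall>j<d. \<forall>l<d. c i j l \<noteq> 0 \<longrightarrow> deg l = deg i + deg j)"

definition in_deg0 :: "nat \<Rightarrow> (nat \<Rightarrow> nat) \<Rightarrow> (nat \<Rightarrow> 'k::field) \<Rightarrow> bool" where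
  "in_deg0 d deg x \<longleftrightarrow> (\<forall>i<d. x i \<noteq> 0 \<longrightarrow> deg i = 0)"

text \<open>A_0 is isomorphic as a k-algebra to k^m: there is a linear bijection from k^m onto A_0
preserving products; it is given by the images E a (a < m) of the standard primitive
idempotents of k^m, which then form a basis of A_0 with E a * E b = delta_ab E a.\<close>

definition deg0_split :: "'k::field sc \<Rightarrow> nat \<Rightarrow> (nat \<Rightarrow> nat) \<Rightarrow> nat \<Rightarrow> (nat \<Rightarrow> nat \<Rightarrow> 'k) \<Rightarrow> bool" where
  "deg0_split c d deg m E \<longleftrightarrow>
     (\<forall>a<m. in_deg0 d deg (E a)) \<and>
     (\<forall>a<m. \<forall>b<m. \<forall>l<d. amult c d (E a) (E b) l = (if a = b then E a l else 0)) \<and>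
     (\<forall>t. (\<forall>i<d. (\<Sum>a<m. t a * E a i) = 0) \<longrightarrow> (\<forall>a<m. t a = 0)) \<and>
     (\<forall>x. in_deg0 d deg x \<longrightarrow> (\<exists>t. \<forall>i<d. x i = (\<Sum>a<m. t a * E a i)))"

definition deg0_iso_prod_field :: "'k::field sc \<Rightarrow> nat \<Rightarrow> (nat \<Rightarrow> nat) \<Rightarrow> bool" where
  "deg0_iso_prod_field c d deg \<longleftrightarrow> (\<exists>m E. deg0_split c d deg m E)"

text \<open>Basis of T(A): e_0..e_(d-1) of A, then the dual basis e_0^*..e_(d-1)^* of DA at
indices d..2d-1. Multiplication (a,f)(b,g) = (ab, ag + fb) with (ag)(x) = g(xa),
(fb)(x) = f(bx). Hence e_i e_J^* = sum_k c k i J e_k^* and e_I^* e_j = sum_k c j k I e_k^*.\<close>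

definition triv_ext :: "'k::field sc \<Rightarrow> nat \<Rightarrow> 'k sc" where
  "triv_ext c d i j l =
     (if i < d \<and> j < d then (if l < d then c i j l else 0)
      else if i < d \<and> d \<le> j \<and> j < 2*d then (if d \<le> l \<and> l < 2*d then c (l - d) i (j - d) else 0)
      else if d \<le> i \<and> i < 2*d \<and> j < d then (if d \<le> l \<and> l < 2*d then c j (l - d) (i - d) else 0)
      else 0)"

text \<open>C_n(B) = B^(tensor (n+1)), with basis the pure tensors e_w0 (x) ... (x) e_wn
indexed by words w of length n+1 over {0..<D}. A chain is a coefficient function on words.\<close>

definition words :: "nat \<Rightarrow> nat \<Rightarrow> nat list set" where
  "words D len = {w. length w = len \<and> set w \<subseteq> {..<D}}"

definition hchain :: "nat \<Rightarrow> nat \<Rightarrow> (nat list \<Rightarrow> 'k::field) \<Rightarrow> bool" where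
  "hchain D n z \<longleftrightarrow> (\<forall>w. z w \<noteq> 0 \<longrightarrow> w \<in> words D (Suc n))"

text \<open>Coefficient of e_v in b(e_w0 (x) ... (x) e_wn) for n >= 1, where
b(b0 (x)...(x) bn) = sum_(i<n) (-1)^i b0 (x)..(x) b_i b_(i+1) (x)..(x) bn
                    + (-1)^n bn b0 (x) b1 (x) ... (x) b_(n-1).\<close>

definition hbd_basis :: "'k::field sc \<Rightarrow> nat \<Rightarrow> nat list \<Rightarrow> nat list \<Rightarrow> 'k" where
  "hbd_basis c D w v =
     (let n = length w - 1 in
       (\<Sum>i<n. (-1)^i * (\<Sum>l<D. if v = take i w @ l # drop (i+2) w then c (w!i) (w!(i+1)) l else 0))
       + (-1)^n * (\<Sum>l<D. if v = l # take (n - 1) (tl w) then c (w!n) (w!0) l else 0))"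

definition hbd :: "'k::field sc \<Rightarrow> nat \<Rightarrow> nat \<Rightarrow> (nat list \<Rightarrow> 'k) \<Rightarrow> (nat list \<Rightarrow> 'k)" where
  "hbd c D n z = (\<lambda>v. \<Sum>w\<in>words D (Suc n). z w * hbd_basis c D w v)"

definition HH_nonzero :: "'k::field sc \<Rightarrow> nat \<Rightarrow> nat \<Rightarrow> bool" where
  "HH_nonzero c D n \<longleftrightarrow>
     (\<exists>z. hchain D n z \<and> (n = 0 \<or> hbd c D n z = (\<lambda>_. 0)) \<and>
          \<not> (\<exists>y. hchain D (Suc n) y \<and> hbd c D (Suc n) y = z))"

definition HHdim :: "'k::field sc \<Rightarrow> nat \<Rightarrow> enat" where
  "HHdim c D = Sup (enat ` {n. HH_nonzero c D n})"

definition alg_closed_field :: "'k::field itself \<Rightarrow> bool" where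
  "alg_closed_field _ \<longleftrightarrow> (\<forall>p :: 'k poly. degree p > 0 \<longrightarrow> (\<exists>x. poly p x = 0))"

end

theory Submission
  imports Defs "HOL-Library.Function_Algebras" "HOL-Number_Theory.Number_Theory"
begin

text \<open>Suppose that the Hochschild homology of \<open>T = T(A)\<close> vanishes in all large degrees. Choose a
basis of A consisting of primitive idempotents of degree 0 and of elements of positive degree in
the Peirce components, and put the dual basis in degrees \<open>N - deg\<close>, so that T becomes positively
graded and its top degree N is spanned by one loop at each vertex. The Hochschild complex of T
splits off the part spanned by cyclically composable words whose letters, except possibly the
first, have positive degree. In each large internal degree j this part is a finite exact complex,
namely the cone of \<open>1 - t\<close> on words of positive letters; hence, in characteristic 0, Connes' cyclic
complex is exact in degree j and its Euler characteristic is 0. Counting cyclic words by their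
period turns this into
\<open>\<Sum>n dvd j. totient n * s (j div n) = 0\<close> for all large j, where s is a signed count of closed walks.
Since the top degree is spanned by loops, the linear recursion for s is invertible over the
integers, so s is purely periodic modulo every prime l. Vanishing for large j and periodicity give
that l divides every \<open>s g\<close> with \<open>g > 0\<close>; at the period, however, s is congruent to N times the
number of vertices, which is not divisible by a large l.\<close>

section \<open>Linear algebra in spaces of functions\<close>

text \<open>In positive internal degree the normalised Hochschild complex always has Euler
  characteristic 0: as a cone of 1 - t it counts each word twice, with opposite signs. Acyclicity
  therefore says nothing at that level. The cyclic complex counts words up to rotation and is not
  balanced in this way, so exactness has to be carried over to it, which costs divisions by word
  lengths.

  Let M(t) be the matrix whose entry at (a, b) sums t^deg over the positive letters from a to b, and
  let P(t) = det(1 + M(t)). The signed counts s have generating function -t P'/P, so s g is the g-th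
  power sum of the reciprocal roots of P. One loop of top degree N at each vertex makes the leading
  coefficient of P equal to 1, like its constant term. Modulo l the roots are then nonzero elements
  of a finite field, which explains the pure periodicity; and N times the number of vertices is the
  degree of P, the formal value of s at 0. Working modulo primes replaces any discussion of where
  the complex roots lie.\<close>

abbreviation (input) fscale :: "'k::field \<Rightarrow> ('a \<Rightarrow> 'k) \<Rightarrow> 'a \<Rightarrow> 'k" where
  "fscale r f \<equiv> (\<lambda>x. r * f x)"

interpretation funs: vector_space "fscale :: 'k::field \<Rightarrow> ('a \<Rightarrow> 'k) \<Rightarrow> 'a \<Rightarrow> 'k"
  by unfold_locales (auto simp: fun_eq_iff algebra_simps)

interpretation funs_pair: vector_space_pair
  "fscale :: 'k::field \<Rightarrow> ('a \<Rightarrow> 'k) \<Rightarrow> 'a \<Rightarrow> 'k" "fscale :: 'k \<Rightarrow> ('b \<Rightarrow> 'k) \<Rightarrow> 'b \<Rightarrow> 'k"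
  by unfold_locales

text \<open>Linearity is spelt out on lambda terms because all operators below are given pointwise;
  the library's notion enters only to obtain splittings.\<close>

definition lin :: "(('a \<Rightarrow> 'k::field) \<Rightarrow> 'b \<Rightarrow> 'k) \<Rightarrow> bool" where
  "lin F \<longleftrightarrow> (\<forall>f g. F (\<lambda>x. f x + g x) = (\<lambda>y. F f y + F g y)) \<and>
             (\<forall>r f. F (\<lambda>x. r * f x) = (\<lambda>y. r * F f y))"

lemma linI:
  assumes "\<And>f g y. F (\<lambda>x. f x + g x) y = F f y + F g y"
    and "\<And>r f y. F (\<lambda>x. r * f x) y = r * F f y"
  shows "lin F"
  using assms by (auto simp: lin_def fun_eq_iff)

lemma lin_add: "lin F \<Longrightarrow> F (\<lambda>x. f x + g x) y = F f y + F g y"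
  and lin_scale: "lin F \<Longrightarrow> F (\<lambda>x. r * f x) y = r * F f y"
  by (auto simp: lin_def fun_eq_iff)

lemma lin_zero: "lin F \<Longrightarrow> F (\<lambda>x. 0) y = 0"
  using lin_scale[of F 0 "\<lambda>x. 0" y] by simp

lemma lin_minus: "lin F \<Longrightarrow> F (\<lambda>x. - f x) y = - F f y"
  using lin_scale[of F "-1" f y] by simp

lemma lin_diff: "lin F \<Longrightarrow> F (\<lambda>x. f x - g x) y = F f y - F g y"
  using lin_add[of F f "\<lambda>x. - g x" y] lin_minus[of F g y] by simp

lemma lin_sum: "lin F \<Longrightarrow> F (\<lambda>x. \<Sum>a\<in>A. f a x) y = (\<Sum>a\<in>A. F (f a) y)"
proof (induction A rule: infinite_finite_induct)
  case (insert a A)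
  then show ?case using lin_add[OF insert.prems, of "f a" "\<lambda>x. \<Sum>a\<in>A. f a x" y] by simp
qed (auto simp: lin_zero)

lemma lin_comp: "lin F \<Longrightarrow> lin G \<Longrightarrow> lin (\<lambda>f. F (G f))"
  by (auto simp: lin_def)

definition supported :: "'a set \<Rightarrow> ('a \<Rightarrow> 'k::zero) \<Rightarrow> bool" where
  "supported A f \<longleftrightarrow> (\<forall>x. x \<notin> A \<longrightarrow> f x = 0)"

definition ind :: "'a \<Rightarrow> 'a \<Rightarrow> 'k::field" where
  "ind a = (\<lambda>x. if x = a then 1 else 0)"

lemma supported_ind: "a \<in> A \<Longrightarrow> supported A (ind a)"
  by (auto simp: supported_def ind_def)

lemma supported_expand:
  assumes "finite A" "supported A f"
  shows "f = (\<lambda>x. \<Sum>a\<in>A. f a * ind a x)"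
proof
  fix x
  have "(\<Sum>a\<in>A. f a * ind a x) = (\<Sum>a\<in>A. if a = x then f a else 0)"
    by (intro sum.cong) (auto simp: ind_def)
  then show "f x = (\<Sum>a\<in>A. f a * ind a x)"
    using assms by (auto simp: supported_def)
qed

lemma lin_expand:
  assumes "finite A" "supported A f" "lin F"
  shows "F f y = (\<Sum>a\<in>A. f a * F (ind a) y)"
  by (subst supported_expand[OF assms(1,2)])
     (simp add: lin_sum[OF assms(3)] lin_scale[OF assms(3)])

text \<open>A linear section over the image of \<open>V\<close>, extended to all functions with its
  values kept in \<open>V\<close>. It serves twice: for the contracting homotopy, and for dualising
  exactness from chains to cochains.\<close>

lemma lin_right_inverse:
  fixes F :: "('a \<Rightarrow> 'k::field) \<Rightarrow> 'b \<Rightarrow> 'k"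
  assumes F: "lin F" and V0: "(\<lambda>_. 0) \<in> V"
    and Va: "\<And>f g. f \<in> V \<Longrightarrow> g \<in> V \<Longrightarrow> (\<lambda>x. f x + g x) \<in> V"
    and Vs: "\<And>r f. f \<in> V \<Longrightarrow> (\<lambda>x. r * f x) \<in> V"
  shows "\<exists>G. lin G \<and> (\<forall>g. G g \<in> V) \<and> (\<forall>v\<in>V. F (G (F v)) = F v)"
proof -
  have lF: "Vector_Spaces.linear fscale fscale F"
    using F by unfold_locales (auto simp: lin_def fun_eq_iff plus_fun_def)
  have sub: "funs.subspace V"
    using V0 Va Vs by (auto simp: funs.subspace_def zero_fun_def plus_fun_def)
  obtain G where G: "range G \<subseteq> V" "Vector_Spaces.linear fscale fscale G" "\<forall>v\<in>F ` V. F (G v) = v"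
    using funs_pair.linear_exists_right_inverse_on[OF lF sub] by auto
  interpret G: Vector_Spaces.linear fscale fscale G by fact
  have "lin G"
    using G.add G.scale by (auto simp: lin_def plus_fun_def)
  then show ?thesis using G by auto
qed

lemma trace_commute:
  fixes X :: "('a \<Rightarrow> 'k::field) \<Rightarrow> 'a \<Rightarrow> 'k"
  assumes "finite A" "lin X" "lin Y"
    and "\<And>f. supported A f \<Longrightarrow> supported A (X f)" "\<And>f. supported A f \<Longrightarrow> supported A (Y f)"
  shows "(\<Sum>a\<in>A. X (Y (ind a)) a) = (\<Sum>a\<in>A. Y (X (ind a)) a)"
proof -
  have "(\<Sum>a\<in>A. X (Y (ind a)) a) = (\<Sum>a\<in>A. \<Sum>e\<in>A. Y (ind a) e * X (ind e) a)"
    by (intro sum.cong refl lin_expand assms supported_ind)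
  also have "\<dots> = (\<Sum>e\<in>A. \<Sum>a\<in>A. X (ind e) a * Y (ind a) e)"
    by (subst sum.swap) (simp add: mult.commute)
  also have "\<dots> = (\<Sum>a\<in>A. Y (X (ind a)) a)"
    by (intro sum.cong refl lin_expand[symmetric] assms supported_ind)
  finally show ?thesis .
qed

text \<open>A right inverse of the differential yields a contracting homotopy h of the image of the
projection P; the identity 1 = bh + hb on that image is then traced against the sign eps,
with which b anticommutes.\<close>

lemma supertrace_exact:
  fixes b P :: "('a \<Rightarrow> 'k::field) \<Rightarrow> 'a \<Rightarrow> 'k"
  assumes fin: "finite A" and b: "lin b" and P: "lin P"
    and bA: "\<And>f. supported A f \<Longrightarrow> supported A (b f)"
    and PA: "\<And>f. supported A f \<Longrightarrow> supported A (P f)"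
    and PP: "\<And>f. P (P f) = P f" and Pb: "\<And>f. P (b (P f)) = b (P f)"
    and bb: "\<And>f. b (b f) = (\<lambda>_. 0)"
    and eP: "\<And>f. P (\<lambda>x. eps x * f x) = (\<lambda>x. eps x * P f x)"
    and eb: "\<And>f. b (\<lambda>x. eps x * f x) = (\<lambda>x. - (eps x * b f x))"
    and exact: "\<And>f. supported A f \<Longrightarrow> P f = f \<Longrightarrow> b f = (\<lambda>_. 0) \<Longrightarrow>
        \<exists>g. supported A g \<and> P g = g \<and> b g = f"
  shows "(\<Sum>a\<in>A. eps a * P (ind a) a) = 0"
proof -
  define V where "V = {f. supported A f \<and> P f = f}"
  have V0: "(\<lambda>_. 0) \<in> V" using lin_zero[OF P] by (auto simp: V_def supported_def)
  have Va: "(\<lambda>x. f x + g x) \<in> V" if "f \<in> V" "g \<in> V" for f g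
    using that lin_add[OF P, of f g] by (auto simp: V_def supported_def fun_eq_iff)
  have Vs: "(\<lambda>x. r * f x) \<in> V" if "f \<in> V" for f r
    using that lin_scale[OF P, of r f] by (auto simp: V_def supported_def fun_eq_iff)
  obtain g where g0: "lin g \<and> (\<forall>f. g f \<in> V) \<and> (\<forall>v\<in>V. b (g (b v)) = b v)"
    using lin_right_inverse[OF b V0 Va Vs] by (rule exE)
  then have g: "lin g" "\<And>f. g f \<in> V" "\<And>v. v \<in> V \<Longrightarrow> b (g (b v)) = b v"
    by blast+
  have bV: "b f \<in> V" if "f \<in> V" for f
    using that bA Pb[of f] by (auto simp: V_def)
  have bg: "b (g f) = f" if f: "f \<in> V" and bf: "b f = (\<lambda>_. 0)" for f
  proof -
    obtain v where "v \<in> V" "b v = f" using exact[of f] f bf by (auto simp: V_def)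
    then show ?thesis using g(3) by auto
  qed
  \<comment> \<open>The section \<open>g\<close> inverts \<open>b\<close> only on cycles.
    Subtracting \<open>g (b f)\<close> first turns the argument into a cycle, which makes
    \<open>b h + h b\<close> the identity on \<open>V\<close>.\<close>
  define h where "h = (\<lambda>f. g (\<lambda>x. f x - g (b f) x))"
  have hlin: "lin h"
  proof -
    have gb: "lin (\<lambda>f. g (b f))" by (rule lin_comp[OF g(1) b])
    have "lin (\<lambda>f x. f x - g (b f) x)"
      by (rule linI) (simp_all add: lin_add[OF gb] lin_scale[OF gb] algebra_simps)
    from lin_comp[OF g(1) this] show ?thesis unfolding h_def .
  qed
  have hV: "h f \<in> V" for f by (simp add: h_def g)
  have hom: "f x = b (h f) x + h (b f) x" if "f \<in> V" for f x
  proof -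
    have diffV: "(\<lambda>x. f x - g (b f) x) \<in> V"
      using that g(2)[of "b f"] lin_diff[OF P] by (auto simp: V_def supported_def fun_eq_iff)
    have "b (\<lambda>x. f x - g (b f) x) = (\<lambda>_. 0)"
      using g(3)[OF that] by (auto simp: lin_diff[OF b] fun_eq_iff)
    from bg[OF diffV this] have 1: "b (h f) x = f x - g (b f) x" by (simp add: h_def)
    have "h (b f) x = g (\<lambda>x. b f x - g (\<lambda>_. 0) x) x" by (simp add: h_def bb)
    also have "\<dots> = g (b f) x" using lin_zero[OF g(1)] by simp
    finally show ?thesis using 1 by simp
  qed
  have PV: "P f \<in> V" if "supported A f" for f using that PA PP by (auto simp: V_def)
  have supV: "supported A f" if "f \<in> V" for f using that by (auto simp: V_def)
  define e where "e = (\<lambda>f x. eps x * (f :: 'a \<Rightarrow> 'k) x)"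
  have elin: "lin e" by (rule linI) (auto simp: e_def algebra_simps)
  have eA: "supported A (e f)" if "supported A f" for f
    using that by (auto simp: e_def supported_def)
  have eind: "e (ind a) = (\<lambda>x. eps a * ind a x)" for a
    by (auto simp: e_def ind_def fun_eq_iff)
  have XA: "supported A (e (b (P f)))" and YA: "supported A (h (P f))" if "supported A f" for f
    using eA[OF bA[OF PA[OF that]]] supV[OF hV] by auto
  have "(\<Sum>a\<in>A. eps a * P (ind a) a)
      = (\<Sum>a\<in>A. e (b (P (h (P (ind a))))) a) + (\<Sum>a\<in>A. e (h (b (P (ind a)))) a)"
    unfolding sum.distrib[symmetric]
  proof (rule sum.cong[OF refl])
    fix a assume a: "a \<in> A"
    show "eps a * P (ind a) a = e (b (P (h (P (ind a))))) a + e (h (b (P (ind a)))) a"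
      using hom[OF PV[OF supported_ind[OF a]], of a] hV[of "P (ind a)"]
      by (simp add: e_def V_def algebra_simps)
  qed
  \<comment> \<open>Cyclicity of the trace moves \<open>h\<close> to the front; pulling the sign
    \<open>e\<close> back through \<open>b\<close> then yields minus the other trace, so the two
    cancel.\<close>
  also have "(\<Sum>a\<in>A. e (b (P (h (P (ind a))))) a) = (\<Sum>a\<in>A. h (P (e (b (P (ind a))))) a)"
    by (rule trace_commute[OF fin lin_comp[OF elin lin_comp[OF b P]] lin_comp[OF hlin P] XA YA])
  also have "\<dots> = (\<Sum>a\<in>A. - (h (b (P (e (ind a)))) a))"
  proof (rule sum.cong[OF refl])
    fix a
    have "P (e (b (P (ind a)))) = e (b (P (ind a)))"
      using eP[of "b (P (ind a))"] Pb[of "ind a"] by (simp add: e_def)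
    also have "\<dots> = (\<lambda>x. - b (P (e (ind a))) x)"
      using eb[of "P (ind a)"] eP[of "ind a"] by (auto simp: e_def)
    finally show "h (P (e (b (P (ind a))))) a = - h (b (P (e (ind a)))) a"
      using lin_minus[OF hlin] by simp
  qed
  also have "(\<Sum>a\<in>A. - (h (b (P (e (ind a)))) a)) = - (\<Sum>a\<in>A. e (h (b (P (ind a)))) a)"
  proof -
    have "lin (\<lambda>f. h (b (P f)))" by (rule lin_comp[OF hlin lin_comp[OF b P]])
    from lin_scale[OF this] have "h (b (P (e (ind a)))) a = e (h (b (P (ind a)))) a" for a
      unfolding eind by (simp add: e_def)
    then show ?thesis by (simp add: sum_negf)
  qed
  finally show ?thesis by simp
qed

section \<open>Cyclic operators on cochains\<close>

definition rot :: "nat \<Rightarrow> (nat list \<Rightarrow> 'k::field) \<Rightarrow> nat list \<Rightarrow> 'k" where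
  "rot i \<psi> w = (-1) ^ ((length w - 1) * i) * \<psi> (rotate i w)"

text \<open>The inverse of \<open>rot i\<close>, written with two reversals so that \<open>i\<close>
  stays unbounded and is never subtracted from the length.\<close>

definition rotr :: "nat \<Rightarrow> (nat list \<Rightarrow> 'k::field) \<Rightarrow> nat list \<Rightarrow> 'k" where
  "rotr i \<psi> w = (-1) ^ ((length w - 1) * i) * \<psi> (rev (rotate i (rev w)))"

text \<open>Transpose of multiplying the first two tensor factors. The value 0 on shorter words
  makes coboundaries vanish on words of length at most 1.\<close>

fun front_face :: "'k::field sc \<Rightarrow> nat \<Rightarrow> (nat list \<Rightarrow> 'k) \<Rightarrow> nat list \<Rightarrow> 'k" where
  "front_face c D \<psi> (x # y # w) = (\<Sum>l<D. c x y l * \<psi> (l # w))"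
| "front_face c D \<psi> [] = 0"
| "front_face c D \<psi> [x] = 0"

text \<open>The sign in rot is that of the cyclic operator, so conjugating the front face by rot i
yields the i-th face of the Hochschild complex together with its sign.\<close>

definition face :: "'k::field sc \<Rightarrow> nat \<Rightarrow> nat \<Rightarrow> (nat list \<Rightarrow> 'k) \<Rightarrow> nat list \<Rightarrow> 'k" where
  "face c D i \<psi> = rot i (front_face c D (rotr i \<psi>))"

definition cobd :: "'k::field sc \<Rightarrow> nat \<Rightarrow> (nat list \<Rightarrow> 'k) \<Rightarrow> nat list \<Rightarrow> 'k" where
  "cobd c D \<psi> w = (\<Sum>i<length w. face c D i \<psi> w)"

text \<open>The wrap-around face is left out: this is the transpose of the bar differential b', as
  \<open>cobd\<close> is that of the Hochschild differential b.\<close>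

definition cobd' :: "'k::field sc \<Rightarrow> nat \<Rightarrow> (nat list \<Rightarrow> 'k) \<Rightarrow> nat list \<Rightarrow> 'k" where
  "cobd' c D \<psi> w = (\<Sum>i<length w - 1. face c D i \<psi> w)"

definition cnorm :: "(nat list \<Rightarrow> 'k::field) \<Rightarrow> nat list \<Rightarrow> 'k" where
  "cnorm \<psi> w = (\<Sum>i<length w. rot i \<psi> w)"

section \<open>Algebra of the signed rotations\<close>

lemma rotate_rev_rotate: "rotate i (rev (rotate i w)) = rev w"
proof (induction i arbitrary: w)
  case (Suc i)
  have *: "rotate1 (rev (rotate1 u)) = rev u" for u :: "'a list"
    by (cases u) auto
  have "rotate (Suc i) (rev (rotate (Suc i) w)) = rotate i (rotate1 (rev (rotate1 (rotate i w))))"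
    by (simp add: rotate1_rotate_swap)
  then show ?case using Suc by (simp add: *)
qed auto

lemma sign_sq: "(-1) ^ k * ((-1) ^ k * x) = (x :: 'k::field)"
  by (simp add: mult.assoc[symmetric] power_add[symmetric])

lemma rot_rot: "rot i (rot j \<psi>) = rot (i + j) \<psi>"
  by (auto simp: rot_def fun_eq_iff rotate_rotate add.commute power_add distrib_left)

lemma rotr_rotr: "rotr i (rotr j \<psi>) = rotr (i + j) \<psi>"
  by (auto simp: rotr_def fun_eq_iff rotate_rotate add.commute power_add distrib_left)

lemma rot_rotr: "rot i (rotr i \<psi>) = \<psi>"
  by (auto simp: rot_def rotr_def fun_eq_iff rotate_rev_rotate sign_sq)

lemma rotr_rot: "rotr i (rot i \<psi>) = \<psi>"
proof
  fix w :: "nat list"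
  have "rotate i (rev (rotate i (rev w))) = w"
    using rotate_rev_rotate[of i "rev w"] by simp
  then show "rotr i (rot i \<psi>) w = \<psi> w"
    by (simp add: rot_def rotr_def sign_sq)
qed

lemma rot_0 [simp]: "rot 0 \<psi> = \<psi>" and rotr_0 [simp]: "rotr 0 \<psi> = \<psi>"
  by (auto simp: rot_def rotr_def fun_eq_iff)

lemma sign_pred_mult: "(-1) ^ ((n - Suc 0) * n) = (1 :: 'k::field)"
  by (rule neg_one_even_power) (cases n, auto)

lemma rot_length: "rot (length w) \<psi> w = \<psi> w"
  by (simp add: rot_def sign_pred_mult)

lemma rotr_eq_rot: "k \<le> length w \<Longrightarrow> rotr k \<psi> w = rot (length w - k) \<psi> w"
proof -
  assume k: "k \<le> length w"
  have "rot (length w - k) \<psi> w = rot (length w - k) (rot k (rotr k \<psi>)) w"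
    by (simp add: rot_rotr)
  then show ?thesis using k by (simp add: rot_rot rot_length)
qed

lemma rotr_length: "rotr (length w) \<psi> w = \<psi> w"
  by (simp add: rotr_eq_rot)

lemma rotr_1: "rotr 1 \<psi> = \<psi> \<Longrightarrow> rotr i \<psi> = \<psi>"
proof (induction i)
  case (Suc i)
  have "rotr (Suc i) \<psi> = rotr 1 (rotr i \<psi>)" by (simp only: rotr_rotr plus_1_eq_Suc)
  then show ?case using Suc by (simp only:)
qed auto

lemma rot_inv: "rotr 1 \<psi> = \<psi> \<Longrightarrow> rot i \<psi> = \<psi>"
  by (metis rotr_1 rot_rotr)

section \<open>Linearity and locality of the faces\<close>

lemma lin_rot: "lin (rot i)" and lin_rotr: "lin (rotr i)"
  by (auto intro!: linI simp: rot_def rotr_def algebra_simps)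

lemma lin_front: "lin (front_face c D)"
proof (rule linI)
  show "front_face c D (\<lambda>x. f x + g x) y = front_face c D f y + front_face c D g y" for f g y
    by (cases "(c, D, f, y)" rule: front_face.cases) (auto simp: algebra_simps sum.distrib)
  show "front_face c D (\<lambda>x. r * f x) y = r * front_face c D f y" for r f y
    by (cases "(c, D, f, y)" rule: front_face.cases) (auto simp: algebra_simps sum_distrib_left)
qed

lemma lin_face: "lin (face c D i)"
  unfolding face_def by (rule lin_comp[OF lin_rot lin_comp[OF lin_front lin_rotr]])

lemma lin_cobd: "lin (cobd c D)" and lin_cobd': "lin (cobd' c D)" and lin_cnorm: "lin cnorm"
  by (auto intro!: linI simp: cobd_def cobd'_def cnorm_def lin_add[OF lin_face] lin_scale[OF lin_face]
     lin_add[OF lin_rot] lin_scale[OF lin_rot] sum.distrib sum_distrib_left)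

lemma front_cong:
  assumes "\<And>v. Suc (length v) = length w \<Longrightarrow> set v \<subseteq> set w \<union> {..<D} \<Longrightarrow> \<psi> v = \<psi>' v"
  shows "front_face c D \<psi> w = front_face c D \<psi>' w"
  using assms by (cases "(c, D, \<psi>, w)" rule: front_face.cases)
    (auto intro!: sum.cong assms arg_cong2[where f = times])

lemma face_cong:
  assumes "\<And>v. Suc (length v) = length w \<Longrightarrow> set v \<subseteq> set w \<union> {..<D} \<Longrightarrow> \<psi> v = \<psi>' v"
  shows "face c D i \<psi> w = face c D i \<psi>' w"
  unfolding face_def rot_def
  by (rule arg_cong[where f = "\<lambda>x. _ * x"], rule front_cong) (auto simp: rotr_def intro!: assms)

lemma cobd_cong:
  assumes "\<And>v. Suc (length v) = length w \<Longrightarrow> set v \<subseteq> set w \<union> {..<D} \<Longrightarrow> \<psi> v = \<psi>' v"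
  shows "cobd c D \<psi> w = cobd c D \<psi>' w"
  unfolding cobd_def by (intro sum.cong refl face_cong assms)

lemma cobd'_cong:
  assumes "\<And>v. Suc (length v) = length w \<Longrightarrow> set v \<subseteq> set w \<union> {..<D} \<Longrightarrow> \<psi> v = \<psi>' v"
  shows "cobd' c D \<psi> w = cobd' c D \<psi>' w"
  unfolding cobd'_def by (intro sum.cong refl face_cong assms)

section \<open>The norm, invariant cochains and the two differentials\<close>

lemma sum_rot_Suc: "(\<Sum>i<length w. rot (Suc i) \<psi> w) = (\<Sum>i<length w. rot i \<psi> w)"
  using sum.lessThan_Suc_shift[of "\<lambda>i. rot i \<psi> w" "length w"]
  by (simp add: rot_length)

lemma sum_rot_shift: "(\<Sum>i<length w. rot (i + k) \<psi> w) = (\<Sum>i<length w. rot i \<psi> w)"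
proof (induction k)
  case (Suc k)
  have "(\<Sum>i<length w. rot (i + Suc k) \<psi> w) = (\<Sum>i<length w. rot (Suc i) (rot k \<psi>) w)"
    by (simp add: rot_rot)
  also have "\<dots> = (\<Sum>i<length w. rot (i + k) \<psi> w)"
    by (simp only: sum_rot_Suc) (simp only: rot_rot)
  finally show ?case using Suc by simp
qed simp

lemma cnorm_rot: "cnorm (rot k \<psi>) = cnorm \<psi>"
  by (auto simp: cnorm_def fun_eq_iff rot_rot sum_rot_shift)

lemma rot_cnorm: "rot k (cnorm \<psi>) = cnorm \<psi>"
proof
  fix w :: "nat list"
  have "rot k (cnorm \<psi>) w = (\<Sum>i<length w. rot k (rot i \<psi>) w)"
    by (simp add: rot_def cnorm_def sum_distrib_left)
  also have "\<dots> = (\<Sum>i<length w. rot (i + k) \<psi> w)"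
    by (simp only: rot_rot add.commute)
  finally show "rot k (cnorm \<psi>) w = cnorm \<psi> w" by (simp add: sum_rot_shift cnorm_def)
qed

lemma rotr_cnorm: "rotr k (cnorm \<psi>) = cnorm \<psi>"
  by (metis rot_cnorm rotr_rot)

lemma cnorm_eq_sum_rotr: "cnorm \<psi> w = (\<Sum>i<length w. rotr i \<psi> w)"
proof -
  have "(\<Sum>i<length w. rotr i \<psi> w) = (\<Sum>i<length w. rot (Suc (length w - Suc i)) \<psi> w)"
    by (intro sum.cong refl) (auto simp: rotr_eq_rot Suc_diff_Suc)
  also have "\<dots> = (\<Sum>i<length w. rot (Suc i) \<psi> w)"
    by (rule sum.nat_diff_reindex)
  finally show ?thesis by (simp only: sum_rot_Suc cnorm_def)
qed

lemma cnorm_rotr: "cnorm (rotr k \<psi>) = cnorm \<psi>"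
  by (metis cnorm_rot rot_rotr)

lemma cnorm_inv: "rotr 1 \<psi> = \<psi> \<Longrightarrow> cnorm \<psi> w = of_nat (length w) * \<psi> w"
  by (simp add: cnorm_def rot_inv)

text \<open>On an invariant cochain the inner rotation in \<open>face\<close> disappears, so the
  coboundary is a sum over all rotations. This is why the invariant cochains form a
  subcomplex.\<close>

lemma cobd_inv: "rotr 1 \<psi> = \<psi> \<Longrightarrow> cobd c D \<psi> = cnorm (front_face c D \<psi>)"
  by (auto simp: cobd_def cnorm_def face_def rotr_1 fun_eq_iff)

lemma rotr_cobd_inv: "rotr 1 \<psi> = \<psi> \<Longrightarrow> rotr 1 (cobd c D \<psi>) = cobd c D \<psi>"
  by (simp add: cobd_inv rotr_cnorm)

lemma face_rotr: "face c D i (rotr 1 \<psi>) = rotr 1 (face c D (Suc i) \<psi>)"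
proof -
  have "rotr 1 (face c D (Suc i) \<psi>) = rotr 1 (rot 1 (rot i (front_face c D (rotr (Suc i) \<psi>))))"
    by (simp add: face_def rot_rot)
  also have "\<dots> = rot i (front_face c D (rotr i (rotr 1 \<psi>)))"
    by (simp only: rotr_rot rotr_rotr) simp
  finally show ?thesis by (simp add: face_def)
qed

lemma face_0: "face c D 0 \<psi> = front_face c D \<psi>"
  by (simp add: face_def)

text \<open>On the shortened words \<open>rotr n\<close> is a full turn and drops out; on words of
  length \<open>Suc n\<close> the remaining \<open>rot n\<close> is \<open>rotr 1\<close>.\<close>

lemma face_last:
  assumes "Suc n = length w"
  shows "face c D n \<psi> w = rotr 1 (front_face c D \<psi>) w"
proof -
  have "face c D n \<psi> w = rot n (front_face c D \<psi>) w"
    unfolding face_def rot_def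
    by (rule arg_cong[where f = "\<lambda>x. _ * x"], rule front_cong)
       (use assms in \<open>auto simp: rotr_length\<close>, metis Suc_inject rotr_length)
  also have "\<dots> = rotr 1 (front_face c D \<psi>) w"
    using rotr_eq_rot[of 1 w "front_face c D \<psi>"] by (simp flip: assms)
  finally show ?thesis .
qed

lemma cobd_eq: "w \<noteq> [] \<Longrightarrow> cobd c D \<psi> w = cobd' c D \<psi> w + rotr 1 (front_face c D \<psi>) w"
  by (cases w rule: rev_cases) (simp_all add: cobd_def cobd'_def face_last)

lemma rotr_sum: "rotr k (\<lambda>w. \<Sum>i<length w - r. F i w) w = (\<Sum>i<length w - r. rotr k (F i) w)"
  by (simp add: rotr_def sum_distrib_left)

text \<open>The relation between b, b' and 1 - t in the cyclic bicomplex, dualised. Rotation shifts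
  the index of a face by one, and the face pushed out at the start is the wrap-around face, by which
  \<open>cobd\<close> exceeds \<open>cobd'\<close>.\<close>

lemma cobd'_diff:
  "cobd' c D (\<lambda>w. \<psi> w - rotr 1 \<psi> w) w = cobd c D \<psi> w - rotr 1 (cobd c D \<psi>) w"
proof (cases "w = []")
  case False
  have "rotr 1 (cobd c D \<psi>) w = rotr 1 (\<lambda>w. \<Sum>i<length w - 0. face c D i \<psi> w) w"
    by (simp add: cobd_def[abs_def])
  also have "\<dots> = (\<Sum>i<length w. rotr 1 (face c D i \<psi>) w)"
    by (simp only: rotr_sum) simp
  also have "\<dots> = (\<Sum>i<Suc (length w - 1). rotr 1 (face c D i \<psi>) w)"
    using False by simp
  also have "\<dots> = rotr 1 (front_face c D \<psi>) w + cobd' c D (rotr 1 \<psi>) w"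
    by (subst sum.lessThan_Suc_shift) (simp only: face_0 cobd'_def face_rotr)
  finally show ?thesis using False by (simp add: cobd_eq lin_diff[OF lin_cobd'])
qed (auto simp: cobd'_def cobd_def rotr_def)

text \<open>The companion relation between b, b' and the norm. Since a sum over all rotations
  absorbs shifts, both sides reduce to rotations of the front face of all
  \<open>rotr k \<psi>\<close>; the range \<open>k < L - 1\<close> is a full norm because shortened
  words have \<open>L - 1\<close> letters.\<close>

lemma cobd_cnorm: "cobd c D (cnorm \<psi>) w = cnorm (cobd' c D \<psi>) w"
proof -
  define L where "L = length w"
  have "rot i (cobd' c D \<psi>) w = (\<Sum>k<L - 1. rot (i + k) (front_face c D (rotr k \<psi>)) w)" for i
  proof -
    have "rot i (cobd' c D \<psi>) w = (\<Sum>k<L - 1. rot i (face c D k \<psi>) w)"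
      by (simp add: rot_def cobd'_def sum_distrib_left L_def)
    then show ?thesis by (simp only: face_def rot_rot)
  qed
  then have "cnorm (cobd' c D \<psi>) w = (\<Sum>k<L - 1. \<Sum>i<L. rot (i + k) (front_face c D (rotr k \<psi>)) w)"
    unfolding cnorm_def by (subst sum.swap) (simp add: L_def)
  also have "\<dots> = (\<Sum>k<L - 1. \<Sum>i<L. rot i (front_face c D (rotr k \<psi>)) w)"
    by (simp only: sum_rot_shift L_def)
  also have "\<dots> = (\<Sum>i<L. rot i (front_face c D (cnorm \<psi>)) w)"
  proof (subst sum.swap, rule sum.cong[OF refl])
    fix i
    have "(\<Sum>k<L - 1. front_face c D (rotr k \<psi>) (rotate i w))
        = front_face c D (\<lambda>v. \<Sum>k<L - 1. rotr k \<psi> v) (rotate i w)"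
      by (rule lin_sum[OF lin_front, symmetric])
    also have "\<dots> = front_face c D (cnorm \<psi>) (rotate i w)"
    proof (rule front_cong)
      fix v :: "nat list" assume "Suc (length v) = length (rotate i w)"
      then have "L - 1 = length v" by (simp add: L_def)
      then show "(\<Sum>k<L - 1. rotr k \<psi> v) = cnorm \<psi> v" by (simp add: cnorm_eq_sum_rotr)
    qed
    finally show "(\<Sum>k<L - 1. rot i (front_face c D (rotr k \<psi>)) w) = rot i (front_face c D (cnorm \<psi>)) w"
      by (simp add: rot_def sum_distrib_left[symmetric])
  qed
  also have "\<dots> = cobd c D (cnorm \<psi>) w"
    by (simp add: cobd_def face_def rotr_cnorm L_def)
  finally show ?thesis ..
qed

text \<open>An explicit solution of (1 - t) x = \<psi> for \<psi> of norm 0. Applying 1 - t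
  telescopes the i-th partial sum to \<psi> - t^i \<psi>, and the average of these is \<psi> minus
  norm over length.\<close>

definition rot_primitive :: "(nat list \<Rightarrow> 'k::field_char_0) \<Rightarrow> nat list \<Rightarrow> 'k" where
  "rot_primitive \<psi> w = (\<Sum>i<length w. \<Sum>k<i. rotr k \<psi> w) / of_nat (length w)"

lemma rot_primitive:
  assumes "w \<noteq> []" "cnorm \<psi> w = 0"
  shows "rot_primitive \<psi> w - rotr 1 (rot_primitive \<psi>) w = \<psi> w"
proof -
  have "rotr 1 (rot_primitive \<psi>) w = (\<Sum>i<length w. \<Sum>k<i. rotr 1 (rotr k \<psi>) w) / of_nat (length w)"
    by (simp add: rotr_def rot_primitive_def sum_distrib_left)
  also have "\<dots> = (\<Sum>i<length w. \<Sum>k<i. rotr (Suc k) \<psi> w) / of_nat (length w)"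
    by (simp only: rotr_rotr) simp
  finally have A: "rotr 1 (rot_primitive \<psi>) w
      = (\<Sum>i<length w. \<Sum>k<i. rotr (Suc k) \<psi> w) / of_nat (length w)" .
  have B: "(\<Sum>k<i. rotr k \<psi> w - rotr (Suc k) \<psi> w) = \<psi> w - rotr i \<psi> w" for i
    using sum_lessThan_telescope'[of "\<lambda>k. rotr k \<psi> w" i] by simp
  have "rot_primitive \<psi> w - rotr 1 (rot_primitive \<psi>) w
      = (\<Sum>i<length w. \<psi> w - rotr i \<psi> w) / of_nat (length w)"
    unfolding A rot_primitive_def
    by (simp only: sum_subtractf[symmetric] diff_divide_distrib[symmetric] B)
  also have "\<dots> = \<psi> w"
    using assms by (simp add: sum_subtractf cnorm_eq_sum_rotr)
  finally show ?thesis .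
qed

section \<open>Faces in coordinates and the signed simplicial identities\<close>

lemma face_nth:
  assumes "Suc i < length w"
  shows "face c D i \<psi> w
    = (-1) ^ i * (\<Sum>l<D. c (w ! i) (w ! Suc i) l * \<psi> (take i w @ l # drop (i + 2) w))"
proof -
  have "rotate i w = drop i w @ take i w"
    using assms by (simp add: rotate_drop_take)
  also have "\<dots> = w ! i # w ! Suc i # drop (i + 2) w @ take i w"
    using assms by (simp add: Cons_nth_drop_Suc[symmetric])
  finally have r: "rotate i w = w ! i # w ! Suc i # drop (i + 2) w @ take i w" .
  have s: "rotr i \<psi> (l # drop (i + 2) w @ take i w)
      = (-1) ^ ((length w - 2) * i) * \<psi> (take i w @ l # drop (i + 2) w)" for l
  proof -
    have "rotate i (rev (l # drop (i + 2) w @ take i w))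
        = rotate (length (rev (take i w))) (rev (take i w) @ rev (l # drop (i + 2) w))"
      using assms by simp
    also have "\<dots> = rev (l # drop (i + 2) w) @ rev (take i w)"
      by (rule rotate_append)
    finally have "rev (rotate i (rev (l # drop (i + 2) w @ take i w))) = take i w @ l # drop (i + 2) w"
      by simp
    then show ?thesis using assms by (simp add: rotr_def min_def)
  qed
  have sgn: "(-1) ^ ((length w - 1) * i) * (-1) ^ ((length w - 2) * i) = ((-1) ^ i :: 'a)"
  proof -
    have "length w - 1 = Suc (length w - 2)" using assms by simp
    then have "(-1) ^ ((length w - 1) * i) * (-1) ^ ((length w - 2) * i)
        = (-1) ^ i * ((-1) ^ ((length w - 2) * i) * ((-1) ^ ((length w - 2) * i) * (1::'a)))"
      by (simp add: power_add)
    then show ?thesis by (simp only: sign_sq) simp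
  qed
  have "face c D i \<psi> w = (-1) ^ ((length w - 1) * i) * (-1) ^ ((length w - 2) * i) *
      (\<Sum>l<D. c (w ! i) (w ! Suc i) l * \<psi> (take i w @ l # drop (i + 2) w))"
    unfolding face_def rot_def r front_face.simps s
    by (simp only: sum_distrib_left mult_ac)
  then show ?thesis by (simp only: sgn)
qed

lemma face_wrap:
  assumes "length v = n"
  shows "face c D (Suc n) \<psi> (x # v @ [y]) = (-1) ^ Suc n * (\<Sum>l<D. c y x l * \<psi> (l # v))"
proof -
  have "rev (rotate 1 (rev (x # v @ [y]))) = y # x # v" by simp
  then show ?thesis
    using assms by (subst face_last) (simp_all add: rotr_def)
qed

text \<open>The cases record where face \<open>k\<close> sits. It overlaps the front face either
  just behind it or by wrapping around, where associativity is used; otherwise the two contractions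
  are disjoint and commute. On two letters both sides are 0.\<close>

lemma front_face_face:
  assumes assoc: "\<And>x y z r. r < D \<Longrightarrow> (\<Sum>l<D. c x y l * c l z r) = (\<Sum>l<D. c y z l * c x l r)"
    and k: "k + 2 \<le> length w"
  shows "front_face c D (face c D k \<psi>) w = - face c D (Suc k) (front_face c D \<psi>) w"
proof -
  obtain x y v where w: "w = x # y # v" using k by (cases w; cases "tl w") auto
  have kv: "k \<le> length v" using k w by simp
  consider "v = []" | "k = 0" "v \<noteq> []" | "0 < k" "k < length v" | "k = length v" "v \<noteq> []"
    using kv by linarith
  then show ?thesis
  proof cases
    case 1
    then show ?thesis
      using kv face_wrap[of "[]" 0 c D "front_face c D \<psi>" x y] by (simp add: w face_0)
  next
    case 2
    then obtain z u where v: "v = z # u" by (cases v) auto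
    have "front_face c D (front_face c D \<psi>) w
        = (\<Sum>l<D. \<Sum>r<D. c x y l * c l z r * \<psi> (r # u))"
      by (simp add: w v sum_distrib_left mult.assoc)
    also have "\<dots> = (\<Sum>r<D. (\<Sum>l<D. c x y l * c l z r) * \<psi> (r # u))"
      by (subst sum.swap) (simp add: sum_distrib_right)
    also have "\<dots> = (\<Sum>r<D. (\<Sum>l<D. c y z l * c x l r) * \<psi> (r # u))"
      by (intro sum.cong refl) (simp add: assoc)
    also have "\<dots> = (\<Sum>l<D. \<Sum>r<D. c y z l * (c x l r * \<psi> (r # u)))"
      by (subst sum.swap) (simp add: sum_distrib_right mult.assoc)
    also have "\<dots> = - face c D 1 (front_face c D \<psi>) w"
      by (subst face_nth) (simp_all add: w v sum_distrib_left)
    finally show ?thesis using 2 by (simp add: face_0)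
  next
    case 3
    then obtain k' where k': "k = Suc k'" by (cases k) auto
    have "front_face c D (face c D k \<psi>) w = (\<Sum>l<D. c x y l *
      ((-1) ^ k * (\<Sum>r<D. c (v ! k') (v ! k) r * \<psi> (l # take k' v @ r # drop (k' + 2) v))))"
      using 3 by (simp add: w face_nth k')
    also have "\<dots> = (-1) ^ k * (\<Sum>r<D. c (v ! k') (v ! k) r *
        (\<Sum>l<D. c x y l * \<psi> (l # take k' v @ r # drop (k' + 2) v)))"
      by (simp add: sum_distrib_left, subst sum.swap) (simp add: mult_ac)
    also have "\<dots> = - face c D (Suc k) (front_face c D \<psi>) w"
      using 3 by (simp add: w face_nth k')
    finally show ?thesis .
  next
    case 4
    then obtain u z where v: "v = u @ [z]" by (cases v rule: rev_cases) auto
    have k': "k = Suc (length u)" using 4 v by simp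
    have "front_face c D (face c D k \<psi>) w
        = (\<Sum>l<D. c x y l * ((-1) ^ k * (\<Sum>r<D. c z l r * \<psi> (r # u))))"
      using face_wrap[of u "length u" c D \<psi> _ z] by (simp add: w v k')
    also have "\<dots> = (-1) ^ k * (\<Sum>r<D. (\<Sum>l<D. c x y l * c z l r) * \<psi> (r # u))"
      by (simp add: sum_distrib_left sum_distrib_right, subst sum.swap) (simp add: mult_ac)
    also have "\<dots> = (-1) ^ k * (\<Sum>r<D. (\<Sum>l<D. c z x l * c l y r) * \<psi> (r # u))"
      by (intro arg_cong[where f = "\<lambda>x. _ * x"] sum.cong refl) (simp add: assoc)
    also have "\<dots> = (-1) ^ k * (\<Sum>l<D. c z x l * (\<Sum>r<D. c l y r * \<psi> (r # u)))"
      by (simp add: sum_distrib_left sum_distrib_right, subst sum.swap) (simp add: mult_ac)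
    also have "\<dots> = - face c D (Suc k) (front_face c D \<psi>) w"
      using face_wrap[of "y # u" "Suc (length u)" c D "front_face c D \<psi>" x z]
      by (simp add: w v k')
    finally show ?thesis .
  qed
qed

text \<open>Conjugation by \<open>rot j\<close> brings the outer face to the front.\<close>

lemma face_face:
  assumes assoc: "\<And>x y z r. r < D \<Longrightarrow> (\<Sum>l<D. c x y l * c l z r) = (\<Sum>l<D. c y z l * c x l r)"
    and "j \<le> i" "i + 2 \<le> length w"
  shows "face c D j (face c D i \<psi>) w = - face c D (Suc i) (face c D j \<psi>) w"
proof -
  obtain k where i: "i = j + k" using \<open>j \<le> i\<close> le_Suc_ex by blast
  have "rotr j (face c D i \<psi>) = face c D k (rotr j \<psi>)"
    unfolding face_def i by (simp only: rot_rot[symmetric] rotr_rot rotr_rotr add.commute)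
  then have 1: "face c D j (face c D i \<psi>) = rot j (front_face c D (face c D k (rotr j \<psi>)))"
    by (simp only: face_def[of c D j])
  have "rotr (Suc i) (face c D j \<psi>) = rotr (Suc k) (front_face c D (rotr j \<psi>))"
    unfolding face_def i by (metis add_Suc_right add.commute rotr_rot rotr_rotr)
  then have 2: "face c D (Suc i) (face c D j \<psi>) = rot j (face c D (Suc k) (front_face c D (rotr j \<psi>)))"
    unfolding face_def[of c D "Suc i"] face_def[of c D "Suc k"] by (simp only: i rot_rot) simp
  have "front_face c D (face c D k (rotr j \<psi>)) (rotate j w)
      = - face c D (Suc k) (front_face c D (rotr j \<psi>)) (rotate j w)"
    by (rule front_face_face[OF assoc]) (use assms i in auto)
  then show ?thesis unfolding 1 2 by (simp add: rot_def)
qed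

lemma alternating_double_sum:
  fixes F :: "nat \<Rightarrow> nat \<Rightarrow> 'k::field"
  assumes "\<And>i j. j \<le> i \<Longrightarrow> i < K \<Longrightarrow> F j i = - F (Suc i) j"
  shows "(\<Sum>j<Suc K. \<Sum>i<K. F j i) = 0"
  using assms
proof (induction K)
  case (Suc K)
  have "(\<Sum>j<Suc K. F j K) = - (\<Sum>j<Suc K. F (Suc K) j)"
    unfolding sum_negf[symmetric] by (intro sum.cong refl Suc.prems) auto
  moreover have "(\<Sum>j<Suc K. \<Sum>i<K. F j i) = 0"
    by (rule Suc.IH, rule Suc.prems) auto
  moreover have "(\<Sum>j<Suc (Suc K). \<Sum>i<Suc K. F j i)
      = (\<Sum>j<Suc K. \<Sum>i<K. F j i) + (\<Sum>j<Suc K. F j K) + (\<Sum>i<Suc K. F (Suc K) i)"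
    by (simp add: sum.distrib algebra_simps)
  ultimately show ?case by (simp only:) simp
qed simp

lemma cobd_cobd:
  assumes assoc: "\<And>x y z r. r < D \<Longrightarrow> (\<Sum>l<D. c x y l * c l z r) = (\<Sum>l<D. c y z l * c x l r)"
  shows "cobd c D (cobd c D \<psi>) w = 0" and "cobd' c D (cobd' c D \<psi>) w = 0"
proof -
  \<comment> \<open>The offset \<open>r\<close> treats both differentials at once: 0 for
    \<open>cobd\<close>, 1 for \<open>cobd'\<close>.\<close>
  have *: "face c D j (\<lambda>v. \<Sum>i<length v - r. face c D i \<psi> v) w
      = (\<Sum>i<length w - 1 - r. face c D j (face c D i \<psi>) w)" for j r
  proof -
    have "face c D j (\<lambda>v. \<Sum>i<length v - r. face c D i \<psi> v) w
        = face c D j (\<lambda>v. \<Sum>i<length w - 1 - r. face c D i \<psi> v) w"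
      by (rule face_cong) (metis diff_Suc_1)
    then show ?thesis by (simp only: lin_sum[OF lin_face])
  qed
  have "cobd c D (cobd c D \<psi>) w = (\<Sum>j<length w. face c D j (\<lambda>v. \<Sum>i<length v - 0. face c D i \<psi> v) w)"
    by (simp add: cobd_def[abs_def])
  also have "\<dots> = (\<Sum>j<length w. \<Sum>i<length w - 1. face c D j (face c D i \<psi>) w)"
    by (simp only: *) simp
  also have "\<dots> = 0"
  proof (cases "length w")
    case (Suc K)
    then show ?thesis
      using alternating_double_sum[of K "\<lambda>j i. face c D j (face c D i \<psi>) w"] face_face[OF assoc]
      by simp
  qed simp
  finally show "cobd c D (cobd c D \<psi>) w = 0" .
  have "cobd' c D (cobd' c D \<psi>) w
      = (\<Sum>j<length w - 1. face c D j (\<lambda>v. \<Sum>i<length v - 1. face c D i \<psi> v) w)"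
    by (simp add: cobd'_def[abs_def])
  also have "\<dots> = (\<Sum>j<length w - 1. \<Sum>i<length w - 1 - 1. face c D j (face c D i \<psi>) w)"
    by (simp only: *)
  also have "\<dots> = 0"
  proof (cases "length w - 1")
    case (Suc K)
    then show ?thesis
      using alternating_double_sum[of K "\<lambda>j i. face c D j (face c D i \<psi>) w"] face_face[OF assoc]
      by simp
  qed simp
  finally show "cobd' c D (cobd' c D \<psi>) w = 0" .
qed

section \<open>Hochschild cohomology in coordinates\<close>

lemma finite_words: "finite (words D n)"
proof -
  have "words D n = {w. set w \<subseteq> {..<D} \<and> length w = n}" by (auto simp: words_def)
  then show ?thesis by (simp add: finite_lists_length_eq)
qed

lemma sum_pick:
  fixes g :: "nat \<Rightarrow> 'k::field"
  assumes "finite A" "\<And>l. l < D \<Longrightarrow> f l \<in> A"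
  shows "(\<Sum>v\<in>A. (\<Sum>l<D. if v = f l then g l else 0) * \<psi> v) = (\<Sum>l<D. g l * \<psi> (f l))"
proof -
  have "(\<Sum>v\<in>A. (\<Sum>l<D. if v = f l then g l else 0) * \<psi> v)
      = (\<Sum>l<D. \<Sum>v\<in>A. if v = f l then g l * \<psi> v else 0)"
    by (subst sum.swap, simp add: sum_distrib_right, intro sum.cong refl) auto
  also have "\<dots> = (\<Sum>l<D. g l * \<psi> (f l))"
    using assms by (intro sum.cong refl) (simp add: sum.delta')
  finally show ?thesis .
qed

text \<open>Identifies the rotation-based \<open>cobd\<close> with the transpose of the boundary
  that defines the homology.\<close>

lemma hbd_basis_pairing:
  assumes w: "w \<in> words D (Suc n)" and n: "n \<ge> 1"
  shows "(\<Sum>v\<in>words D n. hbd_basis c D w v * \<psi> v) = cobd c D \<psi> w"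
proof -
  have lw: "length w = Suc n" and sw: "set w \<subseteq> {..<D}" using w by (auto simp: words_def)
  have mem: "take i w @ l # drop (i + 2) w \<in> words D n" if "i < n" "l < D" for i l
    using that lw sw set_take_subset[of i w] set_drop_subset[of "i + 2" w]
    by (auto simp: words_def)
  have mem': "l # take (n - 1) (tl w) \<in> words D n" if "l < D" for l
  proof -
    have "set (take (n - 1) (tl w)) \<subseteq> set w"
      using set_take_subset[of "n - 1" "tl w"] lw by (cases w) auto
    then show ?thesis using that lw sw n by (auto simp: words_def)
  qed
  obtain x u where xu: "w = x # u" using lw by (cases w) auto
  then obtain v y where "u = v @ [y]" using lw n by (cases u rule: rev_cases) auto
  then have xvy: "w = x # v @ [y]" "length v = n - 1" using xu lw by auto
  have "(\<Sum>v\<in>words D n. hbd_basis c D w v * \<psi> v)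
     = (\<Sum>i<n. (-1) ^ i * (\<Sum>v\<in>words D n. (\<Sum>l<D. if v = take i w @ l # drop (i + 2) w
            then c (w ! i) (w ! Suc i) l else 0) * \<psi> v))
       + (-1) ^ n * (\<Sum>v\<in>words D n. (\<Sum>l<D. if v = l # take (n - 1) (tl w)
            then c (w ! n) (w ! 0) l else 0) * \<psi> v)"
    unfolding hbd_basis_def Let_def lw
    by (simp add: distrib_right sum.distrib sum_distrib_left sum_distrib_right mult.assoc
          sum.swap[of _ "{..<n}" "words D n"] cong: if_cong)
  also have "\<dots> = (\<Sum>i<n. (-1) ^ i * (\<Sum>l<D. c (w ! i) (w ! Suc i) l * \<psi> (take i w @ l # drop (i + 2) w)))
       + (-1) ^ n * (\<Sum>l<D. c (w ! n) (w ! 0) l * \<psi> (l # take (n - 1) (tl w)))"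
    using mem mem'
    by (intro arg_cong2[where f = "(+)"] arg_cong2[where f = times] sum.cong refl sum_pick finite_words) auto
  also have "(-1) ^ n * (\<Sum>l<D. c (w ! n) (w ! 0) l * \<psi> (l # take (n - 1) (tl w))) = face c D n \<psi> w"
  proof -
    have "w ! n = y" using xvy n by (simp add: nth_append nth_Cons')
    then show ?thesis using face_wrap[OF xvy(2), of c D \<psi> x y] xvy n by simp
  qed
  also have "(\<Sum>i<n. (-1) ^ i * (\<Sum>l<D. c (w ! i) (w ! Suc i) l * \<psi> (take i w @ l # drop (i + 2) w)))
      = (\<Sum>i<n. face c D i \<psi> w)"
    by (intro sum.cong refl) (simp add: face_nth lw)
  finally show ?thesis by (simp add: cobd_def lw)
qed

text \<open>Cochains are arbitrary functions on lists, compared only on words over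
  \<open>{..<D}\<close>; thus nothing has to be truncated when they are rotated, pulled back or cut
  off.\<close>

definition cexact :: "'k::field sc \<Rightarrow> nat \<Rightarrow> nat \<Rightarrow> bool" where
  "cexact c D n \<longleftrightarrow> (\<forall>\<psi>. (\<forall>w\<in>words D (n + 2). cobd c D \<psi> w = 0) \<longrightarrow>
     (\<exists>\<phi>. \<forall>w\<in>words D (n + 1). cobd c D \<phi> w = \<psi> w))"

lemma hbd_basis_supported:
  assumes w: "w \<in> words D (Suc n)" and n: "n \<ge> 1"
  shows "supported (words D n) (hbd_basis c D w)"
  unfolding supported_def
proof (intro allI impI)
  fix v assume v: "v \<notin> words D n"
  have lw: "length w = Suc n" and sw: "set w \<subseteq> {..<D}" using w by (auto simp: words_def)
  have "v \<noteq> take i w @ l # drop (i + 2) w" if "i < n" "l < D" for i l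
    using v that lw sw set_take_subset[of i w] set_drop_subset[of "i + 2" w]
    by (fastforce simp: words_def)
  moreover have "v \<noteq> l # take (n - 1) (tl w)" if "l < D" for l
  proof -
    have "set (take (n - 1) (tl w)) \<subseteq> set w"
      using set_take_subset[of "n - 1" "tl w"] lw by (cases w) auto
    then show ?thesis using v that lw sw n by (auto simp: words_def)
  qed
  ultimately show "hbd_basis c D w v = 0"
    unfolding hbd_basis_def Let_def lw
    by (simp add: sum.neutral)
qed

text \<open>Duality over a field. A cocycle, read as a functional on n-chains, kills boundaries,
  hence by vanishing homology all cycles; it therefore factors through the boundary map, and the
  factor is the required primitive.\<close>

lemma HH_zero_cexact:
  fixes c :: "'k::field sc"
  assumes HH: "\<not> HH_nonzero c D n" and n: "n \<ge> 1"
  shows "cexact c D n"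
  unfolding cexact_def
proof (intro allI impI)
  fix \<psi> :: "nat list \<Rightarrow> 'k"
  assume coc: "\<forall>w\<in>words D (n + 2). cobd c D \<psi> w = 0"
  define X where "X = words D (Suc n)"
  define F where "F = hbd c D n"
  define pair where "pair = (\<lambda>z. \<Sum>w\<in>X. z w * \<psi> w)"
  have linF: "lin F"
    by (rule linI) (auto simp: F_def hbd_def algebra_simps sum.distrib sum_distrib_left)
  obtain G where G0: "lin G \<and> (\<forall>g. G g \<in> {z. supported X z}) \<and>
      (\<forall>v\<in>{z. supported X z}. F (G (F v)) = F v)"
    using lin_right_inverse[OF linF, of "{z. supported X z}"]
    by (auto simp: supported_def)
  then have G: "lin G" "\<And>g. supported X (G g)" "\<And>v. supported X v \<Longrightarrow> F (G (F v)) = F v"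
    by auto
  have ker: "pair z = 0" if z: "supported X z" "F z = (\<lambda>_. 0)" for z
  proof -
    have "hchain D n z" using z(1) by (auto simp: hchain_def supported_def X_def)
    then obtain y where y: "hbd c D (Suc n) y = z"
      using HH z(2) unfolding HH_nonzero_def F_def by blast
    have "pair z = (\<Sum>w\<in>X. \<Sum>u\<in>words D (Suc (Suc n)). y u * (hbd_basis c D u w * \<psi> w))"
      unfolding pair_def y[symmetric] hbd_def by (simp add: sum_distrib_right mult.assoc)
    also have "\<dots> = (\<Sum>u\<in>words D (Suc (Suc n)). y u * (\<Sum>w\<in>X. hbd_basis c D u w * \<psi> w))"
      by (subst sum.swap) (simp add: sum_distrib_left)
    also have "\<dots> = 0"
      using coc by (intro sum.neutral ballI) (simp add: X_def hbd_basis_pairing)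
    finally show ?thesis .
  qed
  \<comment> \<open>The factor is made explicit by the section \<open>G\<close> of the boundary: a
    basis word \<open>v\<close> is lifted to a chain and paired with \<open>\<psi>\<close>.\<close>
  have "cobd c D (\<lambda>v. pair (G (ind v))) w = \<psi> w" if w: "w \<in> X" for w
  proof -
    have Find: "F (ind w) = hbd_basis c D w"
      using w finite_words[of D "Suc n"]
      by (auto simp: F_def hbd_def ind_def X_def fun_eq_iff if_distrib[of "\<lambda>x. x * _"] cong: if_cong)
    have sup: "supported (words D n) (F (ind w))"
      unfolding Find using w n by (simp add: X_def hbd_basis_supported)
    have "cobd c D (\<lambda>v. pair (G (ind v))) w = (\<Sum>v\<in>words D n. F (ind w) v * pair (G (ind v)))"
      using w n by (simp add: X_def hbd_basis_pairing Find)
    also have "\<dots> = (\<Sum>u\<in>X. (\<Sum>v\<in>words D n. F (ind w) v * G (ind v) u) * \<psi> u)"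
      unfolding pair_def by (simp add: sum_distrib_left sum_distrib_right mult.assoc) (rule sum.swap)
    also have "\<dots> = pair (G (F (ind w)))"
      unfolding pair_def by (simp only: lin_expand[OF finite_words sup G(1)])
    finally have 1: "cobd c D (\<lambda>v. pair (G (ind v))) w = pair (G (F (ind w)))" .
    \<comment> \<open>The word and the lift of its boundary differ by a cycle.\<close>
    have "pair (\<lambda>u. ind w u - G (F (ind w)) u) = 0"
    proof (rule ker)
      show "supported X (\<lambda>u. ind w u - G (F (ind w)) u)"
        using supported_ind[OF w] G(2)[of "F (ind w)"] by (simp add: supported_def)
      show "F (\<lambda>u. ind w u - G (F (ind w)) u) = (\<lambda>_. 0)"
        using G(3)[OF supported_ind[OF w]] by (simp add: lin_diff[OF linF] fun_eq_iff)
    qed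
    then have "pair (G (F (ind w))) = pair (ind w)"
      by (simp add: pair_def algebra_simps sum_subtractf)
    also have "\<dots> = \<psi> w"
      using w finite_words[of D "Suc n"]
      by (simp add: pair_def ind_def X_def if_distrib[of "\<lambda>x. x * _"] cong: if_cong)
    finally show ?thesis using 1 by simp
  qed
  then show "\<exists>\<phi>. \<forall>w\<in>words D (n + 1). cobd c D \<phi> w = \<psi> w"
    by (auto simp: X_def)
qed

section \<open>Change of basis\<close>

text \<open>Composition with the tensor powers of the linear map whose rows are \<open>P i\<close>;
  recursion on the word takes the place of sums over tuples of indices.\<close>

fun pullback :: "(nat \<Rightarrow> nat \<Rightarrow> 'k::field) \<Rightarrow> nat \<Rightarrow> (nat list \<Rightarrow> 'k) \<Rightarrow> nat list \<Rightarrow> 'k" where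
  "pullback P D \<psi> [] = \<psi> []"
| "pullback P D \<psi> (i # w) = (\<Sum>a<D. P i a * pullback P D (\<lambda>v. \<psi> (a # v)) w)"

lemma lin_pullback: "lin (pullback P D)"
proof (rule linI)
  show "pullback P D (\<lambda>x. f x + g x) w = pullback P D f w + pullback P D g w" for f g w
    by (induction w arbitrary: f g) (simp_all add: algebra_simps sum.distrib)
  show "pullback P D (\<lambda>x. r * f x) w = r * pullback P D f w" for r f w
    by (induction w arbitrary: f) (simp_all add: algebra_simps sum_distrib_left)
qed

lemma pullback_cong:
  assumes "\<And>v. v \<in> words D (length w) \<Longrightarrow> \<psi> v = \<psi>' v"
  shows "pullback P D \<psi> w = pullback P D \<psi>' w"
  using assms
proof (induction w arbitrary: \<psi> \<psi>')
  case (Cons i w)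
  then have "pullback P D (\<lambda>v. \<psi> (a # v)) w = pullback P D (\<lambda>v. \<psi>' (a # v)) w" if "a < D" for a
    using that by (intro Cons.IH Cons.prems) (auto simp: words_def)
  then show ?case by simp
qed (simp add: words_def)

lemma pullback_append:
  "pullback P D \<psi> (u @ w) = pullback P D (\<lambda>v. pullback P D (\<lambda>v'. \<psi> (v @ v')) w) u"
  by (induction u arbitrary: \<psi>) auto

lemma pullback_rot1: "pullback P D (rot 1 \<psi>) = rot 1 (pullback P D \<psi>)"
proof
  fix w :: "nat list"
  have "pullback P D (\<lambda>v. \<psi> (rotate1 v)) w = pullback P D \<psi> (rotate1 w)"
    by (cases w) (simp_all add: pullback_append lin_sum[OF lin_pullback] lin_scale[OF lin_pullback])
  moreover have "pullback P D (rot 1 \<psi>) w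
      = pullback P D (\<lambda>v. (-1) ^ (length w - 1) * \<psi> (rotate1 v)) w"
    by (rule pullback_cong) (simp add: rot_def words_def)
  ultimately show "pullback P D (rot 1 \<psi>) w = rot 1 (pullback P D \<psi>) w"
    by (simp add: lin_scale[OF lin_pullback]) (simp add: rot_def)
qed

lemma pullback_rot: "pullback P D (rot i \<psi>) = rot i (pullback P D \<psi>)"
proof (induction i)
  case (Suc i)
  have "rot (Suc i) \<phi> = rot 1 (rot i \<phi>)" for \<phi> :: "nat list \<Rightarrow> 'a"
    by (simp only: rot_rot plus_1_eq_Suc)
  then show ?case using Suc by (simp only: pullback_rot1)
qed simp

lemma pullback_rotr: "pullback P D (rotr i \<psi>) = rotr i (pullback P D \<psi>)"
  by (metis pullback_rot rot_rotr rotr_rot)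

text \<open>The hypothesis on \<open>P\<close> says that the map with these rows is
  multiplicative.\<close>

lemma pullback_front_face:
  assumes "\<And>i j v. i < D' \<Longrightarrow> j < D' \<Longrightarrow> v < D \<Longrightarrow>
      (\<Sum>a<D. \<Sum>b<D. P i a * P j b * c a b v) = (\<Sum>l<D'. c' i j l * P l v)"
    and "set w \<subseteq> {..<D'}"
  shows "pullback P D (front_face c D \<psi>) w = front_face c' D' (pullback P D \<psi>) w"
proof (cases "(c, D, \<psi>, w)" rule: front_face.cases)
  case (1 c1 D1 \<psi>1 x y u)
  then have w: "w = x # y # u" and xy: "x < D'" "y < D'" using assms(2) by auto
  define R where "R = (\<lambda>l. pullback P D (\<lambda>v. \<psi> (l # v)) u)"
  have "pullback P D (front_face c D \<psi>) w = (\<Sum>a<D. P x a * (\<Sum>b<D. P y b * (\<Sum>l<D. c a b l * R l)))"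
    by (simp add: w R_def lin_sum[OF lin_pullback] lin_scale[OF lin_pullback])
  also have "\<dots> = (\<Sum>a<D. \<Sum>b<D. \<Sum>l<D. P x a * P y b * c a b l * R l)"
    by (simp add: sum_distrib_left mult_ac)
  also have "\<dots> = (\<Sum>a<D. \<Sum>l<D. \<Sum>b<D. P x a * P y b * c a b l * R l)"
    by (intro sum.cong refl sum.swap)
  also have "\<dots> = (\<Sum>l<D. (\<Sum>a<D. \<Sum>b<D. P x a * P y b * c a b l) * R l)"
    by (subst sum.swap) (simp add: sum_distrib_right)
  also have "\<dots> = (\<Sum>l<D. (\<Sum>k<D'. c' x y k * P k l) * R l)"
    by (intro sum.cong refl) (simp add: assms(1) xy)
  also have "\<dots> = front_face c' D' (pullback P D \<psi>) w"
    by (simp add: w R_def sum_distrib_left sum_distrib_right mult.assoc) (rule sum.swap)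
  finally show ?thesis .
qed auto

lemma pullback_cobd:
  assumes int: "\<And>i j v. i < D' \<Longrightarrow> j < D' \<Longrightarrow> v < D \<Longrightarrow>
      (\<Sum>a<D. \<Sum>b<D. P i a * P j b * c a b v) = (\<Sum>l<D'. c' i j l * P l v)"
    and w: "set w \<subseteq> {..<D'}"
  shows "pullback P D (cobd c D \<psi>) w = cobd c' D' (pullback P D \<psi>) w"
proof -
  have f: "pullback P D (face c D i \<psi>) w = face c' D' i (pullback P D \<psi>) w" for i
    using w by (simp add: face_def pullback_rot) (simp add: rot_def pullback_front_face[OF int] pullback_rotr)
  have "pullback P D (cobd c D \<psi>) w = pullback P D (\<lambda>v. \<Sum>i<length w. face c D i \<psi> v) w"
    by (rule pullback_cong) (simp add: cobd_def words_def)
  then show ?thesis by (simp add: lin_sum[OF lin_pullback] f cobd_def)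
qed

lemma pullback_pullback:
  "pullback P D (pullback Q D' \<psi>) w = pullback (\<lambda>i b. \<Sum>a<D. P i a * Q a b) D' \<psi> w"
proof (induction w arbitrary: \<psi>)
  case (Cons i w)
  have "pullback P D (pullback Q D' \<psi>) (i # w)
      = (\<Sum>a<D. \<Sum>b<D'. P i a * Q a b * pullback P D (pullback Q D' (\<lambda>v. \<psi> (b # v))) w)"
    by (simp add: lin_sum[OF lin_pullback] lin_scale[OF lin_pullback] sum_distrib_left mult.assoc)
  then show ?case
    by (subst (asm) sum.swap) (simp add: Cons sum_distrib_right)
qed simp

lemma pullback_id:
  assumes "\<And>i j. i < D \<Longrightarrow> j < D \<Longrightarrow> M i j = (if i = j then 1 else 0)" "set w \<subseteq> {..<D}"
  shows "pullback M D \<psi> w = \<psi> w"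
  using assms(2)
proof (induction w arbitrary: \<psi>)
  case (Cons i w)
  then have "(\<Sum>a<D. M i a * pullback M D (\<lambda>v. \<psi> (a # v)) w)
      = (\<Sum>a<D. if i = a then \<psi> (a # w) else 0)"
    by (intro sum.cong refl) (simp add: assms(1))
  then show ?case using Cons by simp
qed simp

text \<open>A cocycle is carried over by \<open>Q\<close>, and the primitive found there is brought
  back by \<open>P\<close>; the composite is the identity on words.\<close>

lemma cexact_transfer:
  assumes P: "\<And>i j v. i < D' \<Longrightarrow> j < D' \<Longrightarrow> v < D \<Longrightarrow>
      (\<Sum>a<D. \<Sum>b<D. P i a * P j b * c a b v) = (\<Sum>l<D'. c' i j l * P l v)"
    and Q: "\<And>i j v. i < D \<Longrightarrow> j < D \<Longrightarrow> v < D' \<Longrightarrow>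
      (\<Sum>a<D'. \<Sum>b<D'. Q i a * Q j b * c' a b v) = (\<Sum>l<D. c i j l * Q l v)"
    and PQ: "\<And>i j. i < D' \<Longrightarrow> j < D' \<Longrightarrow> (\<Sum>a<D. P i a * Q a j) = (if i = j then 1 else 0)"
    and ex: "cexact c D n"
  shows "cexact c' D' n"
  unfolding cexact_def
proof (intro allI impI)
  fix \<psi> :: "nat list \<Rightarrow> 'a"
  assume coc: "\<forall>w\<in>words D' (n + 2). cobd c' D' \<psi> w = 0"
  have "cobd c D (pullback Q D' \<psi>) w = 0" if "w \<in> words D (n + 2)" for w
  proof -
    have "cobd c D (pullback Q D' \<psi>) w = pullback Q D' (cobd c' D' \<psi>) w"
      using that by (intro pullback_cobd[OF Q, symmetric]) (auto simp: words_def)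
    also have "\<dots> = pullback Q D' (\<lambda>_. 0) w"
      by (rule pullback_cong) (use that coc in \<open>auto simp: words_def\<close>)
    finally show ?thesis by (simp add: lin_zero[OF lin_pullback])
  qed
  then obtain \<phi> where \<phi>: "\<forall>w\<in>words D (n + 1). cobd c D \<phi> w = pullback Q D' \<psi> w"
    using ex unfolding cexact_def by blast
  have "cobd c' D' (pullback P D \<phi>) w = \<psi> w" if "w \<in> words D' (n + 1)" for w
  proof -
    have "cobd c' D' (pullback P D \<phi>) w = pullback P D (cobd c D \<phi>) w"
      using that by (intro pullback_cobd[OF P, symmetric]) (auto simp: words_def)
    also have "\<dots> = pullback P D (pullback Q D' \<psi>) w"
      by (rule pullback_cong) (use that \<phi> in \<open>auto simp: words_def\<close>)
    also have "\<dots> = \<psi> w"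
      unfolding pullback_pullback using that by (intro pullback_id PQ) (auto simp: words_def)
    finally show ?thesis .
  qed
  then show "\<exists>\<phi>. \<forall>w\<in>words D' (n + 1). cobd c' D' \<phi> w = \<psi> w" by blast
qed

section \<open>Graded algebras with a path basis\<close>

text \<open>Indices below \<open>m\<close> are the idempotents, one per vertex. Every other basis
  element has positive degree and runs from \<open>src\<close> to \<open>tgt\<close>, products being
  read from left to right; a product may be a combination of several basis elements.\<close>

locale path_algebra =
  fixes c :: "'k::field_char_0 sc" and D m :: nat and src tgt dg :: "nat \<Rightarrow> nat"
  assumes m: "0 < m" "m \<le> D"
    and src_less: "\<And>i. i < D \<Longrightarrow> src i < m" and tgt_less: "\<And>i. i < D \<Longrightarrow> tgt i < m"
    and idem: "\<And>i. i < m \<Longrightarrow> src i = i" "\<And>i. i < m \<Longrightarrow> tgt i = i" "\<And>i. i < m \<Longrightarrow> dg i = 0"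
    and pos: "\<And>i. m \<le> i \<Longrightarrow> i < D \<Longrightarrow> 0 < dg i"
    and prod: "\<And>i j l. i < D \<Longrightarrow> j < D \<Longrightarrow> l < D \<Longrightarrow> c i j l \<noteq> 0 \<Longrightarrow>
        dg l = dg i + dg j \<and> tgt i = src j \<and> src l = src i \<and> tgt l = tgt j"
    and unit_left: "\<And>a j l. a < m \<Longrightarrow> j < D \<Longrightarrow> l < D \<Longrightarrow>
        c a j l = (if src j = a \<and> l = j then 1 else 0)"
    and unit_right: "\<And>a j l. a < m \<Longrightarrow> j < D \<Longrightarrow> l < D \<Longrightarrow>
        c j a l = (if tgt j = a \<and> l = j then 1 else 0)"
    and assoc: "\<And>x y z r. x < D \<Longrightarrow> y < D \<Longrightarrow> z < D \<Longrightarrow> r < D \<Longrightarrow>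
        (\<Sum>l<D. c x y l * c l z r) = (\<Sum>l<D. c y z l * c x l r)"
begin

text \<open>The structure constants of the ideal of positive degree elements.\<close>

definition cp :: "'k sc" where
  "cp i j l = (if i \<in> {m..<D} \<and> j \<in> {m..<D} then c i j l else 0)"

fun path :: "nat \<Rightarrow> nat \<Rightarrow> nat list \<Rightarrow> bool" where
  "path a b [] \<longleftrightarrow> a = b"
| "path a b (x # w) \<longleftrightarrow> x \<in> {m..<D} \<and> src x = a \<and> path (tgt x) b w"

text \<open>Words of all lengths together, not identified under rotation. Positive degrees make this
  set finite, so it carries the whole complex of internal degree \<open>j\<close>.\<close>

definition cyc :: "nat \<Rightarrow> nat list set" where
  "cyc j = {w. w \<noteq> [] \<and> (\<exists>a. path a a w) \<and> sum_list (map dg w) = j}"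

section \<open>Cyclically composable words\<close>

lemma path_append: "path a b (u @ v) \<longleftrightarrow> (\<exists>e. path a e u \<and> path e b v)"
  by (induction u arbitrary: a) auto

lemma path_set: "path a b w \<Longrightarrow> set w \<subseteq> {m..<D}"
  by (induction w arbitrary: a) auto

lemma path_ends: "path a b w \<Longrightarrow> w \<noteq> [] \<Longrightarrow> src (hd w) = a \<and> tgt (last w) = b"
proof (induction w arbitrary: a)
  case (Cons x w)
  then show ?case by (cases w) auto
qed simp

lemma cyc_set: "w \<in> cyc j \<Longrightarrow> set w \<subseteq> {m..<D}"
  by (auto simp: cyc_def dest: path_set)

lemma cyc_rotate1: "rotate1 w \<in> cyc j \<longleftrightarrow> w \<in> cyc j"
  by (cases w) (auto simp: cyc_def path_append)

lemma cyc_rotate: "rotate i w \<in> cyc j \<longleftrightarrow> w \<in> cyc j"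
  by (induction i) (auto simp: cyc_rotate1)

lemma cyc_rotr: "rev (rotate i (rev w)) \<in> cyc j \<longleftrightarrow> w \<in> cyc j"
proof -
  have "rotate i (rev (rotate i (rev w))) = w"
    using rotate_rev_rotate[of i "rev w"] by simp
  then show ?thesis using cyc_rotate[of i "rev (rotate i (rev w))" j] by simp
qed

lemma length_le_degree: "set w \<subseteq> {m..<D} \<Longrightarrow> length w \<le> sum_list (map dg w)"
proof (induction w)
  case (Cons x w)
  then show ?case using pos[of x] by auto
qed simp

lemma degree_le: "set w \<subseteq> {m..<D} \<Longrightarrow> (\<And>i. i < D \<Longrightarrow> dg i \<le> N) \<Longrightarrow>
    sum_list (map dg w) \<le> N * length w"
proof (induction w)
  case (Cons x w)
  then have "dg x \<le> N" "sum_list (map dg w) \<le> N * length w" by auto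
  then show ?case by simp
qed simp

lemma finite_cyc: "finite (cyc j)"
proof (rule finite_subset)
  show "cyc j \<subseteq> {w. set w \<subseteq> {m..<D} \<and> length w \<le> j}"
    using cyc_set length_le_degree by (auto simp: cyc_def) fastforce+
qed (simp add: finite_lists_length_le)

lemma cp_prod:
  assumes "cp x y l \<noteq> 0" "l < D"
  shows "x \<in> {m..<D}" "y \<in> {m..<D}" "l \<in> {m..<D}" "c x y l \<noteq> 0" "dg l = dg x + dg y"
    "tgt x = src y" "src l = src x" "tgt l = tgt y"
proof -
  show xy: "x \<in> {m..<D}" "y \<in> {m..<D}" "c x y l \<noteq> 0"
    using assms(1) by (auto simp: cp_def split: if_splits)
  then show p: "dg l = dg x + dg y" "tgt x = src y" "src l = src x" "tgt l = tgt y"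
    using prod[of x y l] assms(2) by auto
  have "dg l > 0" using p(1) pos[of x] xy(1) by auto
  then show "l \<in> {m..<D}" using idem(3)[of l] assms(2) by (cases "l < m") auto
qed

text \<open>A nonzero product keeps the outer ends and the total degree of its factors. Hence
  contracting neighbours neither enters nor leaves \<open>cyc j\<close>, and the complex splits by
  internal degree.\<close>

lemma cp_merge:
  assumes "cp x y l \<noteq> 0" "l < D"
  shows "u @ l # v \<in> cyc j \<longleftrightarrow> u @ x # y # v \<in> cyc j"
  using cp_prod[OF assms] by (auto simp: cyc_def path_append)

text \<open>Truncation to 0 outside \<open>{m..<D}\<close> gives associativity for all
  \<open>x\<close>, \<open>y\<close>, \<open>z\<close>, in the form that \<open>cobd_cobd\<close>
  takes as hypothesis, while \<open>assoc\<close> speaks of indices below \<open>D\<close>.\<close>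

lemma cp_assoc:
  assumes "r < D"
  shows "(\<Sum>l<D. cp x y l * cp l z r) = (\<Sum>l<D. cp y z l * cp x l r)"
proof -
  have L: "(\<Sum>l<D. cp x y l * cp l z r) = (\<Sum>l<D. c x y l * c l z r)"
    if "x \<in> {m..<D}" "y \<in> {m..<D}" "z \<in> {m..<D}"
  proof (intro sum.cong refl)
    fix l assume l: "l \<in> {..<D}"
    show "cp x y l * cp l z r = c x y l * c l z r"
    proof (cases "cp x y l = 0")
      case True
      then show ?thesis using that by (simp add: cp_def)
    next
      case False
      then show ?thesis using cp_prod[OF False] l that by (simp add: cp_def)
    qed
  qed
  have R: "(\<Sum>l<D. cp y z l * cp x l r) = (\<Sum>l<D. c y z l * c x l r)"
    if "x \<in> {m..<D}" "y \<in> {m..<D}" "z \<in> {m..<D}"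
  proof (intro sum.cong refl)
    fix l assume l: "l \<in> {..<D}"
    show "cp y z l * cp x l r = c y z l * c x l r"
    proof (cases "cp y z l = 0")
      case True
      then show ?thesis using that by (simp add: cp_def)
    next
      case False
      then show ?thesis using cp_prod[OF False] l that by (simp add: cp_def)
    qed
  qed
  show ?thesis
  proof (cases "x \<in> {m..<D} \<and> y \<in> {m..<D} \<and> z \<in> {m..<D}")
    case True
    then show ?thesis using L R assoc[of x y z r] assms by auto
  next
    case False
    then have z: "cp x y l * cp l z r = 0" "cp y z l * cp x l r = 0" for l
      by (auto simp: cp_def)
    show ?thesis by (simp only: z)
  qed
qed

section \<open>Restriction of the operators to a fixed internal degree\<close>

lemma supported_rot: "supported (cyc j) \<psi> \<Longrightarrow> supported (cyc j) (rot i \<psi>)"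
  and supported_rotr: "supported (cyc j) \<psi> \<Longrightarrow> supported (cyc j) (rotr i \<psi>)"
  by (auto simp: supported_def rot_def rotr_def cyc_rotate cyc_rotr)

lemma supported_front: "supported (cyc j) \<psi> \<Longrightarrow> supported (cyc j) (front_face cp D \<psi>)"
  unfolding supported_def
proof (intro allI impI)
  fix w assume *: "\<forall>x. x \<notin> cyc j \<longrightarrow> \<psi> x = 0" and w: "w \<notin> cyc j"
  show "front_face cp D \<psi> w = 0"
  proof (cases "(cp, D, \<psi>, w)" rule: front_face.cases)
    case (1 c1 D1 \<psi>1 x y u)
    then have w': "w = x # y # u" by simp
    have "cp x y l * \<psi> (l # u) = 0" if "l < D" for l
      using * w w' cp_merge[of x y l "[]" u j] that by (cases "cp x y l = 0") auto
    then show ?thesis unfolding w' front_face.simps by (intro sum.neutral) auto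
  qed auto
qed

lemma supported_face: "supported (cyc j) \<psi> \<Longrightarrow> supported (cyc j) (face cp D i \<psi>)"
  unfolding face_def by (intro supported_rot supported_front supported_rotr)

lemma supported_cobd: "supported (cyc j) \<psi> \<Longrightarrow> supported (cyc j) (cobd cp D \<psi>)"
  and supported_cobd': "supported (cyc j) \<psi> \<Longrightarrow> supported (cyc j) (cobd' cp D \<psi>)"
  using supported_face[of j \<psi>] by (auto simp: supported_def cobd_def cobd'_def)

lemma supported_cnorm: "supported (cyc j) \<psi> \<Longrightarrow> supported (cyc j) (cnorm \<psi>)"
  using supported_rot[of j \<psi>] by (auto simp: supported_def cnorm_def)

lemma supported_rot_primitive: "supported (cyc j) \<psi> \<Longrightarrow> supported (cyc j) (rot_primitive \<psi>)"
  using supported_rotr[of j \<psi>] by (auto simp: supported_def rot_primitive_def)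

lemma sum_unit_left:
  assumes "a < m" "z < D"
  shows "(\<Sum>l<D. c a z l * f l) = (if src z = a then f z else 0)"
proof -
  have "(\<Sum>l<D. c a z l * f l) = (\<Sum>l<D. if l = z then (if src z = a then f l else 0) else 0)"
    using assms by (intro sum.cong refl) (simp add: unit_left)
  then show ?thesis using assms by simp
qed

lemma sum_unit_right:
  assumes "a < m" "z < D"
  shows "(\<Sum>l<D. c z a l * f l) = (if tgt z = a then f z else 0)"
proof -
  have "(\<Sum>l<D. c z a l * f l) = (\<Sum>l<D. if l = z then (if tgt z = a then f l else 0) else 0)"
    using assms by (intro sum.cong refl) (simp add: unit_right)
  then show ?thesis using assms by simp
qed

text \<open>A word containing an idempotent may be rotated so that it starts with it, because the
coboundary of an invariant cochain is invariant; then only the two faces that absorb the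
idempotent contribute, and they cancel.\<close>

lemma invariant_cocycle_extends:
  assumes sup: "supported (cyc j) \<psi>" and inv: "rotr 1 \<psi> = \<psi>"
    and coc: "cobd cp D \<psi> = (\<lambda>_. 0)" and w: "set w \<subseteq> {..<D}"
  shows "cobd c D \<psi> w = 0"
proof (cases "set w \<subseteq> {m..<D}")
  case True
  have "front_face c D \<psi> v = front_face cp D \<psi> v" if "set v \<subseteq> {m..<D}" for v
    using that by (cases "(c, D, \<psi>, v)" rule: front_face.cases) (auto simp: cp_def)
  then have "cobd c D \<psi> w = cobd cp D \<psi> w"
    using True by (simp add: cobd_inv[OF inv] cnorm_def rot_def)
  then show ?thesis by (simp add: coc)
next
  case False
  then obtain x where "x \<in> set w" "x \<notin> {m..<D}" by blast
  with w have x: "x \<in> set w" "x < m" by auto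
  then obtain p where p: "p < length w" "w ! p = x" by (auto simp: in_set_conv_nth)
  define X where "X = front_face c D \<psi>"
  have b: "cobd c D \<psi> = cnorm X" by (simp add: X_def cobd_inv[OF inv])
  define u where "u = drop (Suc p) w @ take p w"
  have xu: "rotate p w = x # u"
    using p by (simp add: rotate_drop_take u_def Cons_nth_drop_Suc[symmetric])
  have su: "set u \<subseteq> {..<D}"
    using w by (auto simp: u_def dest!: in_set_dropD in_set_takeD)
  have "cnorm X (x # u) = 0"
  proof (cases u rule: rev_cases)
    case Nil
    then show ?thesis by (simp add: cnorm_def rot_def X_def)
  next
    case (snoc v y)
    define n where "n = length v"
    \<comment> \<open>An inner face leaves the idempotent \<open>x\<close> in the word, and there
      \<open>\<psi>\<close> vanishes.\<close>
    have mid: "rot (Suc i) X (x # u) = 0" if "i < n" for i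
    proof -
      have "rotate (Suc i) (x # u) = drop i u @ x # take i u"
        using that by (subst rotate_drop_take) (simp add: snoc n_def)
      also have "drop i u = u ! i # u ! Suc i # drop (Suc (Suc i)) u"
      proof -
        have "Suc i < length u" using that by (simp add: snoc n_def)
        then show ?thesis by (simp add: Cons_nth_drop_Suc)
      qed
      finally have r: "rotate (Suc i) (x # u)
          = u ! i # u ! Suc i # (drop (Suc (Suc i)) u @ x # take i u)" by simp
      have "\<psi> (l # drop (Suc (Suc i)) u @ x # take i u) = 0" for l
      proof -
        have "l # drop (Suc (Suc i)) u @ x # take i u \<notin> cyc j"
          using cyc_set[of "l # drop (Suc (Suc i)) u @ x # take i u" j] x(2) by auto
        then show ?thesis using sup by (simp add: supported_def)
      qed
      then show ?thesis unfolding rot_def r X_def by simp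
    qed
    have first: "X (x # u) = (if src (hd u) = x then \<psi> u else 0)"
    proof -
      have "u \<noteq> []" using snoc by simp
      then obtain z u' where z: "u = z # u'" by (cases u) auto
      then show ?thesis using x(2) su by (simp add: X_def sum_unit_left)
    qed
    have "rotate (Suc n) (x # u) = y # x # v"
      using rotate_append[of "x # v" "[y]"] by (simp add: snoc n_def)
    moreover have "X (y # x # v) = (if tgt y = x then \<psi> (y # v) else 0)"
      using x(2) su by (simp add: X_def sum_unit_right snoc)
    moreover have "\<psi> u = (-1) ^ n * \<psi> (y # v)"
    proof -
      have "rotr 1 \<psi> u = (-1) ^ n * \<psi> (y # v)" by (simp add: rotr_def snoc n_def)
      then show ?thesis by (simp only: inv)
    qed
    moreover have "(-1) ^ (Suc n * Suc n) = ((-1) ^ Suc n :: 'k)"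
      by (simp add: power_mult) (cases "even n"; simp)
    ultimately have last: "rot (Suc n) X (x # u) = (if tgt y = x then - \<psi> u else 0)"
      by (simp add: rot_def snoc n_def)
    \<comment> \<open>Where \<open>\<psi>\<close> does not vanish the word \<open>u\<close> closes
      up, so the two absorption conditions at \<open>x\<close> hold or fail together.\<close>
    have "src (hd u) = tgt y" if "\<psi> u \<noteq> 0"
    proof -
      have "u \<in> cyc j" using sup that by (auto simp: supported_def)
      then show ?thesis using path_ends[of _ _ u] by (fastforce simp: cyc_def snoc)
    qed
    then have "X (x # u) + rot (Suc n) X (x # u) = 0"
      unfolding first last by (cases "\<psi> u = 0") auto
    moreover have "cnorm X (x # u)
        = X (x # u) + (\<Sum>i<n. rot (Suc i) X (x # u)) + rot (Suc n) X (x # u)"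
    proof -
      have "cnorm X (x # u) = (\<Sum>i<Suc (Suc n). rot i X (x # u))"
        by (simp add: cnorm_def snoc n_def)
      also have "\<dots> = (\<Sum>i<Suc n. rot i X (x # u)) + rot (Suc n) X (x # u)" by simp
      finally show ?thesis by (simp only: sum.lessThan_Suc_shift rot_0)
    qed
    ultimately show ?thesis using mid by simp
  qed
  moreover have "cnorm X w = rot p (cnorm X) w" by (simp add: rot_cnorm)
  ultimately show ?thesis unfolding b by (simp add: rot_def xu)
qed

text \<open>Normalised cochains on words starting with an idempotent are functions \<open>\<beta>\<close> of the remaining
positive word; on these the coboundary is the cone of \<open>1 - t\<close> from cobd to cobd'.\<close>

lemma cone_exact:
  assumes ex: "cexact c D n" and n: "n \<ge> 1"
    and sup: "supported (cyc j) \<psi>" and hom: "\<And>w. length w \<noteq> Suc n \<Longrightarrow> \<psi> w = 0"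
    and inv: "rotr 1 \<psi> = \<psi>" and coc: "cobd cp D \<psi> = (\<lambda>_. 0)"
  obtains \<alpha> \<beta> where "supported (cyc j) \<alpha>" "supported (cyc j) \<beta>"
    "\<And>w. Suc (length w) \<noteq> n \<Longrightarrow> \<beta> w = 0"
    "cobd cp D \<alpha> = \<psi>" "\<And>w. \<alpha> w - rotr 1 \<alpha> w = cobd' cp D \<beta> w"
proof -
  have "\<forall>w\<in>words D (n + 2). cobd c D \<psi> w = 0"
    using invariant_cocycle_extends[OF sup inv coc] by (auto simp: words_def)
  then obtain \<chi> where \<chi>: "\<And>w. w \<in> words D (n + 1) \<Longrightarrow> cobd c D \<chi> w = \<psi> w"
    using ex unfolding cexact_def by blast
  \<comment> \<open>The primitive \<open>\<chi>\<close> need not be normalised; only its values on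
    positive cyclic words, and on such words preceded by their source idempotent, are kept.\<close>
  define \<alpha> where "\<alpha> = (\<lambda>w. if w \<in> cyc j \<and> length w = n then \<chi> w else 0)"
  define \<beta> where "\<beta> = (\<lambda>w. if w \<in> cyc j \<and> Suc (length w) = n then \<chi> (src (hd w) # w) else 0)"
  have sup\<alpha>: "supported (cyc j) \<alpha>" and sup\<beta>: "supported (cyc j) \<beta>"
    by (auto simp: supported_def \<alpha>_def \<beta>_def)
  have words: "w \<in> words D k" if "w \<in> cyc j" "length w = k" for w k
    using cyc_set[OF that(1)] that(2) by (auto simp: words_def)
  have "cobd cp D \<alpha> w = \<psi> w" for w
  proof (cases "w \<in> cyc j \<and> length w = Suc n")
    case False
    have "cobd cp D \<alpha> w = 0"
    proof (cases "w \<in> cyc j")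
      case True
      then have "cobd cp D \<alpha> w = cobd cp D (\<lambda>_. 0) w"
        using False by (intro cobd_cong) (auto simp: \<alpha>_def)
      then show ?thesis by (simp add: lin_zero[OF lin_cobd])
    qed (use supported_cobd[OF sup\<alpha>] in \<open>auto simp: supported_def\<close>)
    then show ?thesis using False hom sup by (auto simp: supported_def)
  next
    case True
    \<comment> \<open>Contracting a word of \<open>cyc j\<close> stays in \<open>cyc j\<close>, so
      the cut-off in \<open>\<alpha>\<close> is not seen by the faces.\<close>
    have "face c D i \<chi> w = face cp D i \<alpha> w" for i
    proof -
      have r: "rotate i w \<in> cyc j" using True by (simp add: cyc_rotate)
      obtain x y v where xyv: "rotate i w = x # y # v"
        using True n length_rotate[of i w] by (cases "rotate i w"; cases "tl (rotate i w)") auto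
      have xy: "x \<in> {m..<D}" "y \<in> {m..<D}" using cyc_set[OF r] xyv by auto
      have len: "length v = n - 1" using True length_rotate[of i w] xyv by simp
      have "c x y l * rotr i \<chi> (l # v) = cp x y l * rotr i \<alpha> (l # v)" if "l < D" for l
      proof (cases "c x y l = 0")
        case False
        then have "cp x y l \<noteq> 0" using xy by (simp add: cp_def)
        then have "l # v \<in> cyc j" using cp_merge[of x y l "[]" v j] that r xyv by simp
        then have "rev (rotate i (rev (l # v))) \<in> cyc j" by (simp only: cyc_rotr)
        then show ?thesis using xy len n by (simp add: cp_def rotr_def \<alpha>_def)
      qed (simp add: cp_def)
      then show ?thesis by (simp add: face_def rot_def xyv)
    qed
    then have "cobd cp D \<alpha> w = cobd c D \<chi> w" by (simp add: cobd_def)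
    then show ?thesis using \<chi> words True by simp
  qed
  moreover have "\<alpha> w - rotr 1 \<alpha> w = cobd' cp D \<beta> w" for w
  proof (cases "w \<in> cyc j \<and> length w = n")
    case False
    have "cobd' cp D \<beta> w = 0"
    proof (cases "w \<in> cyc j")
      case True
      then have "cobd' cp D \<beta> w = cobd' cp D (\<lambda>_. 0) w"
        using False by (intro cobd'_cong) (auto simp: \<beta>_def)
      then show ?thesis by (simp add: lin_zero[OF lin_cobd'])
    qed (use supported_cobd'[OF sup\<beta>] in \<open>auto simp: supported_def\<close>)
    then show ?thesis using False by (auto simp: \<alpha>_def rotr_def cyc_rotr[of 1, simplified])
  next
    case True
    then have cw: "w \<in> cyc j" and lw: "length w = n" by auto
    have sw: "set w \<subseteq> {m..<D}" using cyc_set[OF cw] .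
    define e where "e = src (hd w)"
    have w0: "w \<noteq> []" using lw n by auto
    obtain z w' where zw: "w = z # w'" using w0 by (cases w) auto
    obtain u y where uy: "w = u @ [y]" using w0 by (cases w rule: rev_cases) auto
    have e: "e < m" "src z = e" "tgt y = e"
    proof -
      show "src z = e" by (simp add: e_def zw)
      then show "e < m" using src_less[of z] sw zw by auto
      show "tgt y = e" using cw path_ends[of _ _ w] by (fastforce simp: cyc_def e_def uy)
    qed
    have lu: "Suc (length u) = n" using lw uy by simp
    have "e # w \<in> words D (n + 1)" using sw e(1) m lw by (auto simp: words_def)
    then have "cobd c D \<chi> (e # w) = \<psi> (e # w)" by (rule \<chi>)
    also have "\<psi> (e # w) = 0"
      using sup cyc_set[of "e # w" j] e(1) by (auto simp: supported_def)
    finally have 0: "(\<Sum>i<Suc n. face c D i \<chi> (e # w)) = 0" by (simp add: cobd_def lw)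
    \<comment> \<open>On \<open>e # w\<close> the two outer faces absorb the idempotent and give
      \<open>\<chi> w - rotr 1 \<chi> w\<close>; the others merge letters of \<open>w\<close> and
      give minus the bar differential of \<open>\<beta>\<close>.\<close>
    have f0: "face c D 0 \<chi> (e # w) = \<chi> w"
      using sw e by (simp add: face_0 zw sum_unit_left)
    have "face c D n \<chi> (e # w) = (-1) ^ n * \<chi> (y # u)"
      using face_wrap[of u "length u" c D \<chi> e y] e sw lu
      by (simp add: uy sum_unit_right)
    moreover have "rotr 1 \<chi> w = (-1) ^ (length u) * \<chi> (y # u)"
      by (simp add: rotr_def uy)
    ultimately have fn: "face c D n \<chi> (e # w) = - rotr 1 \<chi> w" by (simp flip: lu)
    have fi: "face c D (Suc i) \<chi> (e # w) = - face cp D i \<beta> w" if "i < length u" for i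
    proof -
      have i: "Suc i < length w" using that lw lu by simp
      have "w = take i w @ w ! i # w ! Suc i # drop (i + 2) w"
        using i by (metis Cons_nth_drop_Suc Suc_lessD add_2_eq_Suc' append_take_drop_id)
      then have cwi: "take i w @ w ! i # w ! Suc i # drop (i + 2) w \<in> cyc j" using cw by simp
      have L: "w ! i \<in> {m..<D}" "w ! Suc i \<in> {m..<D}" using i by (auto intro!: subsetD[OF sw] simp del: atLeastLessThan_iff)
      have "c (w ! i) (w ! Suc i) l * \<chi> (e # take i w @ l # drop (i + 2) w)
          = cp (w ! i) (w ! Suc i) l * \<beta> (take i w @ l # drop (i + 2) w)" if l: "l < D" for l
      proof (cases "c (w ! i) (w ! Suc i) l = 0")
        case False
        then have nz: "cp (w ! i) (w ! Suc i) l \<noteq> 0" using L by (simp add: cp_def)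
        have mem: "take i w @ l # drop (i + 2) w \<in> cyc j"
          using cp_merge[OF nz l, of "take i w" "drop (i + 2) w" j] cwi by simp
        have "src (hd (take i w @ l # drop (i + 2) w)) = e"
          using cp_prod(7)[OF nz l] w0 by (cases i) (auto simp: e_def hd_conv_nth zw)
        then show ?thesis using mem i lw L n by (simp add: \<beta>_def cp_def)
      qed (simp add: cp_def)
      then show ?thesis using i by (simp add: face_nth)
    qed
    have "(\<Sum>i<Suc n. face c D i \<chi> (e # w))
        = (\<Sum>i<n. face c D i \<chi> (e # w)) + face c D n \<chi> (e # w)" by simp
    also have "(\<Sum>i<n. face c D i \<chi> (e # w)) = \<chi> w - (\<Sum>i<length u. face cp D i \<beta> w)"
      unfolding lu[symmetric] sum.lessThan_Suc_shift by (simp add: f0 fi sum_negf)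
    finally have "\<chi> w - (\<Sum>i<length u. face cp D i \<beta> w) - rotr 1 \<chi> w = 0"
      unfolding 0 fn by simp
    moreover have "length w - 1 = length u" using lu lw by simp
    ultimately have "\<chi> w - rotr 1 \<chi> w = cobd' cp D \<beta> w"
      unfolding cobd'_def by (simp only:) (simp add: algebra_simps)
    moreover have "rotr 1 \<alpha> w = rotr 1 \<chi> w"
      using True cyc_rotr[of 1 w j] by (simp add: rotr_def \<alpha>_def)
    ultimately show ?thesis using True by (simp add: \<alpha>_def)
  qed
  ultimately show ?thesis
    using sup\<alpha> sup\<beta> by (intro that[of \<alpha> \<beta>]) (auto simp: \<beta>_def)
qed

text \<open>The invariant cochains form Connes' cyclic complex. Exactness of the cone makes its cohomology
2-periodic, so that the induction descends from length L to L - 2.\<close>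

lemma cyclic_exact_homogeneous:
  assumes ex: "\<And>n. n \<ge> n0 \<Longrightarrow> cexact c D n" and n0: "n0 \<ge> 1"
    and long: "\<And>w. w \<in> cyc j \<Longrightarrow> n0 < length w"
    and "supported (cyc j) \<psi>" "\<And>w. length w \<noteq> L \<Longrightarrow> \<psi> w = 0"
      "rotr 1 \<psi> = \<psi>" "cobd cp D \<psi> = (\<lambda>_. 0)"
  shows "\<exists>\<phi>. supported (cyc j) \<phi> \<and> rotr 1 \<phi> = \<phi> \<and> cobd cp D \<phi> = \<psi>"
  using assms(4-)
proof (induction L arbitrary: \<psi> rule: less_induct)
  case (less L)
  note sup = less.prems(1) and hom = less.prems(2) and inv = less.prems(3) and coc = less.prems(4)
  show ?case
  proof (cases "L \<le> n0")
    case True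
    then have "\<psi> w = 0" for w
      using sup hom[of w] long[of w] by (cases "w \<in> cyc j") (auto simp: supported_def)
    then have "\<psi> = (\<lambda>_. 0)" by auto
    then show ?thesis using sup inv coc by blast
  next
    case False
    then obtain n where n: "L = Suc n" "n \<ge> n0" by (cases L) auto
    obtain \<alpha> \<beta> where \<alpha>\<beta>: "supported (cyc j) \<alpha>" "supported (cyc j) \<beta>"
      "\<And>w. Suc (length w) \<noteq> n \<Longrightarrow> \<beta> w = 0"
      "cobd cp D \<alpha> = \<psi>" "\<And>w. \<alpha> w - rotr 1 \<alpha> w = cobd' cp D \<beta> w"
      by (rule cone_exact[OF ex[OF n(2)] _ sup _ inv coc]) (use n n0 hom in auto)
    \<comment> \<open>By \<open>cobd_cnorm\<close> this is the norm of \<open>\<alpha>\<close> minus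
      its rotation, hence 0. So \<open>cnorm \<beta>\<close> is an invariant cocycle, on words two
      letters shorter than those of \<open>\<psi>\<close>.\<close>
    have cocb: "cobd cp D (cnorm \<beta>) w = 0" for w
    proof -
      have "cobd' cp D \<beta> = (\<lambda>w. \<alpha> w - rotr 1 \<alpha> w)"
        by (rule ext) (simp only: \<alpha>\<beta>(5))
      then have "cobd cp D (cnorm \<beta>) w = cnorm (\<lambda>w. \<alpha> w - rotr 1 \<alpha> w) w"
        by (simp only: cobd_cnorm)
      then show ?thesis by (simp add: lin_diff[OF lin_cnorm] cnorm_rotr)
    qed
    have "\<exists>\<phi>. supported (cyc j) \<phi> \<and> rotr 1 \<phi> = \<phi> \<and> cobd cp D \<phi> = cnorm \<beta>"
    proof (rule less.IH[of "n - 1"])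
      show "n - 1 < L" using n by simp
      show "cnorm \<beta> w = 0" if "length w \<noteq> n - 1" for w
        unfolding cnorm_def rot_def using that \<alpha>\<beta>(3) by (intro sum.neutral) auto
    qed (use cocb in \<open>auto intro: supported_cnorm \<alpha>\<beta>(2) rotr_cnorm[of 1, simplified]\<close>)
    then obtain \<gamma> where \<gamma>: "supported (cyc j) \<gamma>" "rotr 1 \<gamma> = \<gamma>" "cobd cp D \<gamma> = cnorm \<beta>"
      by blast
    \<comment> \<open>On invariant cochains the norm is multiplication by the length, so rescaling
      produces a preimage of \<open>\<gamma>\<close> under the norm.\<close>
    define \<gamma>' where "\<gamma>' = (\<lambda>w. \<gamma> w / of_nat (length w))"
    have sup\<gamma>': "supported (cyc j) \<gamma>'" using \<gamma>(1) by (auto simp: supported_def \<gamma>'_def)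
    have "rotr 1 \<gamma>' w = \<gamma>' w" for w
      using fun_cong[OF \<gamma>(2), of w] by (simp add: rotr_def \<gamma>'_def)
    then have inv\<gamma>': "rotr 1 \<gamma>' = \<gamma>'" by auto
    have nil: "\<phi> [] = 0" if "supported (cyc j) \<phi>" for \<phi> :: "nat list \<Rightarrow> 'k"
      using that by (simp add: supported_def cyc_def)
    have norm\<gamma>': "cnorm \<gamma>' = \<gamma>"
    proof
      fix w show "cnorm \<gamma>' w = \<gamma> w"
        using nil[OF \<gamma>(1)]
        by (cases "w = []") (simp_all only: cnorm_inv[OF inv\<gamma>'], simp_all add: \<gamma>'_def)
    qed
    \<comment> \<open>\<open>\<gamma>'\<close> is chosen so that this difference has norm 0 and
      hence lies in the image of 1 - t.\<close>
    define \<delta> where "\<delta> = (\<lambda>w. \<beta> w - cobd' cp D \<gamma>' w)"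
    have sup\<delta>: "supported (cyc j) \<delta>"
      using \<alpha>\<beta>(2) supported_cobd'[OF sup\<gamma>'] by (auto simp: supported_def \<delta>_def)
    have n\<delta>: "cnorm \<delta> w = 0" for w
      unfolding \<delta>_def by (simp add: lin_diff[OF lin_cnorm] cobd_cnorm[symmetric] norm\<gamma>' \<gamma>(3))
    define \<epsilon> where "\<epsilon> = rot_primitive \<delta>"
    have \<epsilon>: "supported (cyc j) \<epsilon>" by (simp add: \<epsilon>_def supported_rot_primitive sup\<delta>)
    have \<epsilon>\<delta>: "(\<lambda>w. \<epsilon> w - rotr 1 \<epsilon> w) = \<delta>"
    proof
      fix w show "\<epsilon> w - rotr 1 \<epsilon> w = \<delta> w"
      proof (cases "w = []")
        case True
        then show ?thesis using nil[OF sup\<delta>] nil[OF \<epsilon>] by (simp add: rotr_def)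
      next
        case False
        then show ?thesis unfolding \<epsilon>_def by (rule rot_primitive) (rule n\<delta>)
      qed
    qed
    \<comment> \<open>The correction leaves the coboundary alone and makes \<open>\<alpha>\<close>
      invariant, because (1 - t) b \<epsilon> = b' (1 - t) \<epsilon> = b' \<beta> = (1 - t)
      \<alpha>.\<close>
    define \<phi> where "\<phi> = (\<lambda>w. \<alpha> w - cobd cp D \<epsilon> w)"
    have "supported (cyc j) \<phi>"
      using \<alpha>\<beta>(1) supported_cobd[OF \<epsilon>] by (auto simp: supported_def \<phi>_def)
    moreover have "rotr 1 \<phi> = \<phi>"
    proof
      fix w
      have "cobd cp D \<epsilon> w - rotr 1 (cobd cp D \<epsilon>) w = cobd' cp D (\<lambda>w. \<epsilon> w - rotr 1 \<epsilon> w) w"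
        by (simp only: cobd'_diff)
      also have "\<dots> = cobd' cp D \<beta> w"
        unfolding \<epsilon>\<delta> by (simp add: \<delta>_def lin_diff[OF lin_cobd'] cobd_cobd(2)[OF cp_assoc])
      also have "\<dots> = \<alpha> w - rotr 1 \<alpha> w" by (simp only: \<alpha>\<beta>(5))
      finally show "rotr 1 \<phi> w = \<phi> w"
        unfolding \<phi>_def by (simp add: lin_diff[OF lin_rotr] algebra_simps)
    qed
    moreover have "cobd cp D \<phi> = \<psi>"
      unfolding \<phi>_def by (rule ext) (simp add: lin_diff[OF lin_cobd] cobd_cobd(1)[OF cp_assoc] \<alpha>\<beta>(4))
    ultimately show ?thesis by blast
  qed
qed

lemma cyclic_exact:
  assumes ex: "\<And>n. n \<ge> n0 \<Longrightarrow> cexact c D n" and n0: "n0 \<ge> 1"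
    and long: "\<And>w. w \<in> cyc j \<Longrightarrow> n0 < length w"
    and sup: "supported (cyc j) \<psi>" and inv: "rotr 1 \<psi> = \<psi>" and coc: "cobd cp D \<psi> = (\<lambda>_. 0)"
  shows "\<exists>\<phi>. supported (cyc j) \<phi> \<and> rotr 1 \<phi> = \<phi> \<and> cobd cp D \<phi> = \<psi>"
proof -
  define part where "part = (\<lambda>L (f :: nat list \<Rightarrow> 'k) w. if length w = L then f w else 0)"
  have "\<exists>\<phi>. supported (cyc j) \<phi> \<and> rotr 1 \<phi> = \<phi> \<and> cobd cp D \<phi> = part L \<psi>" for L
  proof (rule cyclic_exact_homogeneous[OF ex n0 long, where L = L])
    show "supported (cyc j) (part L \<psi>)" using sup by (auto simp: part_def supported_def)
    show "rotr 1 (part L \<psi>) = part L \<psi>"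
      using fun_cong[OF inv] by (auto simp: part_def rotr_def fun_eq_iff)
    have "cobd cp D (part L \<psi>) w = 0" for w
    proof (cases "length w = Suc L")
      case True
      then have "cobd cp D (part L \<psi>) w = cobd cp D \<psi> w"
        by (intro cobd_cong) (auto simp: part_def)
      then show ?thesis by (simp add: coc)
    next
      case False
      then have "cobd cp D (part L \<psi>) w = cobd cp D (\<lambda>_. 0) w"
        by (intro cobd_cong) (auto simp: part_def)
      then show ?thesis by (simp add: lin_zero[OF lin_cobd])
    qed
    then show "cobd cp D (part L \<psi>) = (\<lambda>_. 0)" by auto
  qed (auto simp: part_def)
  then obtain \<Phi> where \<Phi>: "\<And>L. supported (cyc j) (\<Phi> L)" "\<And>L. rotr 1 (\<Phi> L) = \<Phi> L"
    "\<And>L. cobd cp D (\<Phi> L) = part L \<psi>" by metis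
  \<comment> \<open>The coboundary raises length by one, so a word takes its value from the
    primitive of the part of \<open>\<psi>\<close> that is one letter longer.\<close>
  define \<phi> where "\<phi> = (\<lambda>w. \<Phi> (Suc (length w)) w)"
  have "supported (cyc j) \<phi>" using \<Phi>(1) by (auto simp: supported_def \<phi>_def)
  moreover have "rotr 1 \<phi> w = \<phi> w" for w
    using fun_cong[OF \<Phi>(2)[of "Suc (length w)"], of w] by (simp add: rotr_def \<phi>_def)
  moreover have "cobd cp D \<phi> w = \<psi> w" for w
  proof -
    have "cobd cp D \<phi> w = cobd cp D (\<Phi> (length w)) w"
      by (rule cobd_cong) (simp add: \<phi>_def)
    then show ?thesis by (simp add: \<Phi>(3) part_def)
  qed
  ultimately show ?thesis by blast
qed

text \<open>Averaging over rotations projects onto the invariant cochains. Its trace against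
  (-1)^length is, up to sign, the Euler characteristic of the cyclic complex in degree
  \<open>j\<close>; the diagonal entry at \<open>w\<close> adds the signs of the rotations fixing
  \<open>w\<close> and divides by the length.\<close>

lemma cyclic_trace_zero:
  assumes ex: "\<And>n. n \<ge> n0 \<Longrightarrow> cexact c D n" and n0: "n0 \<ge> 1"
    and long: "\<And>w. w \<in> cyc j \<Longrightarrow> n0 < length w"
  shows "(\<Sum>w\<in>cyc j. (-1) ^ length w * (\<Sum>i<length w. if rotate i w = w
      then (-1) ^ ((length w - 1) * i) else 0) / of_nat (length w)) = (0 :: 'k)"
proof -
  define P where "P = (\<lambda>(\<psi> :: nat list \<Rightarrow> 'k) w. cnorm \<psi> w / of_nat (length w))"
  define eps where "eps = (\<lambda>w :: nat list. (-1) ^ length w :: 'k)"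
  have invP: "rotr 1 (P \<psi>) = P \<psi>" for \<psi>
  proof
    fix w show "rotr 1 (P \<psi>) w = P \<psi> w"
      using fun_cong[OF rotr_cnorm[of 1 \<psi>], of w] by (simp add: rotr_def P_def)
  qed
  have Pinv: "P \<psi> = \<psi>" if "rotr 1 \<psi> = \<psi>" "\<psi> [] = 0" for \<psi>
    using that by (auto simp: fun_eq_iff P_def cnorm_inv)
  have inv: "rotr 1 \<psi> = \<psi>" if "P \<psi> = \<psi>" for \<psi> using invP[of \<psi>] that by simp
  have "(\<Sum>w\<in>cyc j. eps w * P (ind w) w) = 0"
  proof (rule supertrace_exact[of _ "cobd cp D"])
    show "lin P"
      by (rule linI) (simp_all add: P_def lin_add[OF lin_cnorm] lin_scale[OF lin_cnorm] add_divide_distrib)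
    show "supported (cyc j) (P f)" if "supported (cyc j) f" for f
      using supported_cnorm[OF that] by (auto simp: supported_def P_def)
    show "P (P f) = P f" for f by (rule Pinv[OF invP]) (simp add: P_def)
    show "P (cobd cp D (P f)) = cobd cp D (P f)" for f
      by (rule Pinv[OF rotr_cobd_inv[OF invP]]) (simp add: cobd_def)
    show "cobd cp D (cobd cp D f) = (\<lambda>_. 0)" for f
      by (rule ext) (rule cobd_cobd(1)[OF cp_assoc])
    show "P (\<lambda>x. eps x * f x) = (\<lambda>x. eps x * P f x)" for f
      by (auto simp: fun_eq_iff P_def eps_def cnorm_def rot_def sum_distrib_left mult_ac)
    show "cobd cp D (\<lambda>x. eps x * f x) = (\<lambda>x. - (eps x * cobd cp D f x))" for f
    proof
      fix w
      have "cobd cp D (\<lambda>x. eps x * f x) w = cobd cp D (\<lambda>x. - eps w * f x) w"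
      proof (rule cobd_cong)
        fix v :: "nat list" assume "Suc (length v) = length w"
        then have "length w = Suc (length v)" by simp
        then show "eps v * f v = - eps w * f v" by (simp add: eps_def)
      qed
      then show "cobd cp D (\<lambda>x. eps x * f x) w = - (eps w * cobd cp D f w)"
        by (simp only: lin_scale[OF lin_cobd]) simp
    qed
    show "\<exists>g. supported (cyc j) g \<and> P g = g \<and> cobd cp D g = f"
      if f: "supported (cyc j) f" "P f = f" "cobd cp D f = (\<lambda>_. 0)" for f
    proof -
      obtain g where g: "supported (cyc j) g" "rotr 1 g = g" "cobd cp D g = f"
        using cyclic_exact[OF ex n0 long f(1) inv[OF f(2)] f(3)] by blast
      moreover have "g [] = 0" using g(1) by (simp add: supported_def cyc_def)
      ultimately show ?thesis using Pinv by blast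
    qed
  qed (auto intro: finite_cyc lin_cobd supported_cobd)
  then show ?thesis
    by (simp add: P_def eps_def cnorm_def rot_def ind_def if_distrib[of "\<lambda>x. _ * x"] cong: if_cong)
qed

end

section \<open>Trivial extensions\<close>

lemma sum_double: "(\<Sum>l<2 * n. f l) = (\<Sum>l<n. f l) + (\<Sum>l<n. f (n + l :: nat) :: 'a::comm_monoid_add)"
proof -
  have "(\<Sum>l<n + n. f l) = (\<Sum>l<n. f l) + (\<Sum>l\<in>{n..<n + n}. f l)"
    by (simp add: lessThan_atLeast0 sum.atLeastLessThan_concat)
  also have "(\<Sum>l\<in>{n..<n + n}. f l) = (\<Sum>l<n. f (n + l))"
    using sum.shift_bounds_nat_ivl[of f 0 n n] by (simp add: lessThan_atLeast0 add.commute)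
  finally show ?thesis by (simp add: mult_2)
qed

lemma triv_ext_simps:
  "i < n \<Longrightarrow> j < n \<Longrightarrow> l < n \<Longrightarrow> triv_ext c n i j l = c i j l"
  "i < n \<Longrightarrow> j < n \<Longrightarrow> triv_ext c n i j (n + l) = 0"
  "i < n \<Longrightarrow> l < n \<Longrightarrow> triv_ext c n i (n + j) l = 0"
  "i < n \<Longrightarrow> j < n \<Longrightarrow> k < n \<Longrightarrow> triv_ext c n i (n + j) (n + k) = c k i j"
  "j < n \<Longrightarrow> l < n \<Longrightarrow> triv_ext c n (n + i) j l = 0"
  "i < n \<Longrightarrow> j < n \<Longrightarrow> k < n \<Longrightarrow> triv_ext c n (n + i) j (n + k) = c j k i"
  "triv_ext c n (n + i) (n + j) l = 0"
  by (auto simp: triv_ext_def)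

lemma less_doubleE:
  fixes i n :: nat
  assumes "i < 2 * n"
  obtains "i < n" | i' where "i = n + i'" "i' < n"
  using assms by (cases "i < n") (auto simp: not_less le_iff_add)

context path_algebra
begin

text \<open>One more than the largest degree, so that every dual basis element gets positive
  degree.\<close>

definition top_deg :: nat where
  "top_deg = Suc (Max (dg ` {..<D}))"

text \<open>The left action on functionals comes from right multiplication, so the dual of an
  element running from \<open>src\<close> to \<open>tgt\<close> runs from \<open>tgt\<close> to
  \<open>src\<close>.\<close>

definition ext_src :: "nat \<Rightarrow> nat" where
  "ext_src i = (if i < D then src i else tgt (i - D))"

definition ext_tgt :: "nat \<Rightarrow> nat" where
  "ext_tgt i = (if i < D then tgt i else src (i - D))"

definition ext_dg :: "nat \<Rightarrow> nat" where
  "ext_dg i = (if i < D then dg i else top_deg - dg (i - D))"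

lemma dg_less_top: "i < D \<Longrightarrow> dg i < top_deg"
  by (simp add: top_deg_def less_Suc_eq_le)

text \<open>With two or more factors in DA both sides are 0. With exactly one, the coefficient of a
  dual basis element turns the claim into associativity of \<open>c\<close> for that element's index
  and the two factors in A.\<close>

lemma triv_ext_assoc:
  assumes "x < 2 * D" "y < 2 * D" "z < 2 * D" "r < 2 * D"
  shows "(\<Sum>l<2 * D. triv_ext c D x y l * triv_ext c D l z r)
       = (\<Sum>l<2 * D. triv_ext c D y z l * triv_ext c D x l r)"
  unfolding sum_double
  using assms(1)
proof (cases x rule: less_doubleE)
  case 1
  note x = 1
  show "(\<Sum>l<D. triv_ext c D x y l * triv_ext c D l z r) + (\<Sum>l<D. triv_ext c D x y (D + l) * triv_ext c D (D + l) z r)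
      = (\<Sum>l<D. triv_ext c D y z l * triv_ext c D x l r) + (\<Sum>l<D. triv_ext c D y z (D + l) * triv_ext c D x (D + l) r)"
    using assms(2)
  proof (cases y rule: less_doubleE)
    case 1
    note y = 1
    show ?thesis using assms(3)
    proof (cases z rule: less_doubleE)
      case 1
      show ?thesis using assms(4)
        by (cases r rule: less_doubleE) (simp_all add: triv_ext_simps x y 1 assoc)
    next
      case (2 Z)
      show ?thesis using assms(4)
        by (cases r rule: less_doubleE)
           (simp_all add: triv_ext_simps x y 2 assoc[of _ x y Z, symmetric] mult.commute[of "c _ y Z"])
    qed
  next
    case (2 Y)
    note y = 2
    show ?thesis using assms(3)
    proof (cases z rule: less_doubleE)
      case 1
      show ?thesis using assms(4)
        by (cases r rule: less_doubleE)
           (simp_all add: triv_ext_simps x y 1 assoc[of z _ x Y] mult.commute[of "c _ x Y"] mult.commute[of "c z _ Y"])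
    next
      case (2 Z)
      show ?thesis using assms(4)
        by (cases r rule: less_doubleE) (simp_all add: triv_ext_simps x y 2)
    qed
  qed
next
  case (2 X)
  note x = 2
  show "(\<Sum>l<D. triv_ext c D x y l * triv_ext c D l z r) + (\<Sum>l<D. triv_ext c D x y (D + l) * triv_ext c D (D + l) z r)
      = (\<Sum>l<D. triv_ext c D y z l * triv_ext c D x l r) + (\<Sum>l<D. triv_ext c D y z (D + l) * triv_ext c D x (D + l) r)"
    using assms(2)
  proof (cases y rule: less_doubleE)
    case 1
    note y = 1
    show ?thesis using assms(3)
    proof (cases z rule: less_doubleE)
      case 1
      show ?thesis using assms(4)
        by (cases r rule: less_doubleE)
           (simp_all add: triv_ext_simps x y 1 assoc[of y z _ X] mult.commute[of "c y _ X"])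
    next
      case (2 Z)
      show ?thesis using assms(4)
        by (cases r rule: less_doubleE) (simp_all add: triv_ext_simps x y 2)
    qed
  next
    case (2 Y)
    note y = 2
    show ?thesis using assms(3)
    proof (cases z rule: less_doubleE)
      case 1
      show ?thesis using assms(4)
        by (cases r rule: less_doubleE) (simp_all add: triv_ext_simps x y 1)
    next
      case (2 Z)
      show ?thesis using assms(4)
        by (cases r rule: less_doubleE) (simp_all add: triv_ext_simps x y 2)
    qed
  qed
qed

lemma path_algebra_triv_ext: "path_algebra (triv_ext c D) (2 * D) m ext_src ext_tgt ext_dg"
proof
  show "0 < m" "m \<le> 2 * D" using m by auto
  show "ext_src i < m" "ext_tgt i < m" if "i < 2 * D" for i
    using that by (auto simp: ext_src_def ext_tgt_def src_less tgt_less)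
  show "ext_src i = i" "ext_tgt i = i" "ext_dg i = 0" if "i < m" for i
    using that m by (auto simp: ext_src_def ext_tgt_def ext_dg_def idem)
  show "0 < ext_dg i" if "m \<le> i" "i < 2 * D" for i
    using that dg_less_top[of "i - D"] by (auto simp: ext_dg_def pos)
  show "triv_ext c D a j l = (if ext_src j = a \<and> l = j then 1 else 0)"
    if "a < m" "j < 2 * D" "l < 2 * D" for a j l
    using that(2,3) m that(1)
    by (elim less_doubleE)
       (auto simp: triv_ext_simps ext_src_def unit_left unit_right)
  show "triv_ext c D j a l = (if ext_tgt j = a \<and> l = j then 1 else 0)"
    if "a < m" "j < 2 * D" "l < 2 * D" for a j l
    using that(2,3) m that(1)
    by (elim less_doubleE)
       (auto simp: triv_ext_simps ext_tgt_def unit_left unit_right)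
  show "ext_dg l = ext_dg i + ext_dg j \<and> ext_tgt i = ext_src j \<and> ext_src l = ext_src i \<and> ext_tgt l = ext_tgt j"
    if h: "i < 2 * D" "j < 2 * D" "l < 2 * D" "triv_ext c D i j l \<noteq> 0" for i j l
    using h(1)
  proof (cases i rule: less_doubleE)
    case 1
    note i = 1
    show ?thesis using h(2)
    proof (cases j rule: less_doubleE)
      case 1
      have "l < D" using h(3,4) i 1
        by (cases l rule: less_doubleE) (auto simp: triv_ext_simps)
      then show ?thesis using prod[of i j l] h(4) i 1
        by (simp add: triv_ext_simps ext_dg_def ext_src_def ext_tgt_def)
    next
      case (2 j')
      obtain k where k: "l = D + k" "k < D" using h(3,4) i 2
        by (cases l rule: less_doubleE) (auto simp: triv_ext_simps)
      then have "dg j' = dg k + dg i \<and> tgt k = src i \<and> src j' = src k \<and> tgt j' = tgt i"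
        using prod[of k i j'] h(4) i 2 by (simp add: triv_ext_simps)
      \<comment> \<open>The bound keeps the truncated subtraction in \<open>ext_dg\<close>
        exact.\<close>
      then show ?thesis using i 2 k dg_less_top[of j']
        by (simp add: ext_dg_def ext_src_def ext_tgt_def)
    qed
  next
    case (2 i')
    note i = 2
    show ?thesis using h(2)
    proof (cases j rule: less_doubleE)
      case 1
      obtain k where k: "l = D + k" "k < D" using h(3,4) i 1
        by (cases l rule: less_doubleE) (auto simp: triv_ext_simps)
      then have "dg i' = dg j + dg k \<and> tgt j = src k \<and> src i' = src j \<and> tgt i' = tgt k"
        using prod[of j k i'] h(4) i 1 by (simp add: triv_ext_simps)
      then show ?thesis using i 1 k dg_less_top[of i']
        by (simp add: ext_dg_def ext_src_def ext_tgt_def)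
    next
      case (2 j')
      then show ?thesis using h(4) i by (simp add: triv_ext_simps)
    qed
  qed
qed (rule triv_ext_assoc)

lemma ext_dg_le: "i < 2 * D \<Longrightarrow> ext_dg i \<le> top_deg"
  using dg_less_top[of i] by (auto simp: ext_dg_def)

lemma ext_dg_eq_top:
  assumes "i < 2 * D"
  shows "ext_dg i = top_deg \<longleftrightarrow> (\<exists>a<m. i = D + a)"
  using assms
proof (cases i rule: less_doubleE)
  case 1
  then show ?thesis using dg_less_top[of i] by (simp add: ext_dg_def)
next
  case (2 a)
  then show ?thesis using dg_less_top[of a] idem(3)[of a] pos[of a]
    by (cases "a < m") (auto simp: ext_dg_def)
qed

end

section \<open>Conjugate structure constants\<close>

text \<open>Block matrix of \<open>P\<close> and the transpose of \<open>Q\<close>: when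
  \<open>Q\<close> is inverse to \<open>P\<close>, this is how a basis and its dual basis change
  together.\<close>

definition dbl :: "nat \<Rightarrow> nat \<Rightarrow> (nat \<Rightarrow> nat \<Rightarrow> 'k::field) \<Rightarrow> (nat \<Rightarrow> nat \<Rightarrow> 'k) \<Rightarrow> nat \<Rightarrow> nat \<Rightarrow> 'k" where
  "dbl n d P Q i a = (if i < n \<and> a < d then P i a
      else if n \<le> i \<and> d \<le> a then Q (a - d) (i - n) else 0)"

lemma dbl_simps:
  "i < n \<Longrightarrow> a < d \<Longrightarrow> dbl n d P Q i a = P i a"
  "i < n \<Longrightarrow> dbl n d P Q i (d + a) = 0"
  "a < d \<Longrightarrow> dbl n d P Q (n + i) a = 0"
  "dbl n d P Q (n + i) (d + a) = Q a i"
  by (auto simp: dbl_def)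

text \<open>The rows of \<open>P\<close> are the new basis vectors in old coordinates, and
  \<open>Q\<close> converts back to new coordinates.\<close>

definition conj_sc :: "nat \<Rightarrow> nat \<Rightarrow> (nat \<Rightarrow> nat \<Rightarrow> 'k::field) \<Rightarrow> (nat \<Rightarrow> nat \<Rightarrow> 'k) \<Rightarrow> 'k sc \<Rightarrow> 'k sc \<Rightarrow> bool" where
  "conj_sc n d P Q c c' \<longleftrightarrow> (\<forall>i<n. \<forall>j<n. \<forall>l<n.
     c' i j l = (\<Sum>a<d. P i a * (\<Sum>b<d. P j b * (\<Sum>e<d. c a b e * Q e l))))"

definition inv_mat :: "nat \<Rightarrow> nat \<Rightarrow> (nat \<Rightarrow> nat \<Rightarrow> 'k::field) \<Rightarrow> (nat \<Rightarrow> nat \<Rightarrow> 'k) \<Rightarrow> bool" where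
  "inv_mat n d P Q \<longleftrightarrow> (\<forall>i<n. \<forall>j<n. (\<Sum>a<d. P i a * Q a j) = (if i = j then 1 else 0))"

lemma collapse_left:
  assumes "inv_mat d n Q P" "v < d"
  shows "(\<Sum>l<n. Q v l * (\<Sum>x<d. P l x * F x)) = F v"
proof -
  have "(\<Sum>l<n. Q v l * (\<Sum>x<d. P l x * F x)) = (\<Sum>x<d. (\<Sum>l<n. Q v l * P l x) * F x)"
    by (simp add: sum_distrib_left sum_distrib_right mult.assoc) (rule sum.swap)
  also have "\<dots> = (\<Sum>x<d. if v = x then F x else 0)"
    using assms by (intro sum.cong refl) (simp add: inv_mat_def)
  finally show ?thesis using assms(2) by simp
qed

lemma collapse_right:
  assumes "inv_mat d n Q P" "v < d"
  shows "(\<Sum>l<n. (\<Sum>e<d. F e * Q e l) * P l v) = F v"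
proof -
  have "(\<Sum>l<n. (\<Sum>e<d. F e * Q e l) * P l v) = (\<Sum>e<d. F e * (\<Sum>l<n. Q e l * P l v))"
    by (simp add: sum_distrib_left sum_distrib_right mult.assoc) (rule sum.swap)
  also have "\<dots> = (\<Sum>e<d. if e = v then F e else 0)"
    using assms by (intro sum.cong refl) (simp add: inv_mat_def)
  finally show ?thesis using assms(2) by simp
qed

lemma conj_sc_intertwine:
  assumes conj: "conj_sc n d P Q c c'" and QP: "inv_mat d n Q P"
    and "i < n" "j < n" "v < d"
  shows "(\<Sum>l<n. c' i j l * P l v) = (\<Sum>a<d. \<Sum>b<d. P i a * P j b * c a b v)"
proof -
  have "c' i j l = (\<Sum>e<d. (\<Sum>a<d. \<Sum>b<d. P i a * P j b * c a b e) * Q e l)" if "l < n" for l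
  proof -
    have "c' i j l = (\<Sum>a<d. P i a * (\<Sum>b<d. P j b * (\<Sum>e<d. c a b e * Q e l)))"
      using conj assms that by (simp add: conj_sc_def)
    also have "\<dots> = (\<Sum>a<d. \<Sum>b<d. \<Sum>e<d. P i a * P j b * c a b e * Q e l)"
      by (simp add: sum_distrib_left mult.assoc)
    also have "\<dots> = (\<Sum>a<d. \<Sum>e<d. \<Sum>b<d. P i a * P j b * c a b e * Q e l)"
      by (intro sum.cong refl sum.swap)
    also have "\<dots> = (\<Sum>e<d. \<Sum>a<d. \<Sum>b<d. P i a * P j b * c a b e * Q e l)"
      by (rule sum.swap)
    finally show ?thesis by (simp add: sum_distrib_right)
  qed
  then have "(\<Sum>l<n. c' i j l * P l v)
      = (\<Sum>l<n. (\<Sum>e<d. (\<Sum>a<d. \<Sum>b<d. P i a * P j b * c a b e) * Q e l) * P l v)"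
    by simp
  also have "\<dots> = (\<Sum>a<d. \<Sum>b<d. P i a * P j b * c a b v)"
    by (rule collapse_right[OF QP \<open>v < d\<close>])
  finally show ?thesis .
qed

lemma conj_sc_sym:
  assumes conj: "conj_sc n d P Q c c'" and QP: "inv_mat d n Q P"
  shows "conj_sc d n Q P c' c"
  unfolding conj_sc_def
proof (intro allI impI)
  fix i j l assume l: "i < d" "j < d" "l < d"
  have swap: "(\<Sum>b<n. Q j b * (\<Sum>x<d. \<Sum>y<d. P a x * P b y * c x y l))
      = (\<Sum>x<d. P a x * (\<Sum>b<n. Q j b * (\<Sum>y<d. P b y * c x y l)))" for a
  proof -
    have "(\<Sum>b<n. Q j b * (\<Sum>x<d. \<Sum>y<d. P a x * P b y * c x y l))
        = (\<Sum>b<n. \<Sum>x<d. P a x * (Q j b * (\<Sum>y<d. P b y * c x y l)))"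
      by (intro sum.cong refl) (simp add: sum_distrib_left mult_ac)
    then show ?thesis by (subst (asm) sum.swap) (simp only: sum_distrib_left)
  qed
  have "(\<Sum>a<n. Q i a * (\<Sum>b<n. Q j b * (\<Sum>e<n. c' a b e * P e l)))
      = (\<Sum>a<n. Q i a * (\<Sum>b<n. Q j b * (\<Sum>x<d. \<Sum>y<d. P a x * P b y * c x y l)))"
    using conj_sc_intertwine[OF conj QP _ _ l(3)] by simp
  also have "\<dots> = c i j l"
    by (simp only: swap collapse_left[OF QP l(2)] collapse_left[OF QP l(1)])
  finally show "c i j l = (\<Sum>a<n. Q i a * (\<Sum>b<n. Q j b * (\<Sum>e<n. c' a b e * P e l)))" ..
qed

text \<open>An isomorphism of algebras extends to the trivial extensions, acting on DA by the
  transposed inverse. \<open>AD\<close> and \<open>DA\<close> are the two mixed blocks, where a sum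
  of \<open>Q\<close> against \<open>P\<close> collapses.\<close>

lemma conj_sc_triv_ext:
  assumes conj: "conj_sc n d P Q c c'" and QP: "inv_mat d n Q P"
    and "i < 2 * n" "j < 2 * n" "v < 2 * d"
  shows "(\<Sum>a<2 * d. \<Sum>b<2 * d. dbl n d P Q i a * dbl n d P Q j b * triv_ext c d a b v)
       = (\<Sum>l<2 * n. triv_ext c' n i j l * dbl n d P Q l v)"
proof -
  have c': "c' i j l = (\<Sum>a<d. P i a * (\<Sum>b<d. P j b * (\<Sum>e<d. c a b e * Q e l)))"
    if "i < n" "j < n" "l < n" for i j l using that conj by (simp add: conj_sc_def)
  have AD: "(\<Sum>l<n. c' l i J * Q V l) = (\<Sum>a<d. \<Sum>b<d. P i a * Q b J * c V a b)"
    if "i < n" "J < n" "V < d" for i J V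
  proof -
    have "(\<Sum>l<n. c' l i J * Q V l)
        = (\<Sum>l<n. Q V l * (\<Sum>a<d. P l a * (\<Sum>b<d. P i b * (\<Sum>e<d. c a b e * Q e J))))"
      using that by (intro sum.cong refl) (simp add: c' mult.commute)
    also have "\<dots> = (\<Sum>b<d. P i b * (\<Sum>e<d. c V b e * Q e J))"
      by (rule collapse_left[OF QP that(3)])
    finally show ?thesis by (simp add: sum_distrib_left mult_ac)
  qed
  have DA: "(\<Sum>l<n. c' j l I * Q V l) = (\<Sum>a<d. \<Sum>b<d. Q a I * P j b * c b V a)"
    if "j < n" "I < n" "V < d" for j I V
  proof -
    have "(\<Sum>l<n. c' j l I * Q V l)
        = (\<Sum>l<n. \<Sum>a<d. P j a * (Q V l * (\<Sum>b<d. P l b * (\<Sum>e<d. c a b e * Q e I))))"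
      using that
      by (intro sum.cong refl) (simp only: c' lessThan_iff sum_distrib_right, simp only: mult_ac)
    also have "\<dots> = (\<Sum>a<d. P j a * (\<Sum>l<n. Q V l * (\<Sum>b<d. P l b * (\<Sum>e<d. c a b e * Q e I))))"
      by (subst sum.swap) (simp only: sum_distrib_left)
    also have "\<dots> = (\<Sum>a<d. P j a * (\<Sum>e<d. c a V e * Q e I))"
      by (simp only: collapse_left[OF QP that(3)])
    also have "\<dots> = (\<Sum>a<d. \<Sum>b<d. Q a I * P j b * c b V a)"
      by (simp add: sum_distrib_left mult_ac) (rule sum.swap)
    finally show ?thesis .
  qed
  note AA = conj_sc_intertwine[OF conj QP]
  show ?thesis
    using assms(3)
  proof (cases i rule: less_doubleE)
    case 1
    note i = 1
    show ?thesis
      using assms(4)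
    proof (cases j rule: less_doubleE)
      case 1
      show ?thesis unfolding sum_double sum.distrib using assms(5)
        by (cases v rule: less_doubleE)
           (simp_all add: dbl_simps triv_ext_simps i 1 AA sum_double)
    next
      case (2 J)
      show ?thesis unfolding sum_double sum.distrib using assms(5)
        by (cases v rule: less_doubleE)
           (simp_all add: dbl_simps triv_ext_simps i 2 AD sum_double)
    qed
  next
    case (2 I)
    note i = 2
    show ?thesis
      using assms(4)
    proof (cases j rule: less_doubleE)
      case 1
      show ?thesis unfolding sum_double sum.distrib using assms(5)
        by (cases v rule: less_doubleE)
           (simp_all add: dbl_simps triv_ext_simps i 1 DA sum_double)
    next
      case (2 J)
      show ?thesis unfolding sum_double sum.distrib using assms(5)
        by (cases v rule: less_doubleE)
           (simp_all add: dbl_simps triv_ext_simps i 2 sum_double)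
    qed
  qed
qed

lemma inv_mat_dbl:
  assumes PQ: "inv_mat n d P Q" and QP: "inv_mat d n Q P" and "i < 2 * n" "j < 2 * n"
  shows "(\<Sum>a<2 * d. dbl n d P Q i a * dbl d n Q P a j) = (if i = j then 1 else 0)"
  unfolding sum_double using assms(3)
proof (cases i rule: less_doubleE)
  case 1
  show "(\<Sum>a<d. dbl n d P Q i a * dbl d n Q P a j)
      + (\<Sum>a<d. dbl n d P Q i (d + a) * dbl d n Q P (d + a) j) = (if i = j then 1 else 0)"
    using assms(4) PQ 1 by (cases j rule: less_doubleE) (auto simp: dbl_simps inv_mat_def)
next
  case (2 I)
  show "(\<Sum>a<d. dbl n d P Q i a * dbl d n Q P a j)
      + (\<Sum>a<d. dbl n d P Q i (d + a) * dbl d n Q P (d + a) j) = (if i = j then 1 else 0)"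
    using assms(4) PQ 2
    by (cases j rule: less_doubleE) (auto simp: dbl_simps inv_mat_def mult.commute[of "Q _ I"])
qed

lemma cexact_triv_ext_transfer:
  assumes conj: "conj_sc n d P Q c c'" and PQ: "inv_mat n d P Q" and QP: "inv_mat d n Q P"
    and ex: "cexact (triv_ext c d) (2 * d) k"
  shows "cexact (triv_ext c' n) (2 * n) k"
proof (rule cexact_transfer[OF _ _ _ ex])
  show "(\<Sum>a<2 * d. \<Sum>b<2 * d. dbl n d P Q i a * dbl n d P Q j b * triv_ext c d a b v)
      = (\<Sum>l<2 * n. triv_ext c' n i j l * dbl n d P Q l v)"
    if "i < 2 * n" "j < 2 * n" "v < 2 * d" for i j v
    using that by (rule conj_sc_triv_ext[OF conj QP])
  show "(\<Sum>a<2 * n. \<Sum>b<2 * n. dbl d n Q P i a * dbl d n Q P j b * triv_ext c' n a b v)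
      = (\<Sum>l<2 * d. triv_ext c d i j l * dbl d n Q P l v)"
    if "i < 2 * d" "j < 2 * d" "v < 2 * n" for i j v
    using that by (rule conj_sc_triv_ext[OF conj_sc_sym[OF conj QP] PQ])
  show "(\<Sum>a<2 * d. dbl n d P Q i a * dbl d n Q P a j) = (if i = j then 1 else 0)"
    if "i < 2 * n" "j < 2 * n" for i j
    using that by (rule inv_mat_dbl[OF PQ QP])
qed

section \<open>Existence of a path basis\<close>

locale split_graded_algebra =
  fixes c :: "'k::field_char_0 sc" and d :: nat and deg :: "nat \<Rightarrow> nat"
    and m :: nat and E :: "nat \<Rightarrow> nat \<Rightarrow> 'k"
  assumes d: "d > 0" and alg: "fd_algebra c d" and graded: "graded_by c d deg"
    and split: "deg0_split c d deg m E"
begin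

text \<open>Cutting off the coordinates from \<open>d\<close> on turns the coordinatewise axioms
  into equations between functions.\<close>

definition mu :: "(nat \<Rightarrow> 'k) \<Rightarrow> (nat \<Rightarrow> 'k) \<Rightarrow> nat \<Rightarrow> 'k" where
  "mu x y l = (if l < d then amult c d x y l else 0)"

definition idm :: "nat \<Rightarrow> nat \<Rightarrow> 'k" where
  "idm a i = (if i < d then E a i else 0)"

definition part :: "nat \<Rightarrow> (nat \<Rightarrow> 'k) \<Rightarrow> nat \<Rightarrow> 'k" where
  "part g x i = (if i < d \<and> deg i = g then x i else 0)"

lemma sc_graded: "i < d \<Longrightarrow> j < d \<Longrightarrow> l < d \<Longrightarrow> deg l \<noteq> deg i + deg j \<Longrightarrow> c i j l = 0"
  using graded by (auto simp: graded_by_def)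

section \<open>The product, the grading and the idempotents as functions\<close>

lemma amult_cong:
  "(\<And>i. i < d \<Longrightarrow> x i = x' i) \<Longrightarrow> (\<And>i. i < d \<Longrightarrow> y i = y' i) \<Longrightarrow> amult c d x y = amult c d x' y'"
  by (auto simp: amult_def fun_eq_iff intro!: sum.cong)

lemma mu_assoc: "mu (mu x y) z = mu x (mu y z)"
proof
  fix l
  have "amult c d (mu x y) z = amult c d (amult c d x y) z"
    "amult c d x (mu y z) = amult c d x (amult c d y z)"
    by (auto intro!: amult_cong simp: mu_def)
  then show "mu (mu x y) z l = mu x (mu y z) l"
    using alg by (simp add: mu_def fd_algebra_def)
qed

lemma lin_mu_right: "lin (mu x)"
  by (rule linI) (simp_all add: mu_def amult_def algebra_simps sum.distrib sum_distrib_left)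

lemma lin_mu_left: "lin (\<lambda>x. mu x y)"
  by (rule linI) (simp_all add: mu_def amult_def algebra_simps sum.distrib sum_distrib_left)

lemma mu_zero: "mu (\<lambda>_. 0) y = (\<lambda>_. 0)" "mu x (\<lambda>_. 0) = (\<lambda>_. 0)"
  using lin_zero[OF lin_mu_left] lin_zero[OF lin_mu_right] by (auto simp: fun_eq_iff)

lemma lin_part: "lin (part g)"
  by (rule linI) (simp_all add: part_def)

lemma part_mu:
  assumes "part g x = x" "part h y = y"
  shows "part (g + h) (mu x y) = mu x y"
proof
  fix l
  have "mu x y l = 0" if "l < d" "deg l \<noteq> g + h"
  proof -
    have "x i * y j * c i j l = 0" if "i < d" "j < d" for i j
    proof (cases "c i j l = 0")
      case False
      then have "deg l = deg i + deg j" using graded that \<open>l < d\<close> by (auto simp: graded_by_def)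
      then have "deg i \<noteq> g \<or> deg j \<noteq> h" using \<open>deg l \<noteq> g + h\<close> by auto
      then show ?thesis
        using fun_cong[OF assms(1), of i] fun_cong[OF assms(2), of j] by (auto simp: part_def)
    qed simp
    then show ?thesis by (auto simp: mu_def amult_def intro!: sum.neutral)
  qed
  then show "part (g + h) (mu x y) l = mu x y l" by (auto simp: part_def mu_def)
qed

lemma part_supported: "part g x = x \<Longrightarrow> supported {..<d} x"
  by (auto simp: supported_def fun_eq_iff part_def split: if_splits)

lemma part_part: "part g (part h x) = (if g = h then part g x else (\<lambda>_. 0))"
  by (auto simp: part_def)

lemma mu_supported: "supported {..<d} (mu x y)"
  by (auto simp: supported_def mu_def)

lemma idm_mult: "a < m \<Longrightarrow> b < m \<Longrightarrow> mu (idm a) (idm b) = (if a = b then idm a else (\<lambda>_. 0))"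
proof
  fix l assume "a < m" "b < m"
  have "amult c d (idm a) (idm b) = amult c d (E a) (E b)"
    by (rule amult_cong) (auto simp: idm_def)
  then show "mu (idm a) (idm b) l = (if a = b then idm a else (\<lambda>_. 0)) l"
    using split \<open>a < m\<close> \<open>b < m\<close> by (auto simp: deg0_split_def mu_def idm_def)
qed

lemma idm_part: "a < m \<Longrightarrow> part 0 (idm a) = idm a"
  using split by (auto simp: deg0_split_def in_deg0_def part_def idm_def fun_eq_iff)

lemma idm_independent: "(\<And>i. (\<Sum>a<m. t a * idm a i) = 0) \<Longrightarrow> a < m \<Longrightarrow> t a = 0"
proof -
  assume h: "\<And>i. (\<Sum>a<m. t a * idm a i) = 0" and "a < m"
  have "(\<Sum>a<m. t a * E a i) = 0" if "i < d" for i
    using h[of i] that by (simp add: idm_def)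
  then show "t a = 0" using split \<open>a < m\<close> unfolding deg0_split_def by blast
qed

lemma deg0_expand:
  assumes "part 0 x = x"
  obtains t where "x = (\<lambda>i. \<Sum>a<m. t a * idm a i)"
proof -
  have "in_deg0 d deg x"
    unfolding in_deg0_def by (metis assms part_def)
  then obtain t where "\<forall>i<d. x i = (\<Sum>a<m. t a * E a i)"
    using split unfolding deg0_split_def by blast
  then have "x i = (\<Sum>a<m. t a * idm a i)" for i
    using part_supported[OF assms] by (cases "i < d") (auto simp: idm_def supported_def)
  then show ?thesis using that by blast
qed

lemma idm_nonzero: "a < m \<Longrightarrow> idm a \<noteq> (\<lambda>_. 0)"
proof
  assume a: "a < m" "idm a = (\<lambda>_. 0)"
  have "(\<Sum>b<m. (if b = a then 1 else 0) * idm b i) = 0" for i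
    using a by (intro sum.neutral) auto
  from idm_independent[OF this a(1)] show False by simp
qed

text \<open>\<open>deg0_split\<close> does not state that the idempotents add up to 1. Comparing
  degrees, the degree 0 part of the unit is again a unit; as a combination of the idempotents it
  must have all coefficients 1.\<close>

lemma sum_idm_unit:
  assumes "supported {..<d} x"
  shows "mu (\<lambda>i. \<Sum>a<m. idm a i) x = x" "mu x (\<lambda>i. \<Sum>a<m. idm a i) = x"
proof -
  obtain u where u: "\<And>x l. l < d \<Longrightarrow> amult c d u x l = x l" "\<And>x l. l < d \<Longrightarrow> amult c d x u l = x l"
    using alg unfolding fd_algebra_def by blast
  have L: "(\<Sum>i<d. u i * c i p l) = (if p = l then 1 else 0)" if "p < d" "l < d" for p l
  proof -
    have "amult c d u (ind p) l = (\<Sum>i<d. \<Sum>j<d. if j = p then u i * c i j l else 0)"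
      unfolding amult_def by (intro sum.cong refl) (auto simp: ind_def)
    then show ?thesis using that u(1)[of l "ind p"] by (simp add: ind_def)
  qed
  have R: "(\<Sum>i<d. u i * c p i l) = (if p = l then 1 else 0)" if "p < d" "l < d" for p l
  proof -
    have "amult c d (ind p) u l = (\<Sum>j<d. \<Sum>i<d. if j = p then u i * c j i l else 0)"
      unfolding amult_def by (intro sum.cong refl) (auto simp: ind_def)
    also have "\<dots> = (\<Sum>i<d. u i * c p i l)"
      by (subst sum.swap) (simp add: that)
    finally show ?thesis using that u(2)[of l "ind p"] by (simp add: ind_def)
  qed
  define v where "v = part 0 u"
  have L0: "(\<Sum>i<d. v i * c i p l) = (if p = l then 1 else 0)" if "p < d" "l < d" for p l
  proof (cases "deg l = deg p")
    case True
    have "(\<Sum>i<d. v i * c i p l) = (\<Sum>i<d. u i * c i p l)"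
      using that True by (intro sum.cong refl) (auto simp: v_def part_def sc_graded)
    then show ?thesis using L that by simp
  next
    case False
    have "(\<Sum>i<d. v i * c i p l) = 0"
      using that False by (intro sum.neutral) (auto simp: v_def part_def sc_graded)
    then show ?thesis using False by auto
  qed
  have R0: "(\<Sum>i<d. v i * c p i l) = (if p = l then 1 else 0)" if "p < d" "l < d" for p l
  proof (cases "deg l = deg p")
    case True
    have "(\<Sum>i<d. v i * c p i l) = (\<Sum>i<d. u i * c p i l)"
      using that True by (intro sum.cong refl) (auto simp: v_def part_def sc_graded)
    then show ?thesis using R that by simp
  next
    case False
    have "(\<Sum>i<d. v i * c p i l) = 0"
      using that False by (intro sum.neutral) (auto simp: v_def part_def sc_graded)
    then show ?thesis using False by auto
  qed
  have vl: "mu v x = x" if x: "supported {..<d} x" for x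
  proof
    fix l show "mu v x l = x l"
    proof (cases "l < d")
      case True
      have "mu v x l = (\<Sum>j<d. x j * (\<Sum>i<d. v i * c i j l))"
        unfolding mu_def amult_def using True
        by (subst sum.swap) (simp add: sum_distrib_left mult_ac)
      also have "\<dots> = (\<Sum>j<d. if j = l then x j else 0)"
        by (intro sum.cong refl) (simp add: L0 True)
      finally show ?thesis using True by simp
    qed (use x in \<open>simp add: mu_def supported_def\<close>)
  qed
  have vr: "mu x v = x" if x: "supported {..<d} x" for x
  proof
    fix l show "mu x v l = x l"
    proof (cases "l < d")
      case True
      have "mu x v l = (\<Sum>j<d. x j * (\<Sum>i<d. v i * c j i l))"
        unfolding mu_def amult_def using True
        by (simp add: sum_distrib_left mult_ac)
      also have "\<dots> = (\<Sum>j<d. if j = l then x j else 0)"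
        by (intro sum.cong refl) (simp add: R0 True)
      finally show ?thesis using True by simp
    qed (use x in \<open>simp add: mu_def supported_def\<close>)
  qed
  have "part 0 v = v" by (simp add: v_def part_part)
  then obtain t where t: "v = (\<lambda>i. \<Sum>a<m. t a * idm a i)" by (rule deg0_expand)
  \<comment> \<open>\<open>v\<close> fixes \<open>idm a\<close>, but by orthogonality it also
    multiplies it by \<open>t a\<close>.\<close>
  have "t a = 1" if a: "a < m" for a
  proof -
    have "idm a i = t a * idm a i" for i
    proof -
      have "idm a i = mu v (idm a) i"
        using vl[OF part_supported[OF idm_part[OF a]]] by simp
      also have "\<dots> = (\<Sum>b<m. t b * mu (idm b) (idm a) i)"
        unfolding t by (simp add: lin_sum[OF lin_mu_left] lin_scale[OF lin_mu_left])
      also have "\<dots> = (\<Sum>b<m. if b = a then t b * idm b i else 0)"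
        by (intro sum.cong refl) (simp add: idm_mult a)
      finally show ?thesis using a by simp
    qed
    moreover obtain i where "idm a i \<noteq> 0" using idm_nonzero[OF a] by auto
    ultimately show ?thesis by (metis mult_cancel_right1)
  qed
  then have "v = (\<lambda>i. \<Sum>a<m. idm a i)" unfolding t by simp
  then show "mu (\<lambda>i. \<Sum>a<m. idm a i) x = x" "mu x (\<lambda>i. \<Sum>a<m. idm a i) = x"
    using vl[OF assms] vr[OF assms] by auto
qed

text \<open>Otherwise the empty sum of idempotents would be the unit, so 1 = 0, against
  \<open>d > 0\<close>.\<close>

lemma m_pos: "0 < m"
proof (rule ccontr)
  assume "\<not> 0 < m"
  then have "mu (\<lambda>_. 0) (ind 0) = ind 0"
    using sum_idm_unit(1)[of "ind 0"] supported_ind[of 0 "{..<d}"] d by simp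
  from fun_cong[OF this, of 0] show False
    by (simp add: mu_def amult_def ind_def split: if_splits)
qed

text \<open>The union, not the sum, of the homogeneous parts of the Peirce components: a spanning
  set from which a basis can be selected.\<close>

definition pieces :: "(nat \<Rightarrow> 'k) set" where
  "pieces = {x. \<exists>a<m. \<exists>b<m. \<exists>g. part g x = x \<and> mu (idm a) x = x \<and> mu x (idm b) = x}"

lemma idm_in_pieces: "a < m \<Longrightarrow> idm a \<in> pieces"
proof -
  assume "a < m"
  then have "part 0 (idm a) = idm a \<and> mu (idm a) (idm a) = idm a"
    by (simp add: idm_part idm_mult)
  then show ?thesis unfolding pieces_def using \<open>a < m\<close> by blast
qed

lemma sum_fun_apply: "(\<Sum>a\<in>A. f a) x = (\<Sum>a\<in>A. f a x)" for f :: "'a \<Rightarrow> 'b \<Rightarrow> 'c::comm_monoid_add"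
  by (induction A rule: infinite_finite_induct) auto

lemma in_span_pieces:
  assumes x: "supported {..<d} x"
  shows "x \<in> funs.span pieces"
proof -
  define y where "y = (\<lambda>g a b. mu (mu (idm a) (part g x)) (idm b))"
  have "y g a b \<in> pieces" if "a < m" "b < m" for g a b
  proof -
    have "part (0 + g + 0) (y g a b) = y g a b"
      unfolding y_def using that by (intro part_mu idm_part) (simp_all add: part_part)
    moreover have "mu (idm a) (y g a b) = y g a b"
      unfolding y_def using that by (simp add: mu_assoc[symmetric] idm_mult)
    moreover have "mu (y g a b) (idm b) = y g a b"
      unfolding y_def using that by (simp add: mu_assoc idm_mult)
    ultimately show ?thesis using that by (auto simp: pieces_def)
  qed
  then have "(\<Sum>g\<in>deg ` {..<d}. \<Sum>a<m. \<Sum>b<m. y g a b) \<in> funs.span pieces"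
    by (intro funs.span_sum funs.span_base) auto
  moreover have "x = (\<Sum>g\<in>deg ` {..<d}. \<Sum>a<m. \<Sum>b<m. y g a b)"
  proof
    fix i
    have ps: "supported {..<d} (part g x)" for g by (simp add: supported_def part_def)
    have "(\<Sum>a<m. \<Sum>b<m. y g a b i) = part g x i" for g
    proof -
      have "(\<Sum>b<m. y g a b i) = mu (idm a) (part g x) i" for a
        using fun_cong[OF sum_idm_unit(2)[OF mu_supported[of "idm a" "part g x"]], of i]
        by (simp add: y_def lin_sum[OF lin_mu_right])
      then show ?thesis
        using fun_cong[OF sum_idm_unit(1)[OF ps[of g]], of i]
        by (simp add: lin_sum[OF lin_mu_left])
    qed
    moreover have "(\<Sum>g\<in>deg ` {..<d}. part g x i) = x i"
    proof (cases "i < d")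
      case True
      have "(\<Sum>g\<in>deg ` {..<d}. part g x i) = (\<Sum>g\<in>deg ` {..<d}. if g = deg i then x i else 0)"
        using True by (intro sum.cong refl) (auto simp: part_def)
      then show ?thesis using True by simp
    qed (use x in \<open>simp add: part_def supported_def\<close>)
    ultimately show "x i = (\<Sum>g\<in>deg ` {..<d}. \<Sum>a<m. \<Sum>b<m. y g a b) i"
      by (simp add: sum_fun_apply)
  qed
  ultimately show ?thesis by simp
qed

text \<open>The idempotents are independent members of the spanning set \<open>pieces\<close> and
  hence extend to a basis inside it; listing them first fits the indexing of
  \<open>path_algebra\<close>.\<close>

lemma path_basis_exists:
  obtains n x where "m \<le> n" "\<And>a. a < m \<Longrightarrow> x a = idm a" "\<And>i. i < n \<Longrightarrow> x i \<in> pieces"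
    "\<And>r i. (\<And>l. (\<Sum>i<n. r i * x i l) = 0) \<Longrightarrow> i < n \<Longrightarrow> r i = 0"
    "\<And>f. supported {..<d} f \<Longrightarrow> \<exists>r. \<forall>l. f l = (\<Sum>i<n. r i * x i l)"
proof -
  have inj: "inj_on idm {..<m}"
  proof (rule inj_onI)
    fix a b assume "a \<in> {..<m}" "b \<in> {..<m}" and eq: "idm a = idm b"
    then have "a < m" "b < m" by auto
    then show "a = b"
      using idm_mult[of a b] idm_mult[of a a] idm_nonzero[of a] eq by (auto split: if_splits)
  qed
  have "funs.independent (idm ` {..<m})"
  proof (rule funs.independent_if_scalars_zero)
    fix t y assume sum: "(\<Sum>y\<in>idm ` {..<m}. (\<lambda>x. t y * y x)) = 0" and "y \<in> idm ` {..<m}"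
    then obtain a where a: "a < m" "y = idm a" by auto
    have "(\<Sum>a<m. t (idm a) * idm a i) = 0" for i
      using fun_cong[OF sum, of i] by (simp add: sum.reindex[OF inj] sum_fun_apply)
    from idm_independent[OF this a(1)] show "t y = 0" by (simp add: a)
  qed simp
  then obtain B where B: "idm ` {..<m} \<subseteq> B" "B \<subseteq> pieces" "funs.independent B" "pieces \<subseteq> funs.span B"
    using funs.maximal_independent_subset_extend[of "idm ` {..<m}" pieces] idm_in_pieces by blast
  have "B \<subseteq> funs.span (ind ` {..<d})"
  proof
    fix f assume "f \<in> B"
    then have "supported {..<d} f" using B(2) part_supported by (auto simp: pieces_def)
    then have "f = (\<lambda>x. \<Sum>a<d. f a * ind a x)" by (intro supported_expand) auto
    moreover have "(\<Sum>a<d. (\<lambda>x. f a * ind a x)) = (\<lambda>x. \<Sum>a<d. f a * ind a x)"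
      by (rule ext) (simp add: sum_fun_apply)
    moreover have "(\<Sum>a<d. (\<lambda>x. f a * ind a x)) \<in> funs.span (ind ` {..<d})"
      by (intro funs.span_sum funs.span_scale funs.span_base) auto
    ultimately show "f \<in> funs.span (ind ` {..<d})" by argo
  qed
  then have finB: "finite B" using funs.independent_span_bound[OF _ B(3)] by blast
  define B' where "B' = B - idm ` {..<m}"
  obtain h where h: "bij_betw h {0..<card B'} B'"
    using ex_bij_betw_nat_finite[of B'] finB by (auto simp: B'_def)
  define n where "n = m + card B'"
  define x where "x = (\<lambda>i. if i < m then idm i else h (i - m))"
  have bij: "bij_betw x {..<n} B"
  proof -
    have "bij_betw x {..<m} (idm ` {..<m})"
      using inj by (auto simp: bij_betw_def x_def inj_on_def)
    moreover have "bij_betw x {m..<n} B'"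
    proof -
      have "bij_betw (\<lambda>i. i - m) {m..<n} {0..<card B'}"
        by (rule bij_betw_byWitness[where f' = "\<lambda>i. i + m"]) (auto simp: n_def)
      from bij_betw_trans[OF this h] show ?thesis
        by (rule bij_betw_cong[THEN iffD1, rotated]) (auto simp: x_def)
    qed
    moreover have "{..<m} \<union> {m..<n} = {..<n}" by (auto simp: n_def)
    moreover have "idm ` {..<m} \<union> B' = B" using B(1) by (auto simp: B'_def)
    ultimately show ?thesis
      using bij_betw_combine[of x "{..<m}" "idm ` {..<m}" "{m..<n}" B'] by (auto simp: B'_def)
  qed
  have xinj: "inj_on x {..<n}" and xB: "x ` {..<n} = B" using bij by (auto simp: bij_betw_def)
  show ?thesis
  proof (rule that[of n x])
    show "m \<le> n" by (simp add: n_def)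
    show "x a = idm a" if "a < m" for a using that by (simp add: x_def)
    show "x i \<in> pieces" if "i < n" for i using that xB B(2) by auto
    show "r i = 0" if r: "\<And>l. (\<Sum>i<n. r i * x i l) = 0" and i: "i < n" for r i
    proof -
      define u where "u = (\<lambda>v. r (the_inv_into {..<n} x v))"
      have "(\<Sum>v\<in>B. (\<lambda>y. u v * v y)) = (\<Sum>i<n. (\<lambda>y. r i * x i y))"
        unfolding xB[symmetric] sum.reindex[OF xinj]
        by (intro sum.cong refl) (simp add: u_def the_inv_into_f_f[OF xinj])
      also have "\<dots> = 0" by (rule ext) (simp add: sum_fun_apply r)
      finally have "(\<Sum>v\<in>B. (\<lambda>y. u v * v y)) = 0" .
      then have "u (x i) = 0"
        using funs.independentD[OF B(3) finB order.refl, of u "x i"] i xB by auto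
      then show ?thesis using i by (simp add: u_def the_inv_into_f_f[OF xinj])
    qed
    show "\<exists>r. \<forall>l. f l = (\<Sum>i<n. r i * x i l)" if "supported {..<d} f" for f
    proof -
      have "f \<in> funs.span B"
        using in_span_pieces[OF that] funs.span_mono[OF B(4)] by (auto simp: funs.span_span)
      then obtain u where "f = (\<Sum>v\<in>B. (\<lambda>y. u v * v y))"
        using funs.span_finite[OF finB] by auto
      then have "f l = (\<Sum>i<n. u (x i) * x i l)" for l
        unfolding xB[symmetric] by (simp add: sum.reindex[OF xinj] sum_fun_apply)
      then show ?thesis by (intro exI[of _ "\<lambda>i. u (x i)"]) simp
    qed
  qed
qed

lemma path_algebra_exists:
  "\<exists>c' n P Q src tgt dg. path_algebra c' n m src tgt dg \<and> conj_sc n d P Q c c' \<and>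
     inv_mat n d P Q \<and> inv_mat d n Q P"
proof -
  obtain n x where mn: "m \<le> n" and xa: "\<And>a. a < m \<Longrightarrow> x a = idm a"
    and xp: "\<And>i. i < n \<Longrightarrow> x i \<in> pieces"
    and indep: "\<And>r i. (\<And>l. (\<Sum>i<n. r i * x i l) = 0) \<Longrightarrow> i < n \<Longrightarrow> r i = 0"
    and spans: "\<And>f. supported {..<d} f \<Longrightarrow> \<exists>r. \<forall>l. f l = (\<Sum>i<n. r i * x i l)"
    using path_basis_exists by blast
  have uniq: "r i = s i" if "\<And>l. (\<Sum>i<n. r i * x i l) = (\<Sum>i<n. s i * x i l)" "i < n" for r s i
    using indep[of "\<lambda>i. r i - s i" i] that by (simp add: algebra_simps sum_subtractf)
  have "\<forall>i<n. \<exists>a b g. a < m \<and> b < m \<and> part g (x i) = x i \<and> mu (idm a) (x i) = x i \<and> mu (x i) (idm b) = x i"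
    using xp by (fastforce simp: pieces_def)
  then obtain sr tg dd where sp: "\<And>i. i < n \<Longrightarrow> sr i < m" "\<And>i. i < n \<Longrightarrow> tg i < m"
    "\<And>i. i < n \<Longrightarrow> part (dd i) (x i) = x i" "\<And>i. i < n \<Longrightarrow> mu (idm (sr i)) (x i) = x i"
    "\<And>i. i < n \<Longrightarrow> mu (x i) (idm (tg i)) = x i" by metis
  \<comment> \<open>For the idempotents the chosen ends and degrees are overwritten by the values
    that \<open>path_algebra\<close> prescribes.\<close>
  define src where "src = (\<lambda>i. if i < m then i else sr i)"
  define tgt where "tgt = (\<lambda>i. if i < m then i else tg i)"
  define dg where "dg = (\<lambda>i. if i < m then 0 else dd i)"
  have srcn: "src i < m" and tgtn: "tgt i < m" and dgx: "part (dg i) (x i) = x i"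
    and srcx: "mu (idm (src i)) (x i) = x i" and tgtx: "mu (x i) (idm (tgt i)) = x i" if "i < n" for i
    using that sp[OF that] by (auto simp: src_def tgt_def dg_def xa idm_part idm_mult)
  have xs: "supported {..<d} (x i)" if "i < n" for i using part_supported[OF dgx[OF that]] .
  have left: "mu (idm a) (x j) = (if src j = a then x j else (\<lambda>_. 0))" if "a < m" "j < n" for a j
  proof (cases "src j = a")
    case False
    have "mu (idm a) (x j) = mu (mu (idm a) (idm (src j))) (x j)"
      by (simp only: mu_assoc srcx[OF that(2)])
    also have "mu (idm a) (idm (src j)) = (\<lambda>_. 0)"
      using that srcn False by (simp add: idm_mult)
    finally show ?thesis using False by (simp add: mu_zero)
  qed (use srcx that in auto)
  have right: "mu (x j) (idm a) = (if tgt j = a then x j else (\<lambda>_. 0))" if "a < m" "j < n" for a j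
  proof (cases "tgt j = a")
    case False
    have "mu (x j) (idm a) = mu (x j) (mu (idm (tgt j)) (idm a))"
      by (simp only: mu_assoc[symmetric] tgtx[OF that(2)])
    also have "mu (idm (tgt j)) (idm a) = (\<lambda>_. 0)"
      using that tgtn False by (simp add: idm_mult)
    finally show ?thesis using False by (simp add: mu_zero)
  qed (use tgtx that in auto)
  have "\<forall>p<d. \<exists>r. \<forall>l. ind p l = (\<Sum>i<n. r i * x i l)"
    using spans supported_ind[of _ "{..<d}"] by (metis lessThan_iff)
  then obtain Q where Q: "\<And>p l. p < d \<Longrightarrow> ind p l = (\<Sum>i<n. Q p i * x i l)" by metis
  have QP: "inv_mat d n Q x"
    unfolding inv_mat_def by (simp add: Q[symmetric] ind_def)
  have PQ: "inv_mat n d x Q"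
    unfolding inv_mat_def
  proof (intro allI impI)
    fix i j assume ij: "i < n" "j < n"
    have "(\<Sum>a<d. x i a * Q a j) = (if j = i then 1 else 0)"
    proof (rule uniq[OF _ ij(2)])
      fix l
      have "(\<Sum>j<n. (\<Sum>a<d. x i a * Q a j) * x j l) = (\<Sum>a<d. x i a * (\<Sum>j<n. Q a j * x j l))"
        by (simp add: sum_distrib_left sum_distrib_right mult.assoc) (rule sum.swap)
      also have "\<dots> = (\<Sum>a<d. x i a * ind a l)" by (simp add: Q[symmetric])
      also have "\<dots> = x i l"
        using supported_expand[OF _ xs[OF ij(1)]] by (metis finite_lessThan)
      also have "\<dots> = (\<Sum>j<n. if j = i then x j l else 0)" using ij by simp
      also have "\<dots> = (\<Sum>j<n. (if j = i then 1 else 0) * x j l)" by (intro sum.cong refl) simp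
      finally show "(\<Sum>j<n. (\<Sum>a<d. x i a * Q a j) * x j l) = (\<Sum>j<n. (if j = i then 1 else 0) * x j l)" .
    qed
    then show "(\<Sum>a<d. x i a * Q a j) = (if i = j then 1 else 0)" by auto
  qed
  define c' where "c' = (\<lambda>i j l. \<Sum>a<d. x i a * (\<Sum>b<d. x j b * (\<Sum>e<d. c a b e * Q e l)))"
  have conj: "conj_sc n d x Q c c'" by (simp add: conj_sc_def c'_def)
  have expand: "mu (x i) (x j) l = (\<Sum>k<n. c' i j k * x k l)" if "i < n" "j < n" for i j l
  proof (cases "l < d")
    case True
    then show ?thesis
      using conj_sc_intertwine[OF conj QP that True] by (simp add: mu_def amult_def mult.assoc)
  next
    case False
    then have "x k l = 0" if "k < n" for k using xs[OF that] by (simp add: supported_def)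
    then show ?thesis using False by (simp add: mu_def)
  qed
  have coeff: "c' i j k = r k"
    if "i < n" "j < n" "k < n" "\<And>l. mu (x i) (x j) l = (\<Sum>k<n. r k * x k l)" for i j k r
  proof (rule uniq[of "c' i j" r, OF _ that(3)])
    fix l show "(\<Sum>k<n. c' i j k * x k l) = (\<Sum>k<n. r k * x k l)"
      by (simp only: expand[OF that(1,2), symmetric] that(4))
  qed
  have single: "(\<Sum>k<n. (if p \<and> k = j then 1 else 0) * x k l) = (if p then x j l else 0)"
    if "j < n" for p j l
  proof -
    have "(\<Sum>k<n. (if p \<and> k = j then 1 else 0) * x k l) = (\<Sum>k<n. if k = j then (if p then x k l else 0) else 0)"
      by (intro sum.cong refl) auto
    then show ?thesis using that by simp
  qed
  have "path_algebra c' n m src tgt dg"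
  proof
    show "0 < m" by (rule m_pos)
    show "m \<le> n" by (rule mn)
    show "src i < m" "tgt i < m" if "i < n" for i using srcn tgtn that by auto
    show "src i = i" "tgt i = i" "dg i = 0" if "i < m" for i
      using that by (auto simp: src_def tgt_def dg_def)
    \<comment> \<open>A further basis vector of degree 0 would be a combination of the idempotents,
      against independence.\<close>
    show "0 < dg i" if i: "m \<le> i" "i < n" for i
    proof (rule ccontr)
      assume "\<not> 0 < dg i"
      then have "part 0 (x i) = x i" using dgx[OF i(2)] by simp
      then obtain t where t: "x i = (\<lambda>l. \<Sum>a<m. t a * idm a l)" by (rule deg0_expand)
      have "(if True \<and> i = i then 1 else 0) = (if i < m then t i else 0)"
      proof (rule uniq[of "\<lambda>k. if True \<and> k = i then 1 else 0" "\<lambda>k. if k < m then t k else 0", OF _ i(2)])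
        fix l
        have "(\<Sum>k<n. (if True \<and> k = i then 1 else 0) * x k l) = x i l"
          using single[OF i(2), of True] by simp
        also have "\<dots> = (\<Sum>a<m. t a * x a l)" using xa by (simp add: t)
        also have "\<dots> = (\<Sum>k<n. (if k < m then t k else 0) * x k l)"
          using mn by (intro sum.mono_neutral_cong_left) auto
        finally show "(\<Sum>k<n. (if True \<and> k = i then 1 else 0) * x k l)
          = (\<Sum>k<n. (if k < m then t k else 0) * x k l)" .
      qed
      then show False using i by simp
    qed
    show "c' a j l = (if src j = a \<and> l = j then 1 else 0)" if "a < m" "j < n" "l < n" for a j l
      using that mn by (intro coeff) (auto simp: xa left single)
    show "c' j a l = (if tgt j = a \<and> l = j then 1 else 0)" if "a < m" "j < n" "l < n" for a j l
      using that mn by (intro coeff) (auto simp: xa right single)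
    show "dg l = dg i + dg j \<and> tgt i = src j \<and> src l = src i \<and> tgt l = tgt j"
      if h: "i < n" "j < n" "l < n" "c' i j l \<noteq> 0" for i j l
    proof -
      define y where "y = mu (x i) (x j)"
      have y: "y = (\<lambda>v. \<Sum>k<n. c' i j k * x k v)" unfolding y_def using expand h by auto
      \<comment> \<open>If \<open>F\<close> fixes the product and either fixes or kills each basis
        vector, then every basis vector occurring in the product is fixed. Applied to a degree
        projection and to multiplication by an idempotent on either side.\<close>
      have fixes_coeff: "p l" if F: "lin F" "F y = y"
        "\<And>k. k < n \<Longrightarrow> F (x k) = (if p k then x k else (\<lambda>_. 0))" for F p
      proof -
        have "c' i j l = (if p l then c' i j l else 0)"
        proof (rule coeff[OF h(1,2,3)])
          fix v
          have "mu (x i) (x j) v = F y v" using F(2) by (simp add: y_def)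
          also have "\<dots> = (\<Sum>k<n. c' i j k * F (x k) v)"
            unfolding y by (simp add: lin_sum[OF F(1)] lin_scale[OF F(1)])
          also have "\<dots> = (\<Sum>k<n. (if p k then c' i j k else 0) * x k v)"
            by (intro sum.cong refl) (simp add: F(3))
          finally show "mu (x i) (x j) v = (\<Sum>k<n. (if p k then c' i j k else 0) * x k v)" .
        qed
        then show ?thesis using h(4) by (auto split: if_splits)
      qed
      have "dg l = dg i + dg j"
      proof (rule fixes_coeff[OF lin_part[of "dg i + dg j"], where p = "\<lambda>k. dg k = dg i + dg j"])
        show "part (dg i + dg j) y = y" unfolding y_def using h by (intro part_mu dgx)
        show "part (dg i + dg j) (x k) = (if dg k = dg i + dg j then x k else (\<lambda>_. 0))" if "k < n" for k
          using part_part[of "dg i + dg j" "dg k" "x k"] dgx[OF that] by (auto split: if_splits)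
      qed
      moreover have "src l = src i"
      proof (rule fixes_coeff[OF lin_mu_right[of "idm (src i)"], where p = "\<lambda>k. src k = src i"])
        show "mu (idm (src i)) y = y" unfolding y_def using h by (simp add: mu_assoc[symmetric] srcx)
      qed (use left srcn h in auto)
      moreover have "tgt l = tgt j"
      proof (rule fixes_coeff[OF lin_mu_left[of "idm (tgt j)"], where p = "\<lambda>k. tgt k = tgt j"])
        show "mu y (idm (tgt j)) = y" unfolding y_def using h by (simp add: mu_assoc tgtx)
      qed (use right tgtn h in auto)
      moreover have "tgt i = src j"
      proof (rule ccontr)
        assume ne: "tgt i \<noteq> src j"
        have "y = mu (mu (x i) (idm (tgt i))) (x j)" using h by (simp add: y_def tgtx)
        also have "\<dots> = mu (x i) (\<lambda>_. 0)" using ne h left tgtn by (simp add: mu_assoc)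
        finally have "y = (\<lambda>_. 0)" by (simp only: mu_zero)
        then have "c' i j l = 0"
          using h by (intro coeff[of i j l "\<lambda>_. 0"]) (auto simp: y_def)
        then show False using h by simp
      qed
      ultimately show ?thesis by simp
    qed
    show "(\<Sum>l<n. c' p q l * c' l z r) = (\<Sum>l<n. c' q z l * c' p l r)"
      if h: "p < n" "q < n" "z < n" "r < n" for p q z r
    proof (rule uniq[OF _ h(4)])
      fix v
      have "mu (mu (x p) (x q)) (x z) v = (\<Sum>l<n. c' p q l * mu (x l) (x z) v)"
      proof -
        have "mu (x p) (x q) = (\<lambda>v. \<Sum>l<n. c' p q l * x l v)" using expand h by auto
        then show ?thesis by (simp add: lin_sum[OF lin_mu_left] lin_scale[OF lin_mu_left])
      qed
      also have "\<dots> = (\<Sum>l<n. \<Sum>r<n. c' p q l * c' l z r * x r v)"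
        using expand h by (simp add: sum_distrib_left mult.assoc)
      also have "\<dots> = (\<Sum>r<n. (\<Sum>l<n. c' p q l * c' l z r) * x r v)"
        by (subst sum.swap) (simp add: sum_distrib_right)
      finally have 1: "mu (mu (x p) (x q)) (x z) v = (\<Sum>r<n. (\<Sum>l<n. c' p q l * c' l z r) * x r v)" .
      have "mu (x p) (mu (x q) (x z)) v = (\<Sum>l<n. c' q z l * mu (x p) (x l) v)"
      proof -
        have "mu (x q) (x z) = (\<lambda>v. \<Sum>l<n. c' q z l * x l v)" using expand h by auto
        then show ?thesis by (simp add: lin_sum[OF lin_mu_right] lin_scale[OF lin_mu_right])
      qed
      also have "\<dots> = (\<Sum>l<n. \<Sum>r<n. c' q z l * c' p l r * x r v)"
        using expand h by (simp add: sum_distrib_left mult.assoc)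
      also have "\<dots> = (\<Sum>r<n. (\<Sum>l<n. c' q z l * c' p l r) * x r v)"
        by (subst sum.swap) (simp add: sum_distrib_right)
      finally show "(\<Sum>r<n. (\<Sum>l<n. c' p q l * c' l z r) * x r v)
          = (\<Sum>r<n. (\<Sum>l<n. c' q z l * c' p l r) * x r v)"
        using 1 by (simp add: mu_assoc)
    qed
  qed
  then show ?thesis using conj PQ QP by blast
qed

end

section \<open>Counting cyclic words by their period\<close>

lemma concat_replicate_append: "concat (replicate n u) @ u = u @ concat (replicate n u)"
  by (induction n) auto

lemma rotate_concat_replicate: "rotate (k * length u) (concat (replicate n u)) = concat (replicate n u)"
proof -
  have 1: "rotate (length u) (concat (replicate n u)) = concat (replicate n u)"
    by (cases n) (simp_all add: rotate_append concat_replicate_append)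
  show ?thesis
  proof (induction k)
    case (Suc k)
    have "rotate (Suc k * length u) (concat (replicate n u))
        = rotate (length u) (rotate (k * length u) (concat (replicate n u)))"
      by (simp only: rotate_rotate mult_Suc)
    then show ?case by (simp only: Suc 1)
  qed simp
qed

lemma length_concat_replicate: "length (concat (replicate n u)) = n * length u"
  by (induction n) auto

text \<open>By Bezout some multiple of \<open>i\<close> is congruent to the gcd modulo the length,
  and full turns change nothing.\<close>

lemma rotate_gcd:
  assumes "rotate i w = w" "0 < i"
  shows "rotate (gcd i (length w)) w = w"
proof -
  obtain x y where xy: "i * x = length w * y + gcd i (length w)"
    using bezout_nat[of i "length w"] assms(2) by auto
  have "rotate (k * i) w = w" for k
  proof (induction k)
    case (Suc k)
    have "rotate (Suc k * i) w = rotate i (rotate (k * i) w)"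
      by (simp only: rotate_rotate mult_Suc)
    then show ?case by (simp only: Suc assms)
  qed simp
  then have "w = rotate (length w * y + gcd i (length w)) w"
    using xy by (metis mult.commute)
  also have "\<dots> = rotate (gcd i (length w)) w"
    by (metis mod_mult_self4 rotate_conv_mod)
  finally show ?thesis by simp
qed

lemma rotate_period_concat:
  assumes "rotate g w = w" "length w = g * n"
  shows "w = concat (replicate n (take g w))"
proof (cases "n = 0")
  case False
  have gl: "g \<le> length w" using assms(2) False by simp
  have w: "w = drop g w @ take g w"
  proof (cases "g = length w")
    case False
    then have "rotate g w = drop g w @ take g w" using gl by (simp add: rotate_drop_take)
    then show ?thesis using assms(1) by simp
  qed simp
  have dg: "drop g w = take (length w - g) w"
    using arg_cong[OF w, of "take (length w - g)"] by simp
  have "take (g * k) w = concat (replicate k (take g w))" if "k \<le> n" for k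
    using that
  proof (induction k)
    case (Suc k)
    have "take (g * Suc k) w = take g w @ take (g * k) (drop g w)"
      by (simp add: take_add)
    also have "take (g * k) (drop g w) = take (g * k) w"
    proof -
      have "g * Suc k \<le> length w" using Suc.prems assms(2) by (simp only: mult_le_mono2)
      then have "g * k \<le> length w - g" by simp
      then show ?thesis by (simp add: dg min_def)
    qed
    finally show ?case using Suc by simp
  qed simp
  from this[of n] show ?thesis using assms(2) by simp
qed (use assms in auto)

text \<open>The sign of a rotation fixing an n-fold repetition depends only on the length
  \<open>l\<close> of the repeated block. For odd \<open>l\<close> and even \<open>n\<close>,
  coprimality makes \<open>a\<close> odd and the cyclic sign supplies the -1; for odd
  \<open>l\<close> and odd \<open>n\<close> the cyclic sign is 1.\<close>

lemma period_sign:
  assumes "coprime a n" "0 < n" "0 < l"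
  shows "(-1) ^ (n * l) * (-1) ^ ((n * l - 1) * (a * l)) = ((-1) ^ l :: int)"
proof (cases "even l")
  case False
  show ?thesis
  proof (cases "even n")
    case True
    then have "odd a" using assms(1) by (meson coprime_common_divisor_nat dvd_def odd_one
          coprime_common_divisor)
    moreover have "odd (n * l - 1)" using True assms by auto
    ultimately show ?thesis using True False by (simp add: minus_one_power_iff)
  next
    case odd: False
    then have "even (n * l - 1)" using False assms by simp
    then show ?thesis using odd False by (simp add: minus_one_power_iff)
  qed
qed (simp add: minus_one_power_iff)

context path_algebra
begin

text \<open>Over the rotations of a word the degrees of the first letter add up to the total degree;
  this weight is what allows the factor 1/length of the Euler characteristic to be removed.\<close>

definition walk_sum :: "nat \<Rightarrow> int" where
  "walk_sum g = (\<Sum>u\<in>cyc g. (-1) ^ length u * int (dg (hd u)))"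

lemma sum_rotations:
  fixes g :: "nat list \<Rightarrow> 'k"
  shows "(\<Sum>w\<in>cyc j. (\<Sum>p<length w. g (rotate p w)) / of_nat (length w)) = (\<Sum>w\<in>cyc j. g w)"
proof -
  have len: "length w \<le> j" "w \<noteq> []" if "w \<in> cyc j" for w
    using length_le_degree[OF cyc_set[OF that]] that by (auto simp: cyc_def)
  \<comment> \<open>A word of \<open>cyc j\<close> has at most \<open>j\<close> letters; the uniform
    range \<open>p < j\<close> lets the two sums be interchanged.\<close>
  have ext: "(\<Sum>p<length w. F p) = (\<Sum>p<j. if p < length w then F p else 0)"
    if "w \<in> cyc j" for w and F :: "nat \<Rightarrow> 'k"
  proof -
    have "{..<j} \<inter> {p. p < length w} = {..<length w}" using len[OF that] by auto
    then show ?thesis by (simp add: sum.If_cases)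
  qed
  have bij: "bij_betw (rotate p) (cyc j) (cyc j)" for p
  proof (rule bij_betw_byWitness[where f' = "\<lambda>w. rev (rotate p (rev w))"])
    show "\<forall>a\<in>cyc j. rev (rotate p (rev (rotate p a))) = a"
      by (simp add: rotate_rev_rotate)
    show "\<forall>a\<in>cyc j. rotate p (rev (rotate p (rev a))) = a"
      using rotate_rev_rotate[of p "rev _"] by auto
  qed (auto simp: cyc_rotate cyc_rotr)
  have "(\<Sum>w\<in>cyc j. (\<Sum>p<length w. g (rotate p w)) / of_nat (length w))
      = (\<Sum>w\<in>cyc j. \<Sum>p<j. if p < length w then g (rotate p w) / of_nat (length w) else 0)"
    by (rule sum.cong[OF refl]) (subst sum_divide_distrib, rule ext)
  also have "\<dots> = (\<Sum>p<j. \<Sum>w\<in>cyc j. if p < length (rotate p w)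
      then g (rotate p w) / of_nat (length (rotate p w)) else 0)"
    by (subst sum.swap) (simp only: length_rotate)
  also have "\<dots> = (\<Sum>p<j. \<Sum>w\<in>cyc j. if p < length w then g w / of_nat (length w) else 0)"
    by (intro sum.cong refl sum.reindex_bij_betw[OF bij])
  also have "\<dots> = (\<Sum>w\<in>cyc j. \<Sum>p<length w. g w / of_nat (length w))"
    by (subst sum.swap) (rule sum.cong[OF refl], rule ext[symmetric])
  also have "\<dots> = (\<Sum>w\<in>cyc j. g w)"
    using len by (intro sum.cong refl) simp
  finally show ?thesis .
qed

text \<open>The numerator of the signed diagonal entry at \<open>w\<close> of the averaging
  projection, as an integer.\<close>

definition sym_sign :: "nat list \<Rightarrow> int" where
  "sym_sign w = (-1) ^ length w *
     (\<Sum>i<length w. if rotate i w = w then (-1) ^ ((length w - 1) * i) else 0)"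

lemma sym_sign_rotate: "sym_sign (rotate p w) = sym_sign w"
proof -
  have "rotate i (rotate p w) = rotate p w \<longleftrightarrow> rotate i w = w" for i
  proof -
    have comm: "rotate i (rotate p w) = rotate p (rotate i w)"
      by (simp add: rotate_rotate add.commute)
    have inj: "rotate p u = rotate p v \<longleftrightarrow> u = v" for u v :: "nat list"
      by (metis rev_rev_ident rotate_rev_rotate)
    show ?thesis unfolding comm inj ..
  qed
  then show ?thesis by (simp only: sym_sign_def length_rotate)
qed

text \<open>Multiplying the vanishing sum by \<open>j\<close> and writing \<open>j\<close> as the
  sum of first-letter degrees over the rotations of each word removes the denominators, as
  \<open>sym_sign\<close> is constant along rotations. Characteristic 0 turns the result into an
  identity of integers.\<close>

lemma sum_sym_sign_zero:
  assumes "(\<Sum>w\<in>cyc j. (-1) ^ length w * (\<Sum>i<length w. if rotate i w = w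
      then (-1) ^ ((length w - 1) * i) else 0) / of_nat (length w)) = (0 :: 'k)"
  shows "(\<Sum>w\<in>cyc j. sym_sign w * int (dg (hd w))) = 0"
proof -
  have s: "of_int (sym_sign w) = ((-1) ^ length w * (\<Sum>i<length w. if rotate i w = w
      then (-1) ^ ((length w - 1) * i) else 0) :: 'k)" for w
    by (simp add: sym_sign_def if_distrib[of of_int] cong: if_cong)
  define g where "g = (\<lambda>w. of_int (sym_sign w) * of_nat (dg (hd w)) :: 'k)"
  have hds: "(\<Sum>p<length w. of_nat (dg (hd (rotate p w)))) = (of_nat j :: 'k)" if "w \<in> cyc j" for w
  proof -
    have "(\<Sum>p<length w. dg (hd (rotate p w))) = (\<Sum>p<length w. dg (w ! p))"
      by (intro sum.cong refl) (subst hd_rotate_conv_nth; auto)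
    also have "\<dots> = sum_list (map dg w)" by (simp add: sum_list_sum_nth lessThan_atLeast0)
    also have "\<dots> = j" using that by (simp add: cyc_def)
    finally show ?thesis by (metis of_nat_sum)
  qed
  have "of_int (\<Sum>w\<in>cyc j. sym_sign w * int (dg (hd w))) = (\<Sum>w\<in>cyc j. g w)"
    by (simp add: g_def)
  also have "\<dots> = (\<Sum>w\<in>cyc j. (\<Sum>p<length w. g (rotate p w)) / of_nat (length w))"
    by (rule sum_rotations[symmetric])
  also have "\<dots> = (\<Sum>w\<in>cyc j. of_nat j * (of_int (sym_sign w) / of_nat (length w)))"
    by (intro sum.cong refl) (simp add: g_def sym_sign_rotate sum_distrib_left[symmetric] hds)
  also have "\<dots> = of_nat j * 0"
    unfolding sum_distrib_left[symmetric] s using assms by simp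
  finally have "of_int (\<Sum>w\<in>cyc j. sym_sign w * int (dg (hd w))) = (0 :: 'k)"
    by (simp only: mult_zero_right)
  then show ?thesis by (simp only: of_int_eq_0_iff)
qed

lemma cyc_concat_replicate:
  assumes "0 < n" "u \<in> cyc g"
  shows "concat (replicate n u) \<in> cyc (n * g)"
proof -
  obtain a where a: "path a a u" using assms(2) by (auto simp: cyc_def)
  have "path a a (concat (replicate k u))" for k
    by (induction k) (use a in \<open>auto simp: path_append\<close>)
  moreover have "sum_list (map dg (concat (replicate k u))) = k * g" for k
    by (induction k) (use assms(2) in \<open>auto simp: cyc_def\<close>)
  moreover have "concat (replicate n u) \<noteq> []"
    using assms by (cases n) (auto simp: cyc_def)
  ultimately show ?thesis unfolding cyc_def by blast
qed

lemma cyc_root: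
  assumes "concat (replicate n u) \<in> cyc j"
  shows "j = n * sum_list (map dg u)" "u \<in> cyc (sum_list (map dg u))"
proof -
  have "sum_list (map dg (concat (replicate k u))) = k * sum_list (map dg u)" for k
    by (induction k) auto
  then show "j = n * sum_list (map dg u)" using assms by (auto simp: cyc_def)
  obtain k where k: "n = Suc k" using assms by (cases n) (auto simp: cyc_def)
  have u: "u \<noteq> []" using assms by (auto simp: cyc_def)
  obtain a e where p: "path a e u" "path e a (concat (replicate k u))"
    using assms k by (auto simp: cyc_def path_append)
  \<comment> \<open>A second copy of \<open>u\<close> would start at \<open>e\<close> with the first
    letter of \<open>u\<close>, whose source is \<open>a\<close>; with no further copy the word
    itself closes up.\<close>
  have "e = a"
  proof (cases k)
    case (Suc k')
    then have "path e a (u @ concat (replicate k' u))" using p(2) by simp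
    then obtain f where "path e f u" by (auto simp: path_append)
    then show ?thesis using path_ends[OF p(1) u] path_ends[of e f u] u by simp
  qed (use p in simp)
  then show "u \<in> cyc (sum_list (map dg u))" using p u by (auto simp: cyc_def)
qed

text \<open>The index 0 is traded for the full turn, which carries the same sign, so that after
  division by the gcd with the length the indices range over totatives.\<close>

lemma sym_sign_alt:
  assumes "w \<noteq> []"
  shows "sym_sign w = (\<Sum>i | i \<in> {0<..length w} \<and> rotate i w = w.
      (-1) ^ length w * (-1) ^ ((length w - 1) * i))"
proof -
  define F where "F = (\<lambda>i. if rotate i w = w then (-1) ^ ((length w - 1) * i) else (0::int))"
  have "F (length w) = F 0"
    using sign_pred_mult[of "length w", where 'k = real]
    by (simp add: F_def minus_one_power_iff split: if_splits)
  moreover have "(\<Sum>i<length w. F i) + F (length w) = F 0 + (\<Sum>i<length w. F (Suc i))"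
    using sum.lessThan_Suc_shift[of F "length w"] by simp
  ultimately have "(\<Sum>i<length w. F i) = (\<Sum>i<length w. F (Suc i))" by simp
  also have "\<dots> = (\<Sum>i\<in>{0<..length w}. F i)"
    by (rule sum.reindex_bij_witness[of _ "\<lambda>i. i - 1" Suc]) auto
  also have "\<dots> = (\<Sum>i | i \<in> {0<..length w} \<and> rotate i w = w. (-1) ^ ((length w - 1) * i))"
    unfolding F_def by (rule sum.inter_filter[symmetric]) simp
  finally show ?thesis by (simp add: sym_sign_def F_def sum_distrib_left)
qed

text \<open>A word with a rotation \<open>i\<close> fixing it amounts to a block \<open>u\<close> of
  length \<open>gcd i (length w)\<close>, the number \<open>n\<close> of its repetitions, and a
  shift by \<open>a\<close> blocks with \<open>a\<close> prime to \<open>n\<close>. By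
  \<open>period_sign\<close> the summand depends on \<open>u\<close> only, so the
  \<open>totient n\<close> values of \<open>a\<close> contribute equally.\<close>

lemma sum_sym_sign:
  assumes "0 < j"
  shows "(\<Sum>w\<in>cyc j. sym_sign w * int (dg (hd w)))
       = (\<Sum>n | n dvd j. int (totient n) * walk_sum (j div n))"
proof -
  define val where "val = (\<lambda>(w :: nat list, i). (-1) ^ length w * (-1) ^ ((length w - 1) * i) * int (dg (hd w)))"
  define A where "A = (SIGMA w : cyc j. {i \<in> {0<..length w}. rotate i w = w})"
  define B where "B = (SIGMA n : {n. n dvd j}. totatives n \<times> cyc (j div n))"
  have "(\<Sum>w\<in>cyc j. sym_sign w * int (dg (hd w)))
      = (\<Sum>w\<in>cyc j. \<Sum>i\<in>{i \<in> {0<..length w}. rotate i w = w}. val (w, i))"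
    by (intro sum.cong refl) (auto simp: sym_sign_alt val_def sum_distrib_right cyc_def)
  also have "\<dots> = (\<Sum>x\<in>A. val x)"
    unfolding A_def by (subst sum.Sigma) (auto simp: finite_cyc)
  also have "\<dots> = (\<Sum>(n, a, u)\<in>B. (-1) ^ length u * int (dg (hd u)))"
  proof (rule sum.reindex_bij_witness[where
      j = "\<lambda>(w, i). (length w div gcd i (length w), i div gcd i (length w), take (gcd i (length w)) w)"
      and i = "\<lambda>(n, a, u). (concat (replicate n u), a * length u)"])
    fix x assume "x \<in> A"
    then obtain w i where x: "x = (w, i)" and w: "w \<in> cyc j" and i: "0 < i" "i \<le> length w" "rotate i w = w"
      by (auto simp: A_def)
    define g where "g = gcd i (length w)"
    define n where "n = length w div g"
    define u where "u = take g w"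
    have g: "0 < g" "g dvd i" "g dvd length w" using i by (auto simp: g_def)
    have len: "length w = g * n" using g by (simp add: n_def)
    have n: "0 < n" using len i by (cases n) auto
    have wu: "w = concat (replicate n u)"
      unfolding u_def by (rule rotate_period_concat[OF _ len]) (simp add: g_def rotate_gcd i)
    have lu: "length u = g" using len n by (simp add: u_def)
    have ia: "i = i div g * g" using g by simp
    have jn: "j = n * sum_list (map dg u)" and uc: "u \<in> cyc (sum_list (map dg u))"
      using cyc_root[of n u j] w wu by auto
    have cop: "coprime (i div g) n"
      unfolding n_def g_def by (rule div_gcd_coprime) (use i in auto)
    have tot: "i div g \<in> totatives n"
    proof -
      have "i div g \<le> n" using i by (simp add: n_def div_le_mono)
      moreover have "0 < i div g" using ia i(1) by (cases "i div g") auto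
      ultimately show ?thesis using cop by (simp add: in_totatives_iff)
    qed
    show "(case case x of (w, i) \<Rightarrow> (length w div gcd i (length w), i div gcd i (length w), take (gcd i (length w)) w)
        of (n, a, u) \<Rightarrow> (concat (replicate n u), a * length u)) = x"
      by (simp only: x prod.case g_def[symmetric] n_def[symmetric] u_def[symmetric] wu[symmetric]
          lu ia[symmetric])
    show "(case x of (w, i) \<Rightarrow> (length w div gcd i (length w), i div gcd i (length w), take (gcd i (length w)) w)) \<in> B"
      unfolding x prod.case g_def[symmetric] n_def[symmetric] u_def[symmetric]
      using tot uc jn n by (simp add: B_def)
    have "val (w, i) = (-1) ^ length u * int (dg (hd u))"
    proof -
      have "hd w = hd u" using wu n lu g by (cases n) (auto simp: hd_append)
      moreover have "(-1) ^ length w * (-1) ^ ((length w - 1) * i) = ((-1) ^ g :: int)"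
        using period_sign[OF cop n g(1)] ia len by (simp add: mult.commute)
      ultimately show ?thesis by (simp add: val_def lu)
    qed
    then show "(case case x of (w, i) \<Rightarrow> (length w div gcd i (length w), i div gcd i (length w), take (gcd i (length w)) w)
        of (n, a, u) \<Rightarrow> (-1) ^ length u * int (dg (hd u))) = val x"
      by (simp only: x prod.case g_def[symmetric] n_def[symmetric] u_def[symmetric])
  next
    fix y assume "y \<in> B"
    then obtain n a u where y: "y = (n, a, u)" and n: "n dvd j" and a: "a \<in> totatives n"
      and u: "u \<in> cyc (j div n)" by (auto simp: B_def)
    have n0: "0 < n" using n assms by (auto intro: Nat.gr0I)
    have lu: "0 < length u" using u by (auto simp: cyc_def)
    have a': "0 < a" "a \<le> n" "coprime a n" using a by (auto simp: in_totatives_iff)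
    have g: "gcd (a * length u) (n * length u) = length u"
      using gcd_mult_distrib_nat[of "length u" a n] coprime_imp_gcd_eq_1[OF a'(3)]
      by (simp only: mult.commute[of a] mult.commute[of n] mult_1_right)
    have "take (length u) (concat (replicate n u)) = u" using n0 by (cases n) auto
    then show "(case case y of (n, a, u) \<Rightarrow> (concat (replicate n u), a * length u)
        of (w, i) \<Rightarrow> (length w div gcd i (length w), i div gcd i (length w), take (gcd i (length w)) w)) = y"
      using g lu by (simp add: y length_concat_replicate)
    have "concat (replicate n u) \<in> cyc j"
      using cyc_concat_replicate[OF n0 u] n by simp
    then show "(case y of (n, a, u) \<Rightarrow> (concat (replicate n u), a * length u)) \<in> A"
      using a' lu by (simp add: y A_def length_concat_replicate rotate_concat_replicate)
  qed
  also have "\<dots> = (\<Sum>n | n dvd j. \<Sum>(a, u)\<in>totatives n \<times> cyc (j div n). (-1) ^ length u * int (dg (hd u)))"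
    unfolding B_def using assms by (subst sum.Sigma) (auto simp: finite_cyc)
  also have "\<dots> = (\<Sum>n | n dvd j. int (totient n) * walk_sum (j div n))"
    by (intro sum.cong refl) (simp add: sum.cartesian_product[symmetric] walk_sum_def totient_def)
  finally show ?thesis .
qed

end

section \<open>Totient sums of periodic sequences\<close>

lemma sum_divisors_prime_power:
  fixes f :: "nat \<Rightarrow> 'a::comm_monoid_add"
  assumes q: "prime q" "\<not> q dvd k" and k: "0 < k"
  shows "(\<Sum>n | n dvd k * q ^ i. f n) = (\<Sum>e\<le>i. \<Sum>n | n dvd k. f (n * q ^ e))"
proof -
  have cop: "coprime n (q ^ e)" if "n dvd k" for n e
  proof -
    have "\<not> q dvd n" using that q(2) dvd_trans by blast
    then have "coprime q n" by (rule prime_imp_coprime[OF q(1)])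
    then have "coprime n q" by (simp only: coprime_commute)
    then show ?thesis by simp
  qed
  define h where "h = (\<lambda>(e, n). n * q ^ e)"
  have inj: "inj_on h ({..i} \<times> {n. n dvd k})"
    proof (rule inj_onI, clarsimp simp: h_def)
      fix e n e' n' assume n: "n dvd k" "n' dvd k" and eq: "n * q ^ e = n' * q ^ e'"
      have q0: "0 < q ^ e" for e using q(1) by (simp add: prime_gt_0_nat)
      have "n dvd n' * q ^ e'" by (metis eq dvd_triv_left)
      then have 1: "n dvd n'" using cop[OF n(1), of e'] coprime_dvd_mult_left_iff by blast
      have "n' dvd n * q ^ e" by (metis eq dvd_triv_left)
      then have "n' dvd n" using cop[OF n(2), of e] coprime_dvd_mult_left_iff by blast
      with 1 have nn: "n = n'" by (rule dvd_antisym)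
      have "n \<noteq> 0" using n(1) k by auto
      then have "q ^ e = q ^ e'" using eq nn by simp
      from prime_power_inj[OF q(1) this] show "e = e' \<and> n = n'" using nn by simp
    qed
  have img: "h ` ({..i} \<times> {n. n dvd k}) = {n. n dvd k * q ^ i}"
    proof (intro equalityI subsetI)
      fix x assume "x \<in> h ` ({..i} \<times> {n. n dvd k})"
      then show "x \<in> {n. n dvd k * q ^ i}" by (auto simp: h_def intro: mult_dvd_mono le_imp_power_dvd)
    next
      fix x assume "x \<in> {n. n dvd k * q ^ i}"
      then obtain a b where ab: "x = a * b" "a dvd k" "b dvd q ^ i"
        using division_decomp[of x k "q ^ i"] by auto
      then obtain e where "e \<le> i" "b = q ^ e" using divides_primepow_nat[OF q(1)] by auto
      then show "x \<in> h ` ({..i} \<times> {n. n dvd k})"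
        using ab by (auto simp: h_def intro!: image_eqI[of _ _ "(e, a)"])
    qed
  have "(\<Sum>e\<le>i. \<Sum>n | n dvd k. f (n * q ^ e)) = (\<Sum>x\<in>{..i} \<times> {n. n dvd k}. (f \<circ> h) x)"
    by (simp add: sum.cartesian_product case_prod_unfold h_def)
  also have "\<dots> = (\<Sum>n | n dvd k * q ^ i. f n)"
    unfolding img[symmetric] by (rule sum.reindex[OF inj, symmetric])
  finally show ?thesis ..
qed

text \<open>Along the powers of a large prime q the vanishing totient sums force the value 1 - q
times the initial one; but periodicity returns to the initial value at an exponent i with
q^i = 1 modulo the period.\<close>

lemma totient_sum_periodic:
  fixes s :: "nat \<Rightarrow> int" and l :: nat
  assumes per: "\<And>g. 0 < g \<Longrightarrow> [s (g + p) = s g] (mod int l)" and p: "0 < p" and l: "prime l"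
    and zero: "\<And>j. J < j \<Longrightarrow> (\<Sum>n | n dvd j. int (totient n) * s (j div n)) = 0"
    and k: "0 < k"
  shows "int l dvd s k"
proof -
  have per': "[s (g + t * p) = s g] (mod int l)" if "0 < g" for g t
  proof (induction t)
    case (Suc t)
    have "[s (g + t * p + p) = s (g + t * p)] (mod int l)" using that by (intro per) simp
    then show ?case using Suc by (simp add: add_ac) (metis cong_trans)
  qed simp
  have tot: "int l dvd (\<Sum>n | n dvd k. int (totient n) * s (k div n))" if k: "0 < k" for k
  proof -
    \<comment> \<open>Beyond \<open>J\<close> the totient sums vanish; beyond \<open>k\<close> and
      \<open>p\<close> the prime divides neither; beyond \<open>l\<close> it differs from
      \<open>l\<close>.\<close>
    obtain q where q: "prime q" "J + k + p + l < q" using bigger_prime by blast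
    have nq: "\<not> q dvd k" using q k by (auto dest: dvd_imp_le)
    \<comment> \<open>\<open>S i\<close> is the contribution of the divisors prime to
      \<open>q\<close>, and \<open>A i\<close> the whole totient sum at
      \<open>k * q ^ i\<close>.\<close>
    define S where "S = (\<lambda>i. \<Sum>n | n dvd k. int (totient n) * s ((k div n) * q ^ i))"
    define A where "A = (\<lambda>i. \<Sum>e\<le>i. int (totient (q ^ e)) * S (i - e))"
    have "(\<Sum>n | n dvd k * q ^ i. int (totient n) * s (k * q ^ i div n)) = A i" for i
    proof -
      have "int (totient (n * q ^ e)) * s (k * q ^ i div (n * q ^ e))
          = int (totient (q ^ e)) * (int (totient n) * s ((k div n) * q ^ (i - e)))"
        if "e \<le> i" "n dvd k" for e n
      proof -
        have "\<not> q dvd n" using nq that(2) dvd_trans by blast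
        then have "coprime q n" by (rule prime_imp_coprime[OF q(1)])
        then have "coprime n q" by (simp only: coprime_commute)
        then have "coprime n (q ^ e)" by simp
        moreover have "k * q ^ i div (n * q ^ e) = (k div n) * q ^ (i - e)"
        proof -
          have "q ^ i div q ^ e = q ^ (i - e)"
            using that(1) q(1) by (simp add: power_diff prime_gt_0_nat)
          moreover have "k * q ^ i div (n * q ^ e) = (k div n) * (q ^ i div q ^ e)"
            using that by (intro div_mult_div_if_dvd[symmetric] le_imp_power_dvd)
          ultimately show ?thesis by simp
        qed
        ultimately show ?thesis by (simp add: totient_mult_coprime)
      qed
      then show ?thesis
        unfolding sum_divisors_prime_power[OF q(1) nq k]
        by (simp add: A_def S_def sum_distrib_left)
    qed
    then have A0: "A (Suc i) = 0" for i
    proof -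
      have "J < q" using q by simp
      also have "q \<le> k * q ^ Suc i" using k q(1) prime_gt_0_nat[of q] by simp
      finally show ?thesis using zero \<open>\<And>i. _ = A i\<close> by metis
    qed
    \<comment> \<open>Passing from q^e to q^(e+1) multiplies the totient by q, except at e = 0,
      where q - 1 replaces q; that exception produces \<open>- S i\<close>.\<close>
    have AS: "A (Suc i) = int q * A i + S (Suc i) - S i" for i
    proof -
      have "A (Suc i) = S (Suc i) + (\<Sum>e\<le>i. int (totient (q ^ Suc e)) * S (i - e))"
        unfolding A_def by (subst sum.atMost_Suc_shift) simp
      also have "(\<Sum>e\<le>i. int (totient (q ^ Suc e)) * S (i - e))
          = (\<Sum>e\<le>i. int q * (int (totient (q ^ e)) * S (i - e)) - (if e = 0 then S i else 0))"
      proof (intro sum.cong refl)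
        fix e
        show "int (totient (q ^ Suc e)) * S (i - e)
            = int q * (int (totient (q ^ e)) * S (i - e)) - (if e = 0 then S i else 0)"
        proof (cases e)
          case 0
          then show ?thesis using q(1) prime_gt_0_nat[of q]
            by (simp add: totient_prime of_nat_diff algebra_simps)
        next
          case (Suc e')
          then show ?thesis using q(1) by (simp add: totient_power_Suc del: power_Suc) simp
        qed
      qed
      also have "\<dots> = int q * A i - S i"
        by (simp add: sum_subtractf A_def sum_distrib_left)
      finally show ?thesis by simp
    qed
    have "S (Suc i) = (1 - int q) * S 0" for i
    proof (induction i)
      case 0
      have "A 0 = S 0" by (simp add: A_def)
      then show ?case using AS[of 0] A0[of 0] by (simp add: algebra_simps)
    next
      case (Suc i)
      then show ?case using AS[of "Suc i"] A0[of i] A0[of "Suc i"] by simp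
    qed
    moreover define i where "i = totient p"
    moreover have "0 < i" using p by (simp add: i_def)
    ultimately have Si: "S i = (1 - int q) * S 0" by (metis Suc_pred')
    have "coprime q p"
      using q p by (intro prime_imp_coprime) (auto dest: dvd_imp_le)
    then have "[q ^ i = 1] (mod p)" unfolding i_def by (rule euler_theorem)
    moreover have "1 \<le> q ^ i" using q(1) prime_gt_0_nat[of q] by simp
    ultimately obtain t where t: "q ^ i = 1 + t * p"
      by (metis cong_to_1_nat cong_sym dvdE le_add_diff_inverse mult.commute)
    have "[S i = S 0] (mod int l)"
      unfolding S_def
    proof (intro cong_sum cong_mult cong_refl)
      fix n assume "n \<in> {n. n dvd k}"
      then have "0 < k div n" using k by (auto simp: dvd_imp_le div_greater_zero_iff intro: Nat.gr0I)
      from per'[OF this, of "(k div n) * t"]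
      show "[s (k div n * q ^ i) = s (k div n * q ^ 0)] (mod int l)"
        by (simp add: t algebra_simps)
    qed
    then have "int l dvd int q * S 0"
      unfolding Si cong_iff_dvd_diff by (simp add: algebra_simps)
    moreover have "\<not> int l dvd int q"
    proof
      assume "int l dvd int q"
      then have "l = q" using q(1) l primes_dvd_imp_eq by auto
      then show False using q by simp
    qed
    ultimately have "int l dvd S 0" using l prime_dvd_mult_iff[of "int l"] by auto
    then show ?thesis by (simp add: S_def)
  qed
  \<comment> \<open>The divisor 1 contributes \<open>s k\<close> itself, and all other divisors
    involve \<open>s\<close> at smaller arguments, so strong induction applies.\<close>
  show ?thesis using k
  proof (induction k rule: less_induct)
    case (less k)
    have "{n. n dvd k} = insert 1 {n. n dvd k \<and> n \<noteq> 1}" by auto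
    moreover have fin: "finite {n. n dvd k \<and> n \<noteq> 1}"
      using finite_divisors_nat[of k] less.prems by (auto intro: finite_subset[rotated])
    ultimately have eq: "(\<Sum>n | n dvd k. int (totient n) * s (k div n))
        = s k + (\<Sum>n | n dvd k \<and> n \<noteq> 1. int (totient n) * s (k div n))"
      using fin by simp
    have rest: "int l dvd (\<Sum>n | n dvd k \<and> n \<noteq> 1. int (totient n) * s (k div n))"
    proof (rule dvd_sum)
      fix n assume n: "n \<in> {n. n dvd k \<and> n \<noteq> 1}"
      then have "0 < n" "n \<noteq> 1" "n dvd k" using less.prems by (auto intro: Nat.gr0I)
      then have "k div n < k" "0 < k div n"
        using less.prems by (auto simp: dvd_imp_le div_greater_zero_iff intro!: div_less_dividend)
      from less.IH[OF this] show "int l dvd int (totient n) * s (k div n)" by simp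
    qed
    show ?case using tot[OF less.prems] unfolding eq dvd_add_left_iff[OF rest] .
  qed
qed

section \<open>Signed path counts\<close>

context path_algebra
begin

definition paths :: "nat \<Rightarrow> nat \<Rightarrow> nat \<Rightarrow> nat list set" where
  "paths g a b = {u. path a b u \<and> sum_list (map dg u) = g}"

text \<open>Negative degrees are allowed so that the recursion below needs no case distinction.\<close>

definition path_sum :: "int \<Rightarrow> nat \<Rightarrow> nat \<Rightarrow> int" where
  "path_sum g a b = (if g < 0 then 0 else (\<Sum>u\<in>paths (nat g) a b. (-1) ^ length u))"

lemma finite_paths: "finite (paths g a b)"
proof (rule finite_subset)
  show "paths g a b \<subseteq> {w. set w \<subseteq> {m..<D} \<and> length w \<le> g}"
    using path_set length_le_degree by (fastforce simp: paths_def)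
qed (simp add: finite_lists_length_le)

lemma sum_Cons_words:
  assumes "finite X" "\<And>x. x \<in> X \<Longrightarrow> finite (Q x)"
  shows "(\<Sum>w\<in>{x # u | x u. x \<in> X \<and> u \<in> Q x}. F w) = (\<Sum>x\<in>X. \<Sum>u\<in>Q x. (F (x # u) :: int))"
proof -
  have "(\<Sum>x\<in>X. \<Sum>u\<in>Q x. F (x # u)) = (\<Sum>(x, u)\<in>Sigma X Q. F (x # u))"
    using assms by (simp add: sum.Sigma)
  also have "\<dots> = (\<Sum>w\<in>{x # u | x u. x \<in> X \<and> u \<in> Q x}. F w)"
    by (rule sum.reindex_bij_witness[where i = "\<lambda>w. (hd w, tl w)" and j = "\<lambda>(x, u). x # u"]) auto
  finally show ?thesis ..
qed

lemma path_sum_0: "path_sum 0 a b = (if a = b then 1 else 0)"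
proof -
  have "paths 0 a b = (if a = b then {[]} else {})"
  proof -
    have "u \<in> paths 0 a b \<longleftrightarrow> a = b \<and> u = []" for u
      by (cases u) (auto simp: paths_def dest: pos)
    then show ?thesis by auto
  qed
  then show ?thesis by (simp add: path_sum_def)
qed

text \<open>Splitting off the first letter. Equivalently, the matrices \<open>path_sum g\<close> are
  the coefficients of (1 + M(t))^-1, where M(t) is the matrix of positive letters weighted by
  t^degree.\<close>

lemma path_sum_rec:
  assumes "0 < g"
  shows "path_sum g a b = - (\<Sum>x | x \<in> {m..<D} \<and> src x = a. path_sum (g - int (dg x)) (tgt x) b)"
proof -
  define X where "X = {x. x \<in> {m..<D} \<and> src x = a \<and> int (dg x) \<le> g}"
  have eq: "paths (nat g) a b = {x # u | x u. x \<in> X \<and> u \<in> paths (nat (g - int (dg x))) (tgt x) b}"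
  proof (intro equalityI subsetI)
    fix w assume "w \<in> paths (nat g) a b"
    then show "w \<in> {x # u | x u. x \<in> X \<and> u \<in> paths (nat (g - int (dg x))) (tgt x) b}"
      using assms by (cases w) (auto simp: paths_def X_def)
  next
    fix w assume "w \<in> {x # u | x u. x \<in> X \<and> u \<in> paths (nat (g - int (dg x))) (tgt x) b}"
    then show "w \<in> paths (nat g) a b" by (auto simp: paths_def X_def)
  qed
  have "path_sum g a b = (\<Sum>w\<in>paths (nat g) a b. (-1) ^ length w)"
    using assms by (simp add: path_sum_def)
  also have "\<dots> = (\<Sum>x\<in>X. \<Sum>u\<in>paths (nat (g - int (dg x))) (tgt x) b. (-1) ^ length (x # u))"
    unfolding eq by (rule sum_Cons_words) (auto simp: X_def finite_paths)
  also have "\<dots> = (\<Sum>x\<in>X. - path_sum (g - int (dg x)) (tgt x) b)"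
    by (intro sum.cong refl) (auto simp: path_sum_def X_def sum_negf)
  also have "\<dots> = (\<Sum>x | x \<in> {m..<D} \<and> src x = a. - path_sum (g - int (dg x)) (tgt x) b)"
    by (intro sum.mono_neutral_left) (auto simp: X_def path_sum_def)
  finally show ?thesis by (simp add: sum_negf)
qed

text \<open>Cutting a closed walk after its first letter; in generating functions this is minus the
  trace of t M' (1 + M)^-1.\<close>

lemma walk_sum_rec:
  "walk_sum g = - (\<Sum>x\<in>{m..<D}. int (dg x) * path_sum (int g - int (dg x)) (tgt x) (src x))"
proof -
  define X where "X = {x. x \<in> {m..<D} \<and> dg x \<le> g}"
  have eq: "cyc g = {x # u | x u. x \<in> X \<and> u \<in> paths (nat (int g - int (dg x))) (tgt x) (src x)}"
  proof (intro equalityI subsetI)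
    fix w assume "w \<in> cyc g"
    then show "w \<in> {x # u | x u. x \<in> X \<and> u \<in> paths (nat (int g - int (dg x))) (tgt x) (src x)}"
      by (cases w) (auto simp: paths_def X_def cyc_def)
  next
    fix w assume "w \<in> {x # u | x u. x \<in> X \<and> u \<in> paths (nat (int g - int (dg x))) (tgt x) (src x)}"
    then show "w \<in> cyc g" by (auto simp: paths_def X_def cyc_def)
  qed
  have "walk_sum g = (\<Sum>x\<in>X. \<Sum>u\<in>paths (nat (int g - int (dg x))) (tgt x) (src x).
      (-1) ^ length (x # u) * int (dg (hd (x # u))))"
    unfolding walk_sum_def eq by (rule sum_Cons_words) (auto simp: X_def finite_paths)
  also have "\<dots> = (\<Sum>x\<in>X. - (int (dg x) * path_sum (int g - int (dg x)) (tgt x) (src x)))"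
    by (intro sum.cong refl)
       (auto simp: path_sum_def X_def sum_negf sum_distrib_left mult.commute)
  also have "\<dots> = (\<Sum>x\<in>{m..<D}. - (int (dg x) * path_sum (int g - int (dg x)) (tgt x) (src x)))"
    by (intro sum.mono_neutral_left) (auto simp: X_def path_sum_def)
  finally show ?thesis by (simp add: sum_negf)
qed

end

text \<open>When the letters of top degree are exactly one loop per vertex, the recursion for the
signed path counts can also be run backwards.\<close>

locale top_loop_path_algebra = path_algebra +
  fixes N :: nat and top :: "nat \<Rightarrow> nat"
  assumes N: "0 < N" "\<And>i. i < D \<Longrightarrow> dg i \<le> N"
    and top: "\<And>a. a < m \<Longrightarrow> top a \<in> {m..<D} \<and> src (top a) = a \<and> tgt (top a) = a \<and> dg (top a) = N"
    and top_unique: "\<And>i. i < D \<Longrightarrow> dg i = N \<Longrightarrow> \<exists>a<m. i = top a"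
begin

lemma path_sum_back:
  assumes "0 < g" "a < m"
  shows "path_sum (g - int N) a b = - path_sum g a b
    - (\<Sum>x | x \<in> {m..<D} \<and> src x = a \<and> dg x < N. path_sum (g - int (dg x)) (tgt x) b)"
proof -
  have "{x. x \<in> {m..<D} \<and> src x = a} = insert (top a) {x. x \<in> {m..<D} \<and> src x = a \<and> dg x < N}"
  proof (intro equalityI subsetI)
    fix x assume x: "x \<in> {x. x \<in> {m..<D} \<and> src x = a}"
    show "x \<in> insert (top a) {x. x \<in> {m..<D} \<and> src x = a \<and> dg x < N}"
    proof (cases "dg x = N")
      case True
      then obtain e where "e < m" "x = top e" using top_unique x by auto
      then show ?thesis using x top by auto
    next
      case False
      then show ?thesis using N(2)[of x] x by auto
    qed
  qed (use top[OF assms(2)] in auto)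
  then show ?thesis
    using top[OF assms(2)] by (subst path_sum_rec[OF assms(1), of a]) simp
qed

text \<open>A window of \<open>N\<close> consecutive matrices modulo \<open>l\<close> has finitely
  many states, so two windows agree, and running backwards moves the coincidence down to 0. The
  claim starts at \<open>0 < g\<close> because \<open>walk_sum 0\<close> is 0, whereas the period
  yields the formal value \<open>N * m\<close>.\<close>

lemma walk_sum_periodic:
  fixes l :: nat
  assumes "1 < l"
  obtains p where "0 < p" "\<And>g. 0 < g \<Longrightarrow> [walk_sum (g + p) = walk_sum g] (mod int l)"
    "[walk_sum p = int (N * m)] (mod int l)"
proof -
  have ms: "0 < dg x" "dg x \<le> N" "tgt x < m" "src x < m" if "x \<in> {m..<D}" for x
    using that pos[of x] N(2)[of x] tgt_less[of x] src_less[of x] by auto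
  define St where "St = (\<lambda>g :: nat. restrict (\<lambda>(h, a, b). path_sum (int g - int h) a b mod int l)
    ({..<N} \<times> {..<m} \<times> {..<m}))"
  have "range St \<subseteq> ({..<N} \<times> {..<m} \<times> {..<m}) \<rightarrow>\<^sub>E {0..<int l}"
    using assms by (auto simp: St_def restrict_PiE_iff image_subset_iff simp del: PiE_iff)
  then have "finite (range St)" by (rule finite_subset) (intro finite_PiE; simp)
  then have "\<not> inj St" using finite_imageD[of St UNIV] by auto
  then obtain g1 g2 where g12: "g1 < g2" "St g1 = St g2"
    unfolding inj_def by (metis linorder_neqE_nat)
  define Eq where "Eq = (\<lambda>g g' :: int. \<forall>h<N. \<forall>a<m. \<forall>b<m.
    [path_sum (g - int h) a b = path_sum (g' - int h) a b] (mod int l))"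
  have Eq0: "Eq (int g1) (int g2)"
    unfolding Eq_def cong_def
  proof (intro allI impI)
    fix h a b assume "h < N" "a < m" "b < m"
    then show "path_sum (int g1 - int h) a b mod int l = path_sum (int g2 - int h) a b mod int l"
      using fun_cong[OF g12(2), of "(h, a, b)"] by (simp add: St_def)
  qed
  have EqD: "[path_sum (g - int h) a b = path_sum (g' - int h) a b] (mod int l)"
    if "Eq g g'" "h < N" "a < m" "b < m" for g g' h a b
    using that by (simp add: Eq_def)
  have backward: "Eq (g - 1) (g' - 1)" if E: "Eq g g'" and pos: "0 < g" "0 < g'" for g g'
    unfolding Eq_def
  proof (intro allI impI)
    fix h a b assume h: "h < N" "a < m" "b < m"
    show "[path_sum (g - 1 - int h) a b = path_sum (g' - 1 - int h) a b] (mod int l)"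
    proof (cases "Suc h < N")
      case True
      then show ?thesis using EqD[OF E True h(2,3)] by (simp add: algebra_simps)
    next
      case False
      then have N': "N = Suc h" using h by simp
      have "[path_sum (g - int N) a b = path_sum (g' - int N) a b] (mod int l)"
        unfolding path_sum_back[OF pos(1) h(2)] path_sum_back[OF pos(2) h(2)]
        using EqD[OF E _ h(2,3), of 0] N(1)
        by (intro cong_diff cong_sum EqD[OF E] h(3))
           (auto simp: tgt_less cong_minus_minus_iff)
      then show ?thesis by (simp add: N' algebra_simps)
    qed
  qed
  have forward: "Eq (g + 1) (g' + 1)" if E: "Eq g g'" and pos: "0 \<le> g" "0 \<le> g'" for g g'
    unfolding Eq_def
  proof (intro allI impI)
    fix h a b assume h: "h < N" "a < m" "b < m"
    show "[path_sum (g + 1 - int h) a b = path_sum (g' + 1 - int h) a b] (mod int l)"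
    proof (cases h)
      case (Suc h')
      then show ?thesis using EqD[OF E, of h' a b] h by simp
    next
      case 0
      have "[path_sum (g + 1 - int (dg x)) (tgt x) b = path_sum (g' + 1 - int (dg x)) (tgt x) b] (mod int l)"
        if "x \<in> {x. x \<in> {m..<D} \<and> src x = a}" for x
      proof -
        have x: "x \<in> {m..<D}" using that by simp
        have "int (dg x) = 1 + int (dg x - 1)" using ms(1)[OF x] by simp
        then have "g + 1 - int (dg x) = g - int (dg x - 1)" "g' + 1 - int (dg x) = g' - int (dg x - 1)"
          by linarith+
        moreover have "dg x - 1 < N" using ms(1,2)[OF x] by simp
        ultimately show ?thesis using EqD[OF E _ ms(3)[OF x] h(3)] by (simp only:)
      qed
      then have "[path_sum (g + 1) a b = path_sum (g' + 1) a b] (mod int l)"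
        using pos by (subst (1 2) path_sum_rec) (auto simp: cong_minus_minus_iff intro!: cong_sum)
      then show ?thesis by (simp add: 0)
    qed
  qed
  have "Eq (int (g1 - k)) (int (g2 - k))" if "k \<le> g1" for k
    using that
  proof (induction k)
    case (Suc k)
    then show ?case using backward[of "int (g1 - k)" "int (g2 - k)"] g12(1)
      by (simp add: of_nat_diff algebra_simps)
  qed (use Eq0 in simp)
  \<comment> \<open>The window at 0 consists of the identity matrix and, in negative degrees, zeros.
    Its repetition at the period later determines \<open>walk_sum p\<close>.\<close>
  from this[of g1] have E0: "Eq 0 (int (g2 - g1))" by simp
  define p where "p = g2 - g1"
  have p: "0 < p" using g12 by (simp add: p_def)
  have E: "Eq (int g) (int (g + p))" for g
  proof (induction g)
    case 0
    then show ?case using E0 by (simp add: p_def)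
  next
    case (Suc g)
    then show ?case using forward[of "int g" "int (g + p)"] by (simp add: algebra_simps)
  qed
  show ?thesis
  proof (rule that[OF p])
    fix g :: nat assume g: "0 < g"
    show "[walk_sum (g + p) = walk_sum g] (mod int l)"
      unfolding walk_sum_rec
    proof (rule cong_minus_minus_iff[THEN iffD2], intro cong_sum cong_mult cong_refl)
      fix x assume x: "x \<in> {m..<D}"
      \<comment> \<open>A window reaches back only \<open>N - 1\<close> steps, so a letter of degree
        \<open>N\<close> calls for the window at \<open>g - 1\<close>.\<close>
      have "[path_sum (int (g - 1) - int (dg x - 1)) (tgt x) (src x)
          = path_sum (int (g - 1 + p) - int (dg x - 1)) (tgt x) (src x)] (mod int l)"
        using ms[OF x] by (intro EqD[OF E]) auto
      moreover have "int (g - 1) - int (dg x - 1) = int g - int (dg x)"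
        "int (g - 1 + p) - int (dg x - 1) = int (g + p) - int (dg x)"
        using g ms(1)[OF x] by auto
      ultimately show "[path_sum (int (g + p) - int (dg x)) (tgt x) (src x)
          = path_sum (int g - int (dg x)) (tgt x) (src x)] (mod int l)"
        by (simp only: cong_sym_eq)
    qed
  next
    have small: "[path_sum (int p - int (dg x)) (tgt x) b = 0] (mod int l)"
      if "x \<in> {m..<D}" "dg x < N" "b < m" for x b
      using EqD[OF E[of 0], of "dg x" "tgt x" b] ms[OF that(1)] that
      by (simp add: path_sum_def[of "- int (dg x)"] cong_sym_eq)
    \<comment> \<open>Backward recursion at \<open>p\<close>: the value there is 1, as at 0, and the
      letters of lower degree contribute 0, which leaves -1.\<close>
    have big: "[path_sum (int p - int N) a a = - 1] (mod int l)" if a: "a < m" for a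
    proof -
      have 1: "[path_sum (int p) a a = 1] (mod int l)"
        using EqD[OF E[of 0], of 0 a a] N(1) a by (simp add: path_sum_0 cong_sym_eq)
      have "[(\<Sum>x | x \<in> {m..<D} \<and> src x = a \<and> dg x < N. path_sum (int p - int (dg x)) (tgt x) a)
          = (\<Sum>x | x \<in> {m..<D} \<and> src x = a \<and> dg x < N. 0)] (mod int l)"
        by (intro cong_sum small) (use a in auto)
      from cong_diff[OF cong_minus_minus_iff[THEN iffD2, OF 1] this]
      show ?thesis using p a by (simp add: path_sum_back)
    qed
    have "[(\<Sum>x\<in>{m..<D}. int (dg x) * path_sum (int p - int (dg x)) (tgt x) (src x))
        = (\<Sum>x\<in>{m..<D}. if dg x = N then - int N else 0)] (mod int l)"
    proof (rule cong_sum)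
      fix x assume x: "x \<in> {m..<D}"
      show "[int (dg x) * path_sum (int p - int (dg x)) (tgt x) (src x)
          = (if dg x = N then - int N else 0)] (mod int l)"
      proof (cases "dg x = N")
        case True
        then obtain a where "a < m" "x = top a" using top_unique[of x] x by auto
        then show ?thesis
          using True top[of a] cong_mult[OF cong_refl[of "int N" "int l"] big[of a]] by simp
      next
        case False
        then have "dg x < N" using ms(2)[OF x] by simp
        then show ?thesis
          using cong_mult[OF cong_refl[of "int (dg x)" "int l"] small[OF x _ ms(4)[OF x]]] False by simp
      qed
    qed
    also have "(\<Sum>x\<in>{m..<D}. if dg x = N then - int N else 0) = - int (N * m)"
    proof -
      have "{x \<in> {m..<D}. dg x = N} = top ` {..<m}"
        using top top_unique by force
      moreover have "inj_on top {..<m}" using top by (metis inj_onI lessThan_iff)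
      ultimately have "card {x \<in> {m..<D}. dg x = N} = m" by (simp add: card_image)
      then show ?thesis by (simp add: sum.If_cases Int_def)
    qed
    finally show "[walk_sum p = int (N * m)] (mod int l)"
      unfolding walk_sum_rec using cong_minus_minus_iff by fastforce
  qed
qed

lemma walk_sums_nonvanishing:
  "\<exists>j>J. (\<Sum>n | n dvd j. int (totient n) * walk_sum (j div n)) \<noteq> 0"
proof (rule ccontr)
  assume "\<not> ?thesis"
  then have zero: "\<And>j. J < j \<Longrightarrow> (\<Sum>n | n dvd j. int (totient n) * walk_sum (j div n)) = 0"
    by auto
  obtain l :: nat where l: "prime l" "N * m < l" using bigger_prime by blast
  obtain p where p: "0 < p" "\<And>g. 0 < g \<Longrightarrow> [walk_sum (g + p) = walk_sum g] (mod int l)"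
    "[walk_sum p = int (N * m)] (mod int l)"
    using walk_sum_periodic[of l] prime_gt_1_nat[OF l(1)] by blast
  have "int l dvd walk_sum p"
    by (rule totient_sum_periodic[OF p(2) p(1) l(1) zero p(1)])
  then have "int l dvd int (N * m)" using p(3) cong_dvd_iff[of "walk_sum p" "int (N * m)" "int l"]
    by (metis cong_dvd_iff cong_0_iff cong_sym cong_trans)
  then have "l dvd N * m" by (simp only: of_nat_dvd_iff)
  moreover have "0 < N * m" using N(1) m(1) by simp
  ultimately show False using l(2) by (auto dest: dvd_imp_le)
qed

end

section \<open>Trivial extensions have infinite Hochschild homology dimension\<close>

lemma (in top_loop_path_algebra) not_cexact_eventually:
  assumes "1 \<le> n0"
  shows "\<exists>n\<ge>n0. \<not> cexact c D n"
proof (rule ccontr)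
  assume "\<not> ?thesis"
  then have ex: "\<And>n. n \<ge> n0 \<Longrightarrow> cexact c D n" by auto
  \<comment> \<open>Letters have degree at most \<open>N\<close>, so beyond \<open>N * n0\<close>
    every word of \<open>cyc j\<close> has more than \<open>n0\<close> letters and the complex lies
    entirely in the exact range.\<close>
  obtain j where j: "N * n0 < j" "(\<Sum>n | n dvd j. int (totient n) * walk_sum (j div n)) \<noteq> 0"
    using walk_sums_nonvanishing by blast
  have long: "n0 < length w" if "w \<in> cyc j" for w
  proof -
    have "j \<le> N * length w" using degree_le[OF cyc_set[OF that] N(2)] that by (simp add: cyc_def)
    with j(1) have "N * n0 < N * length w" by (rule less_le_trans)
    then show ?thesis by simp
  qed
  from sum_sym_sign_zero[OF cyclic_trace_zero[OF ex assms long]]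
  show False using j sum_sym_sign[of j] by simp
qed

theorem theorem3p9:
  fixes c :: "'k::field_char_0 sc" and d :: nat and deg :: "nat \<Rightarrow> nat"
  assumes "alg_closed_field TYPE('k)"
    and "d > 0"
    and "fd_algebra c d"
    and "graded_by c d deg"
    and "deg0_iso_prod_field c d deg"
  shows "HHdim (triv_ext c d) (2 * d) = \<infinity>"
proof (rule ccontr)
  assume "HHdim (triv_ext c d) (2 * d) \<noteq> \<infinity>"
  then obtain K where K: "HHdim (triv_ext c d) (2 * d) = enat K" by auto
  have bound: "n \<le> K" if "HH_nonzero (triv_ext c d) (2 * d) n" for n
  proof -
    have "enat n \<le> HHdim (triv_ext c d) (2 * d)"
      unfolding HHdim_def using that by (intro Sup_upper) auto
    then show ?thesis by (simp add: K)
  qed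
  obtain m E where "deg0_split c d deg m E"
    using assms(5) by (auto simp: deg0_iso_prod_field_def)
  then interpret split_graded_algebra c d deg m E
    using assms by unfold_locales auto
  obtain c' n P Q src tgt dg where path: "path_algebra c' n m src tgt dg"
    and conj: "conj_sc n d P Q c c'" and PQ: "inv_mat n d P Q" and QP: "inv_mat d n Q P"
    using path_algebra_exists by blast
  interpret A: path_algebra c' n m src tgt dg by (rule path)
  interpret T: path_algebra "triv_ext c' n" "2 * n" m A.ext_src A.ext_tgt A.ext_dg
    by (rule A.path_algebra_triv_ext)
  \<comment> \<open>The loops of top degree are the duals of the idempotents.\<close>
  interpret T: top_loop_path_algebra "triv_ext c' n" "2 * n" m A.ext_src A.ext_tgt A.ext_dg
    A.top_deg "\<lambda>a. n + a"
  proof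
    show "0 < A.top_deg" by (simp add: A.top_deg_def)
    show "A.ext_dg i \<le> A.top_deg" if "i < 2 * n" for i using that by (rule A.ext_dg_le)
    show "n + a \<in> {m..<2 * n} \<and> A.ext_src (n + a) = a \<and> A.ext_tgt (n + a) = a \<and> A.ext_dg (n + a) = A.top_deg"
      if "a < m" for a
      using that A.m by (simp add: A.ext_src_def A.ext_tgt_def A.ext_dg_def A.idem)
    show "\<exists>a<m. i = n + a" if "i < 2 * n" "A.ext_dg i = A.top_deg" for i
      using that A.ext_dg_eq_top by blast
  qed
  \<comment> \<open>\<open>Suc K\<close> exceeds every degree of nonzero homology and is at least 1,
    as the passage to cochains demands.\<close>
  obtain k where k: "Suc K \<le> k" "\<not> cexact (triv_ext c' n) (2 * n) k"
    using T.not_cexact_eventually[of "Suc K"] by auto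
  have "\<not> HH_nonzero (triv_ext c d) (2 * d) k" using bound[of k] k(1) by auto
  then have "cexact (triv_ext c d) (2 * d) k" using k(1) by (intro HH_zero_cexact) auto
  then show False using cexact_triv_ext_transfer[OF conj PQ QP] k(2) by blast
qed

end
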